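(* Let $X$ be an $n$-dimensional normal random vector with mean $\mu$ and non-singular covariance matrix $\Sigma$, and let $X(1),X(2),\dots$ be i.i.d. copies of $X$. For $N\ge 1$ set $\bar X=\frac1N\sum_{k=1}^N X(k)$ and $\tilde X^{(1)}(k)=X(k)-\bar X+\mu$. (i) $X$ has the first order asymptotic universal moment matching property. Moreover, for every smooth function $f:\mathbb{R}^n\to\mathbb{R}$ with compact support, $$\mathrm{Var}\Big[\frac1N\sum_{k=1}^N f(\tilde X^{(1)}(k))\Big]=\frac{A_N}{N}\Big(\mathrm{Var}[f(X)]-\mathbb{E}[\partial f(X)]\,\Sigma\,\mathbb{E}[\partial f(X)]^{\mathrm T}\Big),$$ where $A_N=1+\mathrm{O}(N^{-1/2})$ as $N\to\infty$. (ii) Conversely, let $X$ be a continuous $n$-dimensional random vector with $\mathbb{E}(|X|^2)<\infty$, non-singular covariance matrix and differentiable density $p$. If $X$ has the first order asymptotic universal moment matching property, then $X$ is a normal distribution.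
   Context: For a random vector $X$ with density $p$, $\mathbb{E}|X|^2<\infty$, mean $\mu$ and non-singular covariance $\Sigma$, let $X(1),\dots,X(N)$ be i.i.d. copies of $X$, $\bar X=\frac1N\sum_{k=1}^NX(k)$, and $\tilde X^{(1)}(k)=X(k)-\bar X+\mu$ (first order moment matched samples). $X$ is said to have the first order asymptotic universal moment matching property if (a) for every smooth function $f$ with compact support $\mathrm{supp}(f)\subseteq\mathrm{supp}(p)^{o}$ (interior of the support of $p$) there are constants $A_N$ with $\lim_{N\to\infty}A_N=1$ such that $\mathrm{Var}\big[\frac1N\sum_{k=1}^Nf(\tilde X^{(1)}(k))\big]\le \frac{A_N}{N}\mathrm{Var}[f(X)]$ for all $N$, and (b) for some such $f$, $\lim_{N\to\infty}N\,\mathrm{Var}\big[\frac1N\sum_{k=1}^Nf(\tilde X^{(1)}(k))\big]<\mathrm{Var}[f(X)]$. Here $\partial f(x)$ denotes the row vector $(\partial_1f(x),\dots,\partial_nf(x))$. $A_N=1+\mathrm{O}(N^{-1/2})$ means $|A_N-1|\le CN^{-1/2}$ for some constant $C$ and all large $N$. *)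

theory Defs
  imports "HOL-Probability.Probability" "HOL-Library.Landau_Symbols"
begin

coinductive smooth_fn :: "('a::euclidean_space \<Rightarrow> real) \<Rightarrow> bool" where
  "(\<forall>x. f differentiable (at x)) \<Longrightarrow>
   (\<forall>v. smooth_fn (\<lambda>x. frechet_derivative f (at x) v)) \<Longrightarrow> smooth_fn f"

definition fsupp :: "('a::topological_space \<Rightarrow> real) \<Rightarrow> 'a set" where
  "fsupp f = closure {x. f x \<noteq> 0}"

definition pderiv_i :: "(real^'n \<Rightarrow> real) \<Rightarrow> 'n \<Rightarrow> real^'n \<Rightarrow> real" where
  "pderiv_i f i x = frechet_derivative f (at x) (axis i 1)"

definition varM :: "'a measure \<Rightarrow> ('a \<Rightarrow> real) \<Rightarrow> real" where
  "varM M g = (\<integral>x. (g x - (\<integral>y. g y \<partial>M))\<^sup>2 \<partial>M)"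

definition mean_vec :: "(real^'n) measure \<Rightarrow> real^'n" where
  "mean_vec P = (\<integral>x. x \<partial>P)"

definition cov_mat :: "(real^'n) measure \<Rightarrow> real^'n^'n" where
  "cov_mat P = (\<chi> i j. \<integral>x. (x$i - mean_vec P $ i) * (x$j - mean_vec P $ j) \<partial>P)"

definition iid_law :: "(real^'n) measure \<Rightarrow> nat \<Rightarrow> (nat \<Rightarrow> real^'n) measure" where
  "iid_law P N = PiM {..<N} (\<lambda>_. P)"

definition sample_mean :: "nat \<Rightarrow> (nat \<Rightarrow> real^'n) \<Rightarrow> real^'n" where
  "sample_mean N \<omega> = (1 / real N) *\<^sub>R (\<Sum>k<N. \<omega> k)"

definition mm_sample :: "(real^'n) measure \<Rightarrow> nat \<Rightarrow> (nat \<Rightarrow> real^'n) \<Rightarrow> nat \<Rightarrow> real^'n" where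
  "mm_sample P N \<omega> k = \<omega> k - sample_mean N \<omega> + mean_vec P"

definition mm_var :: "(real^'n) measure \<Rightarrow> (real^'n \<Rightarrow> real) \<Rightarrow> nat \<Rightarrow> real" where
  "mm_var P f N = varM (iid_law P N) (\<lambda>\<omega>. (1 / real N) * (\<Sum>k<N. f (mm_sample P N \<omega> k)))"

definition test_fn :: "(real^'n \<Rightarrow> real) \<Rightarrow> (real^'n \<Rightarrow> real) \<Rightarrow> bool" where
  "test_fn p f \<longleftrightarrow> smooth_fn f \<and> compact (fsupp f) \<and> fsupp f \<subseteq> interior (fsupp p)"

definition aumm1 :: "(real^'n) measure \<Rightarrow> (real^'n \<Rightarrow> real) \<Rightarrow> bool" where
  "aumm1 P p \<longleftrightarrow>
     (\<forall>f. test_fn p f \<longrightarrow>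
        (\<exists>A :: nat \<Rightarrow> real. A \<longlonglongrightarrow> 1 \<and>
           (\<forall>N\<ge>1. mm_var P f N \<le> A N / real N * varM P f))) \<and>
     (\<exists>f. test_fn p f \<and>
        (\<exists>L. (\<lambda>N. real N * mm_var P f N) \<longlonglongrightarrow> L \<and> L < varM P f))"

definition normal_density :: "real^'n \<Rightarrow> real^'n^'n \<Rightarrow> real^'n \<Rightarrow> real" where
  "normal_density \<mu> \<Sigma> x =
     exp (- (1/2) * ((x - \<mu>) \<bullet> (matrix_inv \<Sigma> *v (x - \<mu>))))
       / sqrt ((2 * pi) ^ CARD('n) * det \<Sigma>)"

definition pos_def :: "real^'n^'n \<Rightarrow> bool" where
  "pos_def \<Sigma> \<longleftrightarrow> transpose \<Sigma> = \<Sigma> \<and> (\<forall>v. v \<noteq> 0 \<longrightarrow> v \<bullet> (\<Sigma> *v v) > 0)"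

end

theory Submission
  imports Defs
begin

text \<open>Write \<open>u = X - \<mu>\<close>, \<open>g = E \<partial>f(X)\<close> and \<open>c = E f(X) u\<close>. A second order Taylor expansion shows that the
  moment matched estimator differs from the sample mean of \<open>f(X(k)) - g \<bullet> (X(k) - \<mu>)\<close> by a remainder
  that is quadratic in sample means of centred variables; hence \<open>N\<close> times its variance tends to
  \<open>Var f(X) - 2 g \<bullet> c + g \<bullet> \<Sigma> g\<close>. For a normal law, integration by parts gives \<open>c = \<Sigma> g\<close>.

  Conversely, asymptotic universality makes \<open>g\<close> vanish whenever \<open>c\<close> does, so \<open>g = M c\<close> for a fixed
  matrix \<open>M\<close>. This is the weak form of \<open>\<partial>p(x) = - M (x - \<mu>) p(x)\<close>, whose solutions are the Gaussian
  densities, and testing it against truncated linear functions gives \<open>M \<Sigma> = 1\<close>.\<close>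

subsection \<open>Smooth functions with compact support\<close>

text \<open>The obstacle is integrability. In the converse \<open>X\<close> has second moments only,
  but the limit of \<open>N\<close> times the variance needs the remainder to be small in mean
  square, and estimating that costs a fourth moment. So the two-sided limit is proved under a fourth
  moment hypothesis, which the normal law satisfies, and the converse works with a one-sided bound
  by duality, Var(T) >= 2 Cov(T, S) - Var(S), where T is the estimator and S the sample mean of a
  bounded function. Then only the correlation of the remainder with S has to be small. The reason
  behind the converse: for \<open>c = 0\<close> the formal limit is Var f(X) + g \<bullet> \<Sigma>
  g, which universality caps at Var f(X), so a non-singular \<Sigma> forces \<open>g = 0\<close>.
  Test functions must live inside the support of \<open>p\<close>, so truncated linear functions are
  not admissible from the start. They become so once the differential equation has shown that
  \<open>p\<close> is positive everywhere.\<close>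

lemma frechet_eqI: "(f has_derivative f') (at x) \<Longrightarrow> frechet_derivative f (at x) = f'"
  using frechet_derivative_at by metis

text \<open>The classical flat function exp(-1/s), extended by 0, divided by powers of
  \<open>s\<close>. The index \<open>k\<close> makes the family closed under differentiation up to
  linear combinations.\<close>

definition flat_exp :: "nat \<Rightarrow> real \<Rightarrow> real" where
  "flat_exp k s = (if s \<le> 0 then 0 else exp (- 1 / s) / s ^ k)"

text \<open>A single term of the exponential series is bounded by its sum. It yields both the
  flatness of \<open>flat_exp\<close> at 0 and the fourth moment of the normal law.\<close>

lemma power_le_fact_exp:
  fixes x :: real
  assumes "x \<ge> 0"
  shows "x ^ n \<le> fact n * exp x"
proof -
  have "(\<lambda>n. x ^ n / fact n) sums exp x"
    using exp_converges[of x] by (simp add: scaleR_conv_of_real divide_inverse mult.commute)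
  then have "(\<Sum>i\<in>{n}. x ^ i / fact i) \<le> exp x"
    using assms by (metis (no_types, lifting) divide_nonneg_pos fact_gt_zero finite.emptyI finite.insertI sum_le_suminf sums_iff zero_le_power)
  then show ?thesis by (simp add: field_simps)
qed

text \<open>The exponential estimate is taken at \<open>1 / s\<close> with exponent
  \<open>k + 2\<close>, two more than the pole. The surplus makes the difference quotient at 0 tend
  to 0.\<close>

lemma flat_exp_quadratic_bound: "\<bar>flat_exp k s\<bar> \<le> fact (k + 2) * s\<^sup>2"
proof (cases "s \<le> 0")
  case False
  then have s: "s > 0" by simp
  have "1 \<le> fact (k + 2) * exp (1 / s) * s ^ (k + 2)"
    using power_le_fact_exp[of "1 / s" "k + 2"] s by (simp add: field_simps power_divide)
  then have "exp (- (1 / s)) \<le> fact (k + 2) * s ^ (k + 2)"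
    using s by (simp add: exp_minus field_simps)
  then show ?thesis
    using s by (simp add: flat_exp_def divide_le_eq power_add power2_eq_square mult_ac)
qed (simp add: flat_exp_def)

lemma flat_exp_has_derivative:
  "(flat_exp k has_real_derivative (flat_exp (k + 2) s - real k * flat_exp (k + 1) s)) (at s)"
proof -
  consider "s < 0" | "s > 0" | "s = 0" by linarith
  then show ?thesis
  proof cases
    case 1
    have "(flat_exp k has_real_derivative 0) (at s)"
      by (rule has_field_derivative_transform_within_open[of "\<lambda>_. 0" _ _ "{..<0}"])
        (use 1 in \<open>auto simp: flat_exp_def\<close>)
    then show ?thesis using 1 by (simp add: flat_exp_def)
  next
    case 2
    have "((\<lambda>s. exp (- 1 / s) / s ^ k) has_real_derivative
        (exp (-1 / s) / s ^ (k + 2) - real k * (exp (-1 / s) / s ^ (k + 1)))) (at s)"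
    \<comment> \<open>The power rule produces the truncated exponent \<open>k - 1\<close>; the split
      replaces it by a genuine predecessor.\<close>
    proof (cases k)
      case 0
      then show ?thesis using 2
        by (auto intro!: derivative_eq_intros simp: power2_eq_square field_simps)
    next
      case (Suc m)
      have "((\<lambda>s. s ^ k) has_real_derivative real k * s ^ m) (at s)"
        using DERIV_pow[of k s] Suc by simp
      moreover have "((\<lambda>s. exp (- 1 / s)) has_real_derivative exp (- 1 / s) * (1 / s\<^sup>2)) (at s)"
        using 2 by (auto intro!: derivative_eq_intros simp: power2_eq_square)
      ultimately have "((\<lambda>s. exp (- 1 / s) / s ^ k) has_real_derivative
          (exp (- 1 / s) * (1 / s\<^sup>2) * s ^ k - exp (- 1 / s) * (real k * s ^ m)) / (s ^ k * s ^ k)) (at s)"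
        using 2 by (intro DERIV_divide) auto
      also have "(exp (- 1 / s) * (1 / s\<^sup>2) * s ^ k - exp (- 1 / s) * (real k * s ^ m)) / (s ^ k * s ^ k)
          = exp (-1 / s) / s ^ (k + 2) - real k * (exp (-1 / s) / s ^ (k + 1))"
        unfolding Suc using 2 by (simp add: power2_eq_square field_simps)
      finally show ?thesis .
    qed
    then have "(flat_exp k has_real_derivative
        (exp (-1 / s) / s ^ (k + 2) - real k * (exp (-1 / s) / s ^ (k + 1)))) (at s)"
      by (rule has_field_derivative_transform_within_open[of _ _ _ "{0<..}"])
        (use 2 in \<open>auto simp: flat_exp_def\<close>)
    then show ?thesis using 2 by (simp add: flat_exp_def)
  next
    case 3
    have "((\<lambda>h. flat_exp k h / h) \<longlongrightarrow> 0) (at 0)"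
    proof (rule Lim_null_comparison)
      have "\<bar>flat_exp k h / h\<bar> \<le> fact (k + 2) * \<bar>h\<bar>" if "h \<noteq> 0" for h
        using flat_exp_quadratic_bound[of k h] that
        by (simp add: abs_divide divide_le_eq power2_eq_square mult.assoc flip: abs_mult)
      then show "\<forall>\<^sub>F h in at 0. norm (flat_exp k h / h) \<le> fact (k + 2) * \<bar>h\<bar>"
        by (auto simp: eventually_at_filter)
      show "((\<lambda>h. fact (k + 2) * \<bar>h\<bar>) \<longlongrightarrow> 0) (at (0::real))"
        by (auto intro!: tendsto_eq_intros)
    qed
    then show ?thesis using 3 by (simp add: has_field_derivative_iff flat_exp_def)
  qed
qed

text \<open>This class is closed under directional derivatives, which is all that coinduction needs to
  place it inside \<open>smooth_fn\<close>.\<close>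

inductive smooth_alg :: "('a::euclidean_space \<Rightarrow> real) \<Rightarrow> bool" where
  smooth: "smooth_fn f \<Longrightarrow> smooth_alg f"
| const: "smooth_alg (\<lambda>x. c)"
| inner: "smooth_alg (\<lambda>x. x \<bullet> b)"
| bump: "smooth_alg (\<lambda>x. flat_exp k (1 - x \<bullet> x))"
| add: "smooth_alg f \<Longrightarrow> smooth_alg g \<Longrightarrow> smooth_alg (\<lambda>x. f x + g x)"
| mult: "smooth_alg f \<Longrightarrow> smooth_alg g \<Longrightarrow> smooth_alg (\<lambda>x. f x * g x)"

lemma smooth_fn_differentiable: "smooth_fn f \<Longrightarrow> f differentiable (at x)"
  by (auto elim: smooth_fn.cases)

lemma smooth_fn_frechet: "smooth_fn f \<Longrightarrow> smooth_fn (\<lambda>x. frechet_derivative f (at x) v)"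
  by (auto elim: smooth_fn.cases)

lemma smooth_alg_derivative:
  "smooth_alg f \<Longrightarrow> (\<forall>x. f differentiable (at x)) \<and> (\<forall>v. smooth_alg (\<lambda>x. frechet_derivative f (at x) v))"
proof (induction rule: smooth_alg.induct)
  case (smooth f)
  then show ?case
    by (auto intro: smooth_alg.smooth smooth_fn_frechet smooth_fn_differentiable)
next
  case (const c)
  then show ?case by (auto intro: smooth_alg.const)
next
  case (inner b)
  have d: "((\<lambda>x. x \<bullet> b) has_derivative (\<lambda>v. v \<bullet> b)) (at x)" for x :: 'a
    by (auto intro!: derivative_eq_intros)
  then show ?case
    unfolding differentiable_def frechet_eqI[OF d] by (auto intro: smooth_alg.const)
next
  case (bump k)
  have d: "((\<lambda>x. flat_exp k (1 - x \<bullet> x)) has_derivative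
      (\<lambda>v. (flat_exp (k + 2) (1 - x \<bullet> x) + (- real k) * flat_exp (k + 1) (1 - x \<bullet> x)) * (-2 * (x \<bullet> v)))) (at x)" for x :: 'a
  proof -
    have "((\<lambda>x. 1 - x \<bullet> x) has_derivative (\<lambda>v. -2 * (x \<bullet> v))) (at x)"
      by (auto intro!: derivative_eq_intros simp: inner_commute)
    from has_derivative_compose[OF this flat_exp_has_derivative[unfolded has_field_derivative_def]]
    show ?thesis by simp
  qed
  have "smooth_alg (\<lambda>x::'a. (flat_exp (k + 2) (1 - x \<bullet> x) + (- real k) * flat_exp (k + 1) (1 - x \<bullet> x)) * (-2 * (x \<bullet> v)))" for v
    by (intro smooth_alg.mult smooth_alg.add smooth_alg.const smooth_alg.bump smooth_alg.inner)
  with d show ?case unfolding differentiable_def frechet_eqI[OF d] by blast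
next
  case (add f g)
  have d: "((\<lambda>x. f x + g x) has_derivative (\<lambda>v. frechet_derivative f (at x) v + frechet_derivative g (at x) v)) (at x)" for x
    using add.IH by (intro has_derivative_add) (auto simp: frechet_derivative_works)
  then show ?case using add.IH
    by (auto simp: frechet_eqI[OF d] differentiable_def intro!: smooth_alg.add)
next
  case (mult f g)
  have d: "((\<lambda>x. f x * g x) has_derivative (\<lambda>v. f x * frechet_derivative g (at x) v + frechet_derivative f (at x) v * g x)) (at x)" for x
    using mult.IH by (intro has_derivative_mult) (auto simp: frechet_derivative_works)
  then show ?case using mult.IH mult.hyps
    by (auto simp: frechet_eqI[OF d] differentiable_def intro!: smooth_alg.add smooth_alg.mult)
qed

lemma smooth_alg_smooth_fn: "smooth_alg f \<Longrightarrow> smooth_fn f"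
  by (coinduction arbitrary: f rule: smooth_fn.coinduct) (auto dest: smooth_alg_derivative)

lemma smooth_fn_const: "smooth_fn (\<lambda>x. c)"
  and smooth_fn_inner: "smooth_fn (\<lambda>x. x \<bullet> b)"
  and smooth_fn_add: "smooth_fn f \<Longrightarrow> smooth_fn g \<Longrightarrow> smooth_fn (\<lambda>x. f x + g x)"
  and smooth_fn_mult: "smooth_fn f \<Longrightarrow> smooth_fn g \<Longrightarrow> smooth_fn (\<lambda>x. f x * g x)"
  and smooth_fn_bump: "smooth_fn (\<lambda>x. flat_exp k (1 - x \<bullet> x))"
  by (auto intro: smooth_alg_smooth_fn smooth_alg.intros)

text \<open>By the chain rule each differentiation contributes another factor \<open>a\<close>, so
  the coinduction invariant has to admit an arbitrary constant \<open>k\<close> in front.\<close>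

lemma smooth_fn_affine:
  fixes f :: "'a::euclidean_space \<Rightarrow> real"
  assumes "smooth_fn f"
  shows "smooth_fn (\<lambda>x. f (a *\<^sub>R x + b))"
proof -
  have "smooth_fn h" if "\<exists>k f. smooth_fn f \<and> h = (\<lambda>x. k * f (a *\<^sub>R x + b))" for h
    using that
  proof (rule smooth_fn.coinduct[of "\<lambda>h. \<exists>k f. smooth_fn f \<and> h = (\<lambda>x. k * f (a *\<^sub>R x + b))"])
    fix h
    assume "\<exists>k f. smooth_fn f \<and> h = (\<lambda>x. k * f (a *\<^sub>R x + b))"
    then obtain k f where f: "smooth_fn f" and h: "h = (\<lambda>x. k * f (a *\<^sub>R x + b))" by blast
    have "((\<lambda>x. a *\<^sub>R x + b) has_derivative (\<lambda>v. a *\<^sub>R v)) (at x)" for x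
      by (auto intro!: derivative_eq_intros)
    from has_derivative_compose[OF this]
    have "((\<lambda>x. f (a *\<^sub>R x + b)) has_derivative (\<lambda>v. frechet_derivative f (at (a *\<^sub>R x + b)) (a *\<^sub>R v))) (at x)" for x
      using smooth_fn_differentiable[OF f] by (auto simp: frechet_derivative_works)
    then have d: "(h has_derivative (\<lambda>v. k * frechet_derivative f (at (a *\<^sub>R x + b)) (a *\<^sub>R v))) (at x)" for x
      unfolding h by (auto intro!: derivative_eq_intros)
    have "linear (frechet_derivative f (at z))" for z
      using smooth_fn_differentiable[OF f] by (rule linear_frechet_derivative)
    then have "frechet_derivative h (at x) v = (k * a) * frechet_derivative f (at (a *\<^sub>R x + b)) v" for x v
      unfolding frechet_eqI[OF d] by (simp add: linear_scale)
    then have "\<exists>k g. smooth_fn g \<and> (\<lambda>x. frechet_derivative h (at x) v) = (\<lambda>x. k * g (a *\<^sub>R x + b))" for v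
      by (intro exI[of _ "k * a"] exI[of _ "\<lambda>z. frechet_derivative f (at z) v"]) (simp add: smooth_fn_frechet[OF f])
    moreover have "h differentiable (at x)" for x
      using d unfolding differentiable_def by blast
    ultimately show "\<exists>f. h = f \<and> (\<forall>x. f differentiable (at x)) \<and>
      (\<forall>v. (\<exists>k g. smooth_fn g \<and> (\<lambda>x. frechet_derivative f (at x) v) = (\<lambda>x. k * g (a *\<^sub>R x + b))) \<or>
           smooth_fn (\<lambda>x. frechet_derivative f (at x) v))"
      by (intro exI[of _ h] conjI allI refl disjI1)
  qed
  from this[of "\<lambda>x. f (a *\<^sub>R x + b)"] show ?thesis
    using assms by (metis mult_1)
qed

section \<open>Compactly supported smooth functions: bounds, Lipschitz gradients, Taylor
  estimate\<close>

definition cc_smooth :: "('a::euclidean_space \<Rightarrow> real) \<Rightarrow> bool" where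
  "cc_smooth f \<longleftrightarrow> smooth_fn f \<and> compact (fsupp f)"

lemma fsupp_subset: "closed S \<Longrightarrow> (\<And>x. x \<notin> S \<Longrightarrow> f x = 0) \<Longrightarrow> fsupp f \<subseteq> S"
  unfolding fsupp_def by (rule closure_minimal) auto

lemma not_in_fsupp: "x \<notin> fsupp f \<Longrightarrow> f x = 0"
  unfolding fsupp_def using closure_subset[of "{x. f x \<noteq> 0}"] by blast

lemma cc_smoothI:
  assumes "smooth_fn f" "compact S" "\<And>x. x \<notin> S \<Longrightarrow> f x = 0"
  shows "cc_smooth f"
proof -
  have "fsupp f \<subseteq> S" using assms by (intro fsupp_subset) (auto intro: compact_imp_closed)
  moreover have "closed (fsupp f)" by (simp add: fsupp_def)
  ultimately show ?thesis using assms unfolding cc_smooth_def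
    by (metis closed_Int_compact inf.absorb1)
qed

lemma frechet_outside_fsupp:
  fixes f :: "'a::euclidean_space \<Rightarrow> real"
  assumes "x \<notin> fsupp f"
  shows "frechet_derivative f (at x) v = 0"
proof -
  have "open (- fsupp f)" by (simp add: fsupp_def open_Compl)
  then have "(f has_derivative (\<lambda>v. 0)) (at x)"
    by (rule has_derivative_transform_within_open[OF has_derivative_const[of 0]])
      (use assms in \<open>auto simp: not_in_fsupp\<close>)
  then show ?thesis by (simp add: frechet_eqI)
qed

lemma cc_smooth_frechet:
  assumes "cc_smooth f"
  shows "cc_smooth (\<lambda>x. frechet_derivative f (at x) v)"
  using assms by (intro cc_smoothI[of _ "fsupp f"])
    (auto simp: cc_smooth_def smooth_fn_frechet frechet_outside_fsupp)

lemma cc_smooth_add: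
  assumes "cc_smooth f" "cc_smooth g"
  shows "cc_smooth (\<lambda>x. f x + g x)"
  using assms by (intro cc_smoothI[of _ "fsupp f \<union> fsupp g"])
    (auto simp: cc_smooth_def smooth_fn_add not_in_fsupp)

lemma cc_smooth_mult: "smooth_fn f \<Longrightarrow> cc_smooth g \<Longrightarrow> cc_smooth (\<lambda>x. f x * g x)"
  by (intro cc_smoothI[of _ "fsupp g"])
    (auto simp: cc_smooth_def smooth_fn_mult not_in_fsupp)

lemma smooth_fn_has_derivative:
  "smooth_fn f \<Longrightarrow> (f has_derivative frechet_derivative f (at x)) (at x)"
  using smooth_fn_differentiable frechet_derivative_works by blast

lemma smooth_fn_continuous: "smooth_fn f \<Longrightarrow> continuous_on S f"
  by (meson continuous_at_imp_continuous_on has_derivative_continuous smooth_fn_has_derivative)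

lemma cc_smooth_bounded:
  fixes f :: "'a::euclidean_space \<Rightarrow> real"
  assumes "cc_smooth f"
  obtains B where "B > 0" "\<And>x. \<bar>f x\<bar> \<le> B"
proof -
  have "bounded (f ` fsupp f)"
    using assms by (auto simp: cc_smooth_def intro: compact_imp_bounded compact_continuous_image smooth_fn_continuous)
  then obtain B where "B > 0" "\<And>x. x \<in> fsupp f \<Longrightarrow> \<bar>f x\<bar> \<le> B"
    by (auto simp: bounded_pos)
  then have "\<bar>f x\<bar> \<le> B" for x
    by (cases "x \<in> fsupp f") (auto simp: not_in_fsupp)
  with \<open>B > 0\<close> that show ?thesis by blast
qed

definition grad :: "('a::euclidean_space \<Rightarrow> real) \<Rightarrow> 'a \<Rightarrow> 'a" where
  "grad f x = (\<Sum>b\<in>Basis. frechet_derivative f (at x) b *\<^sub>R b)"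

lemma frechet_grad:
  assumes "f differentiable (at x)"
  shows "frechet_derivative f (at x) v = grad f x \<bullet> v"
proof -
  interpret linear "frechet_derivative f (at x)" using assms by (rule linear_frechet_derivative)
  have "frechet_derivative f (at x) v = frechet_derivative f (at x) (\<Sum>b\<in>Basis. (v \<bullet> b) *\<^sub>R b)"
    by (simp add: euclidean_representation)
  then show ?thesis by (simp add: sum scale grad_def inner_sum_left inner_sum_right inner_commute mult.commute)
qed

lemma grad_inner_Basis: "b \<in> Basis \<Longrightarrow> grad f x \<bullet> b = frechet_derivative f (at x) b"
  by (simp add: grad_def inner_sum_left inner_Basis if_distrib[of "\<lambda>z. _ * z"] cong: if_cong)

lemma smooth_fn_has_grad:
  "smooth_fn f \<Longrightarrow> (f has_derivative (\<lambda>v. grad f x \<bullet> v)) (at x)"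
  using smooth_fn_has_derivative[of f x] frechet_grad[OF smooth_fn_differentiable, of f x]
  by (metis (no_types, lifting) ext)

lemma smooth_fn_continuous_grad:
  "smooth_fn f \<Longrightarrow> continuous_on S (grad f)"
  unfolding grad_def by (intro continuous_intros smooth_fn_continuous smooth_fn_frechet)

lemma cc_smooth_grad_bounded:
  assumes "cc_smooth f"
  obtains B where "B > 0" "\<And>x. norm (grad f x) \<le> B"
proof -
  have "\<forall>b\<in>Basis. \<exists>B. \<forall>x. \<bar>frechet_derivative f (at x) b\<bar> \<le> B"
    using cc_smooth_frechet[OF assms] cc_smooth_bounded by meson
  then obtain B where B: "\<And>b x. b \<in> Basis \<Longrightarrow> \<bar>frechet_derivative f (at x) b\<bar> \<le> B b" by metis
  have "norm (grad f x) \<le> (\<Sum>b\<in>Basis. \<bar>B b\<bar>)" for x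
    unfolding grad_def using B
    by (intro norm_sum[THEN order_trans] sum_mono) (auto intro: order_trans[OF _ abs_ge_self])
  then show ?thesis using that[of "(\<Sum>b\<in>Basis. \<bar>B b\<bar>) + 1"]
    by (metis add_strict_increasing2 le_add_same_cancel1 norm_ge_zero order_trans zero_le_one zero_less_one)
qed

lemma cc_smooth_lipschitz:
  assumes "cc_smooth f"
  obtains L where "L > 0" "\<And>x y. \<bar>f x - f y\<bar> \<le> L * norm (x - y)"
proof -
  obtain B where B: "B > 0" "\<And>x. norm (grad f x) \<le> B" using cc_smooth_grad_bounded[OF assms] by blast
  have "norm (f x - f y) \<le> B * norm (x - y)" for x y
  proof (rule differentiable_bound[of UNIV f "\<lambda>x v. grad f x \<bullet> v"])
    show "(f has_derivative (\<bullet>) (grad f x)) (at x within UNIV)" for x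
      using assms by (auto simp: cc_smooth_def smooth_fn_has_grad)
    show "onorm ((\<bullet>) (grad f x)) \<le> B" for x
      using B by (intro onorm_le) (metis mult_right_mono norm_ge_zero Cauchy_Schwarz_ineq2 order_trans real_norm_def)
  qed auto
  then show ?thesis using that B by auto
qed

text \<open>Each component of the gradient is a directional derivative, hence again smooth with
  compact support and so Lipschitz.\<close>

lemma cc_smooth_grad_lipschitz:
  assumes "cc_smooth f"
  obtains L where "L > 0" "\<And>x y. norm (grad f x - grad f y) \<le> L * norm (x - y)"
proof -
  have "\<forall>b\<in>Basis. \<exists>L. \<forall>x y. \<bar>frechet_derivative f (at x) b - frechet_derivative f (at y) b\<bar> \<le> L * norm (x - y)"
    using cc_smooth_frechet[OF assms] cc_smooth_lipschitz by meson
  then obtain L where L: "\<And>b x y. b \<in> Basis \<Longrightarrow>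
      \<bar>frechet_derivative f (at x) b - frechet_derivative f (at y) b\<bar> \<le> L b * norm (x - y)" by metis
  have "norm (grad f x - grad f y) \<le> ((\<Sum>b\<in>Basis. \<bar>L b\<bar>) + 1) * norm (x - y)" for x y
  proof -
    have "norm (grad f x - grad f y) \<le> (\<Sum>b\<in>Basis. \<bar>L b\<bar> * norm (x - y))"
      unfolding grad_def sum_subtractf[symmetric] scaleR_diff_left[symmetric] using L
      by (intro norm_sum[THEN order_trans] sum_mono)
        (auto intro: order_trans[OF _ mult_right_mono[OF abs_ge_self]])
    then show ?thesis by (simp add: sum_distrib_right distrib_right add_increasing2)
  qed
  moreover have "(\<Sum>b\<in>Basis. \<bar>L b\<bar>) + 1 > 0"
    by (metis add_nonneg_pos sum_abs_ge_zero zero_less_one)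
  ultimately show ?thesis using that by blast
qed

text \<open>The mean value inequality is applied to \<open>f\<close> minus its linear part at
  \<open>x\<close>, on the ball of radius \<open>norm d\<close>, where the gradient moves by at most
  \<open>L * norm d\<close>. The increment is written \<open>- d\<close> because moment matching
  subtracts the error of the sample mean.\<close>

lemma cc_smooth_taylor:
  assumes "cc_smooth f"
  obtains K where "K > 0" "\<And>x d. \<bar>f (x - d) - f x + grad f x \<bullet> d\<bar> \<le> K * (norm d)\<^sup>2"
proof -
  obtain L where L: "L > 0" "\<And>x y. norm (grad f x - grad f y) \<le> L * norm (x - y)"
    using cc_smooth_grad_lipschitz[OF assms] by blast
  have "\<bar>f (x - d) - f x + grad f x \<bullet> d\<bar> \<le> L * (norm d)\<^sup>2" for x d
  proof -
    define h where "h y = f y - grad f x \<bullet> y" for y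
    have "norm (h (x - d) - h x) \<le> L * norm d * norm ((x - d) - x)"
    proof (rule differentiable_bound[of "cball x (norm d)" h "\<lambda>y v. (grad f y - grad f x) \<bullet> v"])
      show "(h has_derivative (\<bullet>) (grad f y - grad f x)) (at y within cball x (norm d))" for y
        unfolding h_def
        using smooth_fn_has_grad[of f y] assms
        by (auto simp: cc_smooth_def inner_diff_left intro!: derivative_eq_intros intro: has_derivative_at_withinI)
      show "onorm ((\<bullet>) (grad f y - grad f x)) \<le> L * norm d" if "y \<in> cball x (norm d)" for y
      proof (rule onorm_le)
        fix v
        have "norm (grad f y - grad f x) \<le> L * norm d"
          using L(2)[of y x] that L(1)
          by (auto simp: dist_norm norm_minus_commute intro: order_trans mult_left_mono)
        then show "norm ((grad f y - grad f x) \<bullet> v) \<le> L * norm d * norm v"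
          by (metis mult_right_mono norm_ge_zero Cauchy_Schwarz_ineq2 order_trans real_norm_def)
      qed
    qed auto
    then show ?thesis by (simp add: h_def inner_diff_right power2_eq_square algebra_simps)
  qed
  with L(1) that show ?thesis by blast
qed

text \<open>The standard mollifier exp(-1/(1-|x|^2)) on the unit ball, not normalised; its value at
  0 and its integral are cancelled wherever they occur.\<close>

definition bump :: "'a::euclidean_space \<Rightarrow> real" where
  "bump x = flat_exp 0 (1 - x \<bullet> x)"

lemma bump_nonneg: "bump x \<ge> 0"
  by (simp add: bump_def flat_exp_def)

lemma bump_0: "bump (0::'a::euclidean_space) > 0"
  by (simp add: bump_def flat_exp_def)

lemma bump_outside: "x \<notin> cball 0 1 \<Longrightarrow> bump x = 0"
  using one_less_power[of "norm x" 2] by (simp add: bump_def flat_exp_def flip: power2_norm_eq_inner)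

lemma cc_smooth_bump: "cc_smooth bump"
  unfolding bump_def[abs_def]
  by (rule cc_smoothI[of _ "cball 0 1"]) (auto simp: smooth_fn_bump bump_outside[unfolded bump_def])

subsection \<open>Moments of sums of independent copies\<close>

text \<open>Integrability and value travel together in \<open>has_bochner_integral\<close>, so long
  moment expansions can be assembled by composing rules, term by term.\<close>

lemma (in pair_sigma_finite) has_bochner_integral_tensor:
  fixes f :: "'a \<Rightarrow> real" and g :: "'b \<Rightarrow> real"
  assumes f: "has_bochner_integral M1 f a" and g: "has_bochner_integral M2 g b"
  shows "has_bochner_integral (M1 \<Otimes>\<^sub>M M2) (\<lambda>z. f (fst z) * g (snd z)) (a * b)"
proof -
  have [measurable]: "integrable M1 f" "integrable M2 g" "f \<in> borel_measurable M1" "g \<in> borel_measurable M2"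
    using f g by (auto simp: has_bochner_integral_iff)
  have int: "integrable (M1 \<Otimes>\<^sub>M M2) (\<lambda>z. f (fst z) * g (snd z))"
    using f g by (intro Fubini_integrable) (auto simp: abs_mult has_bochner_integral_iff)
  have "integral\<^sup>L (M1 \<Otimes>\<^sub>M M2) (\<lambda>z. f (fst z) * g (snd z)) = (\<integral>x. (\<integral>y. f x * g y \<partial>M2) \<partial>M1)"
    using integral_fst'[OF int] by simp
  also have "\<dots> = a * b"
    using f g by (auto simp: has_bochner_integral_iff)
  finally show ?thesis using int by (simp add: has_bochner_integral_iff)
qed

lemma integrable_dominated:
  fixes f :: "'a \<Rightarrow> 'b::{banach, second_countable_topology}" and g :: "'a \<Rightarrow> real"
  assumes "integrable M g" "f \<in> borel_measurable M" "\<And>x. norm (f x) \<le> g x"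
  shows "integrable M f"
  by (rule Bochner_Integration.integrable_bound[OF assms(1,2)])
    (use assms(3) in \<open>auto intro: order_trans[OF _ abs_ge_self]\<close>)

lemma tendsto_integral_dominated:
  fixes f :: "'a \<Rightarrow> 'b::{banach, second_countable_topology}" and w :: "'a \<Rightarrow> real"
  assumes "integrable M w" "\<And>x. (\<lambda>n. s n x) \<longlonglongrightarrow> f x" "\<And>n x. norm (s n x) \<le> w x"
    "f \<in> borel_measurable M" "\<And>n. s n \<in> borel_measurable M"
  shows "(\<lambda>n. integral\<^sup>L M (s n)) \<longlonglongrightarrow> integral\<^sup>L M f"
  by (rule integral_dominated_convergence[OF assms(4,5,1)]) (use assms(2,3) in auto)

lemma abs_le_1_plus_square: "\<bar>r\<bar> \<le> 1 + r\<^sup>2" for r :: real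
  using zero_le_power2[of "\<bar>r\<bar> - 1"] zero_le_power2[of r] by (simp only: power2_diff power2_abs) simp

lemma has_bochner_integral_scale:
  "has_bochner_integral M' f x \<Longrightarrow> has_bochner_integral M' (\<lambda>y. c * f y) (c * x :: real)"
  by (rule has_bochner_integral_mult_right)

abbreviation iid :: "'b measure \<Rightarrow> nat \<Rightarrow> (nat \<Rightarrow> 'b) measure" where
  "iid P N \<equiv> PiM {..<N} (\<lambda>_. P)"

definition psum :: "('b \<Rightarrow> 'c::comm_monoid_add) \<Rightarrow> nat \<Rightarrow> (nat \<Rightarrow> 'b) \<Rightarrow> 'c" where
  "psum a N X = (\<Sum>k<N. a (X k))"

lemma psum_Suc: "psum a (Suc N) (X(N := x)) = psum a N X + a x"
  by (simp add: psum_def)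

lemma inner_psum: "psum a N X \<bullet> v = psum (\<lambda>x. a x \<bullet> v) N X"
  by (simp add: psum_def inner_sum_left)

lemma measurable_psum [measurable (raw)]:
  fixes a :: "'b \<Rightarrow> 'c::{second_countable_topology, topological_comm_monoid_add}"
  assumes [measurable]: "a \<in> borel_measurable P"
  shows "psum a N \<in> borel_measurable (iid P N)"
  unfolding psum_def[abs_def] by measurable

lemma power2_inner_Basis_le: "i \<in> Basis \<Longrightarrow> (v \<bullet> i)\<^sup>2 \<le> (norm v)\<^sup>2"
  using Basis_le_norm[of i v] by (simp add: abs_le_square_iff[symmetric])

context prob_space
begin

lemma prob_space_iid: "prob_space (iid M N)"
  by (rule prob_space_PiM) (rule prob_space_axioms)

text \<open>The law of \<open>N + 1\<close> samples is the image of the product of one factor and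
  the law of \<open>N\<close> samples under insertion at coordinate \<open>N\<close>. All moment
  bounds are inductions on \<open>N\<close> through this step.\<close>

lemma has_bochner_integral_iid_Suc:
  fixes F :: "_ \<Rightarrow> real"
  assumes [measurable]: "F \<in> borel_measurable (iid M (Suc N))"
    and h: "has_bochner_integral (M \<Otimes>\<^sub>M iid M N) (\<lambda>z. F ((snd z)(N := fst z))) v"
  shows "has_bochner_integral (iid M (Suc N)) F v"
proof -
  have "distr (M \<Otimes>\<^sub>M iid M N) (PiM (insert N {..<N}) (\<lambda>_. M)) (\<lambda>(x, X). X(N := x)) = PiM (insert N {..<N}) (\<lambda>_. M)"
    by (rule distr_pair_PiM_eq_PiM) (auto intro: prob_space_axioms)
  then have eq: "distr (M \<Otimes>\<^sub>M iid M N) (iid M (Suc N)) (\<lambda>(x, X). X(N := x)) = iid M (Suc N)"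
    by (simp add: lessThan_Suc)
  have "has_bochner_integral (distr (M \<Otimes>\<^sub>M iid M N) (iid M (Suc N)) (\<lambda>(x, X). X(N := x))) F v"
    by (rule has_bochner_integral_distr)
      (use h in \<open>auto simp: lessThan_Suc case_prod_unfold intro!: measurable_fun_upd assms(1)[unfolded lessThan_Suc]\<close>)
  then show ?thesis by (simp add: eq)
qed

lemma has_bochner_integral_iid_component:
  fixes f :: "_ \<Rightarrow> real"
  assumes "has_bochner_integral M f v" "k < N"
  shows "has_bochner_integral (iid M N) (\<lambda>X. f (X k)) v"
proof -
  have [measurable]: "f \<in> borel_measurable M" "(\<lambda>X. X k) \<in> measurable (iid M N) M"
    using assms by (auto simp: has_bochner_integral_iff)
  have "distr (iid M N) M (\<lambda>X. X k) = M"
    by (rule distr_PiM_component) (use assms(2) in \<open>auto intro: prob_space_axioms\<close>)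
  then have "has_bochner_integral (distr (iid M N) M (\<lambda>X. X k)) f v" using assms by simp
  then show ?thesis
    by (simp add: has_bochner_integral_iff integrable_distr_eq integral_distr)
qed

lemma has_bochner_integral_const_1: "has_bochner_integral M (\<lambda>_. c::real) c"
  by (simp add: has_bochner_integral_iff prob_space)

lemma integrable_of_square:
  fixes a :: "_ \<Rightarrow> real"
  assumes [measurable]: "a \<in> borel_measurable M" and "integrable M (\<lambda>x. (a x)\<^sup>2)"
  shows "integrable M a"
  by (rule integrable_dominated[of _ "\<lambda>x. 1 + (a x)\<^sup>2"])
    (use assms in \<open>auto simp: abs_le_1_plus_square\<close>)

lemma integrable_mult_of_squares:
  fixes a b :: "_ \<Rightarrow> real"
  assumes [measurable]: "a \<in> borel_measurable M" "b \<in> borel_measurable M"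
    and "integrable M (\<lambda>x. (a x)\<^sup>2)" "integrable M (\<lambda>x. (b x)\<^sup>2)"
  shows "integrable M (\<lambda>x. a x * b x)"
proof (rule integrable_dominated[of _ "\<lambda>x. (a x)\<^sup>2 + (b x)\<^sup>2"])
  fix x
  have "0 \<le> (\<bar>a x\<bar> - \<bar>b x\<bar>)\<^sup>2" "0 \<le> \<bar>a x\<bar> * \<bar>b x\<bar>" by simp_all
  then show "norm (a x * b x) \<le> (a x)\<^sup>2 + (b x)\<^sup>2"
    unfolding power2_diff power2_abs real_norm_def abs_mult by linarith
qed (use assms in auto)

lemma psum_mean:
  fixes a :: "_ \<Rightarrow> real"
  assumes "integrable M a"
  shows "has_bochner_integral (iid M N) (psum a N) (real N * expectation a)"
proof -
  have "has_bochner_integral (iid M N) (\<lambda>X. \<Sum>k<N. a (X k)) (\<Sum>k<N. expectation a)"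
    using assms by (intro has_bochner_integral_sum has_bochner_integral_iid_component)
      (auto simp: has_bochner_integral_iff)
  then show ?thesis by (simp add: psum_def[abs_def])
qed

text \<open>Adding one sample expands the product into four terms; the two mixed ones factor by
  independence and vanish because both functions are centred.\<close>

lemma psum_second_moment:
  fixes a b :: "_ \<Rightarrow> real"
  assumes [measurable]: "a \<in> borel_measurable M" "b \<in> borel_measurable M"
    and sq: "integrable M (\<lambda>x. (a x)\<^sup>2)" "integrable M (\<lambda>x. (b x)\<^sup>2)"
    and zero: "expectation a = 0" "expectation b = 0"
  shows "has_bochner_integral (iid M N) (\<lambda>X. psum a N X * psum b N X) (real N * expectation (\<lambda>x. a x * b x))"
proof (induction N)
  case 0
  then show ?case by (simp add: psum_def has_bochner_integral_zero)
next
  case (Suc N)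
  interpret pr: prob_space "iid M N" by (rule prob_space_iid)
  interpret pair_sigma_finite M "iid M N" ..
  note t = has_bochner_integral_tensor and add = has_bochner_integral_add
  have a: "has_bochner_integral M a 0" and b: "has_bochner_integral M b 0"
    using integrable_of_square[OF assms(1) sq(1)] integrable_of_square[OF assms(2) sq(2)] zero
    by (auto simp: has_bochner_integral_iff)
  have A: "has_bochner_integral (iid M N) (psum a N) 0" and B: "has_bochner_integral (iid M N) (psum b N) 0"
    using psum_mean[of a N] psum_mean[of b N] a b zero by (auto simp: has_bochner_integral_iff)
  have ab: "has_bochner_integral M (\<lambda>x. a x * b x) (expectation (\<lambda>x. a x * b x))"
    using integrable_mult_of_squares[OF assms(1,2) sq] by (simp add: has_bochner_integral_iff)
  have "has_bochner_integral (M \<Otimes>\<^sub>M iid M N)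
     (\<lambda>z. 1 * (psum a N (snd z) * psum b N (snd z)) + a (fst z) * psum b N (snd z)
         + b (fst z) * psum a N (snd z) + (a (fst z) * b (fst z)) * 1)
     (1 * (real N * expectation (\<lambda>x. a x * b x)) + 0 * 0 + 0 * 0 + expectation (\<lambda>x. a x * b x) * 1)"
    by (rule add[OF add[OF add[OF t[OF has_bochner_integral_const_1 Suc.IH] t[OF a B]] t[OF b A]]
          t[OF ab pr.has_bochner_integral_const_1]])
  then show ?case
    by (intro has_bochner_integral_iid_Suc) (simp, simp only: psum_Suc, simp add: algebra_simps)
qed

text \<open>Centring reduces the growth from order \<open>N^4\<close> to \<open>N^2\<close>. Only
  the mixed moment of \<open>a^2 b^2\<close> is required, not fourth moments of \<open>a\<close> and
  \<open>b\<close> separately; with one factor bounded, second moments of the other suffice.\<close>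

lemma psum_mixed_fourth_moment:
  fixes a b :: "_ \<Rightarrow> real"
  assumes [measurable]: "a \<in> borel_measurable M" "b \<in> borel_measurable M"
    and sq: "integrable M (\<lambda>x. (a x)\<^sup>2)" "integrable M (\<lambda>x. (b x)\<^sup>2)"
    and sqq: "integrable M (\<lambda>x. (a x)\<^sup>2 * (b x)\<^sup>2)"
    and zero: "expectation a = 0" "expectation b = 0"
  shows "\<exists>C\<ge>0. \<forall>N. integrable (iid M N) (\<lambda>X. (psum a N X)\<^sup>2 * (psum b N X)\<^sup>2) \<and>
      integral\<^sup>L (iid M N) (\<lambda>X. (psum a N X)\<^sup>2 * (psum b N X)\<^sup>2) \<le> C * (real N)\<^sup>2"
proof -
  define \<alpha> \<beta> \<gamma> \<delta> where d: "\<alpha> = expectation (\<lambda>x. (a x)\<^sup>2)" "\<beta> = expectation (\<lambda>x. (b x)\<^sup>2)"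
    "\<gamma> = expectation (\<lambda>x. a x * b x)" "\<delta> = expectation (\<lambda>x. (a x)\<^sup>2 * (b x)\<^sup>2)"
  \<comment> \<open>The step from \<open>N\<close> to \<open>N + 1\<close> adds \<delta> plus
    \<open>N\<close> times the other summands. \<open>C\<close> dominates both increments, and
    \<open>C + N C + C N^2\<close> is at most \<open>C (N + 1)^2\<close>.\<close>
  define C where "C = 2 * \<alpha> * \<beta> + 4 * \<gamma>\<^sup>2 + \<delta>"
  have nn: "\<alpha> \<ge> 0" "\<beta> \<ge> 0" "\<delta> \<ge> 0" by (simp_all add: d)
  then have "C \<ge> 0" by (simp add: C_def)
  have a: "has_bochner_integral M a 0" and b: "has_bochner_integral M b 0"
    using integrable_of_square[OF assms(1) sq(1)] integrable_of_square[OF assms(2) sq(2)] zero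
    by (auto simp: has_bochner_integral_iff)
  have a2: "has_bochner_integral M (\<lambda>x. (a x)\<^sup>2) \<alpha>" and b2: "has_bochner_integral M (\<lambda>x. (b x)\<^sup>2) \<beta>"
    and ab: "has_bochner_integral M (\<lambda>x. a x * b x) \<gamma>"
    and a2b2: "has_bochner_integral M (\<lambda>x. (a x)\<^sup>2 * (b x)\<^sup>2) \<delta>"
    using integrable_mult_of_squares[OF assms(1,2) sq] sq sqq by (simp_all add: has_bochner_integral_iff d)
  \<comment> \<open>Third order mixed moments are finite because |g| is at most 1 + g^2.\<close>
  have cross: "integrable M' (\<lambda>x. (f x)\<^sup>2 * g x)"
    if "integrable M' (\<lambda>x. (f x)\<^sup>2)" "integrable M' (\<lambda>x. (f x)\<^sup>2 * (g x)\<^sup>2)"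
      "f \<in> borel_measurable M'" "g \<in> borel_measurable M'" for f g :: "'x \<Rightarrow> real" and M'
  proof (rule integrable_dominated[of _ "\<lambda>x. (f x)\<^sup>2 + (f x)\<^sup>2 * (g x)\<^sup>2"])
    show "norm ((f x)\<^sup>2 * g x) \<le> (f x)\<^sup>2 + (f x)\<^sup>2 * (g x)\<^sup>2" for x
      using mult_left_mono[OF abs_le_1_plus_square[of "g x"], of "(f x)\<^sup>2"]
      by (simp add: abs_mult algebra_simps)
  qed (use that in auto)
  have abb: "integrable M (\<lambda>x. (a x)\<^sup>2 * b x)" "integrable M (\<lambda>x. (b x)\<^sup>2 * a x)"
    using cross[of M a b] cross[of M b a] assms by (auto simp: mult.commute)
  have "\<exists>v \<le> C * (real N)\<^sup>2. has_bochner_integral (iid M N) (\<lambda>X. (psum a N X)\<^sup>2 * (psum b N X)\<^sup>2) v" for N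
  proof (induction N)
    case 0
    then show ?case by (intro exI[of _ 0]) (simp add: psum_def has_bochner_integral_zero)
  next
    case (Suc N)
    then obtain v where v: "v \<le> C * (real N)\<^sup>2"
      and AABB: "has_bochner_integral (iid M N) (\<lambda>X. (psum a N X)\<^sup>2 * (psum b N X)\<^sup>2) v" by blast
    interpret pr: prob_space "iid M N" by (rule prob_space_iid)
    interpret pair_sigma_finite M "iid M N" ..
    have A: "has_bochner_integral (iid M N) (psum a N) 0" and B: "has_bochner_integral (iid M N) (psum b N) 0"
      using psum_mean[of a N] psum_mean[of b N] a b zero by (auto simp: has_bochner_integral_iff)
    have AA: "has_bochner_integral (iid M N) (\<lambda>X. (psum a N X)\<^sup>2) (real N * \<alpha>)"
      and BB: "has_bochner_integral (iid M N) (\<lambda>X. (psum b N X)\<^sup>2) (real N * \<beta>)"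
      and AB: "has_bochner_integral (iid M N) (\<lambda>X. psum a N X * psum b N X) (real N * \<gamma>)"
      using psum_second_moment[of a a N] psum_second_moment[of b b N] psum_second_moment[of a b N] assms
      by (simp_all add: power2_eq_square d)
    have AAB: "integrable (iid M N) (\<lambda>X. (psum a N X)\<^sup>2 * psum b N X)"
      and BBA: "integrable (iid M N) (\<lambda>X. (psum b N X)\<^sup>2 * psum a N X)"
      using cross[of "iid M N" "psum a N" "psum b N"] cross[of "iid M N" "psum b N" "psum a N"] AA BB AABB
      by (auto simp: has_bochner_integral_iff mult.commute[of "(psum b N _)\<^sup>2" "(psum a N _)\<^sup>2"])
    note t = has_bochner_integral_tensor and add = has_bochner_integral_add and hb = has_bochner_integral_integrable
      and m = has_bochner_integral_scale
    \<comment> \<open>The nine terms of \<open>(A + a)^2 (B + b)^2\<close>. Each third order moment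
      is multiplied by the mean of a centred factor, so its value never has to be known, only its
      existence.\<close>
    have "has_bochner_integral (M \<Otimes>\<^sub>M iid M N)
       (\<lambda>z. ((a (fst z))\<^sup>2 * (b (fst z))\<^sup>2) * 1 + 2 * (((a (fst z))\<^sup>2 * b (fst z)) * psum b N (snd z))
         + (a (fst z))\<^sup>2 * (psum b N (snd z))\<^sup>2 + 2 * (((b (fst z))\<^sup>2 * a (fst z)) * psum a N (snd z))
         + 4 * ((a (fst z) * b (fst z)) * (psum a N (snd z) * psum b N (snd z)))
         + 2 * (a (fst z) * ((psum b N (snd z))\<^sup>2 * psum a N (snd z)))
         + (b (fst z))\<^sup>2 * (psum a N (snd z))\<^sup>2
         + 2 * (b (fst z) * ((psum a N (snd z))\<^sup>2 * psum b N (snd z)))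
         + 1 * ((psum a N (snd z))\<^sup>2 * (psum b N (snd z))\<^sup>2))
       (\<delta> * 1 + 2 * (expectation (\<lambda>x. (a x)\<^sup>2 * b x) * 0) + \<alpha> * (real N * \<beta>)
         + 2 * (expectation (\<lambda>x. (b x)\<^sup>2 * a x) * 0) + 4 * (\<gamma> * (real N * \<gamma>))
         + 2 * (0 * pr.expectation (\<lambda>X. (psum b N X)\<^sup>2 * psum a N X)) + \<beta> * (real N * \<alpha>)
         + 2 * (0 * pr.expectation (\<lambda>X. (psum a N X)\<^sup>2 * psum b N X)) + 1 * v)"
      by (rule add[OF add[OF add[OF add[OF add[OF add[OF add[OF add[OF
           t[OF a2b2 pr.has_bochner_integral_const_1] m[OF t[OF hb[OF abb(1)] B]]] t[OF a2 BB]]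
           m[OF t[OF hb[OF abb(2)] A]]] m[OF t[OF ab AB]]] m[OF t[OF a hb[OF BBA]]]] t[OF b2 AA]]
           m[OF t[OF b hb[OF AAB]]]] t[OF has_bochner_integral_const_1 AABB]])
    then have "has_bochner_integral (iid M (Suc N)) (\<lambda>X. (psum a (Suc N) X)\<^sup>2 * (psum b (Suc N) X)\<^sup>2)
       (\<delta> + real N * (2 * \<alpha> * \<beta> + 4 * \<gamma>\<^sup>2) + v)"
      by (intro has_bochner_integral_iid_Suc)
        (simp, simp only: psum_Suc, simp add: algebra_simps power2_eq_square)
    moreover have "\<delta> + real N * (2 * \<alpha> * \<beta> + 4 * \<gamma>\<^sup>2) + v \<le> C * (real (Suc N))\<^sup>2"
    proof -
      have "\<delta> \<le> C" "2 * \<alpha> * \<beta> + 4 * \<gamma>\<^sup>2 \<le> C" using nn by (auto simp: C_def)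
      then have "\<delta> + real N * (2 * \<alpha> * \<beta> + 4 * \<gamma>\<^sup>2) + v \<le> C + real N * C + C * (real N)\<^sup>2"
        using v by (intro add_mono mult_left_mono) auto
      also have "\<dots> \<le> C * (real (Suc N))\<^sup>2"
        using mult_nonneg_nonneg[OF \<open>C \<ge> 0\<close>, of "real N"] by (simp add: power2_eq_square algebra_simps)
      finally show ?thesis .
    qed
    ultimately show ?case by blast
  qed
  with \<open>C \<ge> 0\<close> show ?thesis
    unfolding has_bochner_integral_iff by (intro exI[of _ C] conjI allI) blast+
qed

text \<open>Both squared norms are split into coordinates and the scalar bound is summed. The two
  functions may take values in different spaces, since the deviation of \<open>X\<close> is also
  paired with real functions.\<close>

lemma psum_norm_fourth_moment:
  fixes a :: "_ \<Rightarrow> 'e::euclidean_space" and b :: "_ \<Rightarrow> 'f::euclidean_space"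
  assumes [measurable]: "a \<in> borel_measurable M" "b \<in> borel_measurable M"
    and sq: "integrable M (\<lambda>x. (norm (a x))\<^sup>2)" "integrable M (\<lambda>x. (norm (b x))\<^sup>2)"
    and sqq: "integrable M (\<lambda>x. (norm (a x))\<^sup>2 * (norm (b x))\<^sup>2)"
    and zero: "\<And>i. expectation (\<lambda>x. a x \<bullet> i) = 0" "\<And>j. expectation (\<lambda>x. b x \<bullet> j) = 0"
  shows "\<exists>C\<ge>0. \<forall>N. integrable (iid M N) (\<lambda>X. (norm (psum a N X))\<^sup>2 * (norm (psum b N X))\<^sup>2) \<and>
      integral\<^sup>L (iid M N) (\<lambda>X. (norm (psum a N X))\<^sup>2 * (norm (psum b N X))\<^sup>2) \<le> C * (real N)\<^sup>2"
proof -
  let ?ab = "\<lambda>N i j X. (psum a N X \<bullet> i)\<^sup>2 * (psum b N X \<bullet> j)\<^sup>2"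
  define Q where "Q i j C \<longleftrightarrow> C \<ge> 0 \<and> (\<forall>N. integrable (iid M N) (\<lambda>X. ?ab N i j X) \<and>
      integral\<^sup>L (iid M N) (\<lambda>X. ?ab N i j X) \<le> C * (real N)\<^sup>2)" for i j C
  have "\<forall>i\<in>Basis. \<forall>j\<in>Basis. \<exists>C. Q i j C"
    unfolding Q_def
  proof (intro ballI, unfold inner_psum, rule psum_mixed_fourth_moment)
    fix i :: 'e and j :: 'f assume ij: "i \<in> Basis" "j \<in> Basis"
    show "integrable M (\<lambda>x. (a x \<bullet> i)\<^sup>2)"
      by (rule integrable_dominated[OF sq(1)]) (use ij in \<open>auto simp: power2_inner_Basis_le\<close>)
    show "integrable M (\<lambda>x. (b x \<bullet> j)\<^sup>2)"
      by (rule integrable_dominated[OF sq(2)]) (use ij in \<open>auto simp: power2_inner_Basis_le\<close>)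
    show "integrable M (\<lambda>x. (a x \<bullet> i)\<^sup>2 * (b x \<bullet> j)\<^sup>2)"
      by (rule integrable_dominated[OF sqq]) (use ij in \<open>auto simp: abs_mult intro!: mult_mono power2_inner_Basis_le\<close>)
  qed (use zero in auto)
  then obtain C where "\<And>i j. i \<in> Basis \<Longrightarrow> j \<in> Basis \<Longrightarrow> Q i j (C i j)"
    by metis
  note C = this[unfolded Q_def]
  have nrm: "(norm v)\<^sup>2 = (\<Sum>i\<in>Basis. (v \<bullet> i)\<^sup>2)" for v :: "'x::euclidean_space"
    unfolding power2_norm_eq_inner by (subst euclidean_inner) (simp add: power2_eq_square)
  have eq: "(norm (psum a N X))\<^sup>2 * (norm (psum b N X))\<^sup>2 = (\<Sum>i\<in>Basis. \<Sum>j\<in>Basis. ?ab N i j X)" for N X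
    unfolding nrm by (rule sum_product)
  show ?thesis unfolding eq
  proof (intro exI[of _ "\<Sum>i\<in>Basis. \<Sum>j\<in>Basis. C i j"] conjI allI)
    show "(\<Sum>i\<in>Basis. \<Sum>j\<in>Basis. C i j) \<ge> 0" using C by (simp add: sum_nonneg)
    fix N
    show "integrable (iid M N) (\<lambda>X. \<Sum>i\<in>Basis. \<Sum>j\<in>Basis. ?ab N i j X)"
      using C by (intro Bochner_Integration.integrable_sum) blast
    have "integral\<^sup>L (iid M N) (\<lambda>X. \<Sum>i\<in>Basis. \<Sum>j\<in>Basis. ?ab N i j X)
       = (\<Sum>i\<in>Basis. \<Sum>j\<in>Basis. integral\<^sup>L (iid M N) (\<lambda>X. ?ab N i j X))"
      using C by (subst Bochner_Integration.integral_sum) (auto intro!: Bochner_Integration.integrable_sum sum.cong Bochner_Integration.integral_sum)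
    also have "\<dots> \<le> (\<Sum>i\<in>Basis. \<Sum>j\<in>Basis. C i j * (real N)\<^sup>2)"
      using C by (intro sum_mono) blast
    finally show "integral\<^sup>L (iid M N) (\<lambda>X. \<Sum>i\<in>Basis. \<Sum>j\<in>Basis. ?ab N i j X) \<le> (\<Sum>i\<in>Basis. \<Sum>j\<in>Basis. C i j) * (real N)\<^sup>2"
      by (simp add: sum_distrib_right)
  qed
qed

lemma psum_norm_second_moment:
  fixes a :: "_ \<Rightarrow> 'e::euclidean_space"
  assumes [measurable]: "a \<in> borel_measurable M"
    and sq: "integrable M (\<lambda>x. (norm (a x))\<^sup>2)"
    and zero: "\<And>i. expectation (\<lambda>x. a x \<bullet> i) = 0"
  shows "integrable (iid M N) (\<lambda>X. (norm (psum a N X))\<^sup>2)" (is ?I)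
    and "integral\<^sup>L (iid M N) (\<lambda>X. (norm (psum a N X))\<^sup>2) = real N * expectation (\<lambda>x. (norm (a x))\<^sup>2)" (is ?E)
proof -
  have nrm: "(norm v)\<^sup>2 = (\<Sum>i\<in>Basis. (v \<bullet> i) * (v \<bullet> i))" for v :: "'x::euclidean_space"
    unfolding power2_norm_eq_inner by (rule euclidean_inner)
  have i: "integrable M (\<lambda>x. (a x \<bullet> i)\<^sup>2)" if "i \<in> Basis" for i
    by (rule integrable_dominated[OF sq(1)]) (use that in \<open>auto simp: power2_inner_Basis_le\<close>)
  have "has_bochner_integral (iid M N) (\<lambda>X. (norm (psum a N X))\<^sup>2) (\<Sum>i\<in>Basis. real N * expectation (\<lambda>x. (a x \<bullet> i) * (a x \<bullet> i)))"
    unfolding nrm inner_psum using i zero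
    by (intro has_bochner_integral_sum psum_second_moment) auto
  moreover have "expectation (\<lambda>x. (norm (a x))\<^sup>2) = (\<Sum>i\<in>Basis. expectation (\<lambda>x. (a x \<bullet> i) * (a x \<bullet> i)))"
    unfolding nrm using i by (intro Bochner_Integration.integral_sum) (simp add: power2_eq_square)
  ultimately show ?I ?E by (auto simp: has_bochner_integral_iff sum_distrib_left)
qed

end

subsection \<open>Linearisation of the moment matched estimator\<close>

lemma abs_mult_weighted_le:
  fixes x y s :: real
  assumes "s > 0"
  shows "\<bar>x * y\<bar> \<le> (s * x\<^sup>2 + y\<^sup>2 / s) / 2"
proof -
  have "0 \<le> (s * \<bar>x\<bar> - \<bar>y\<bar>)\<^sup>2 / s" using assms by simp
  also have "\<dots> = s * x\<^sup>2 + y\<^sup>2 / s - 2 * (\<bar>x\<bar> * \<bar>y\<bar>)"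
    using assms by (simp add: power2_diff field_simps power2_eq_square)
  finally show ?thesis by (simp add: abs_mult)
qed

locale l2_law = prob_space P for P :: "(real^'n) measure" +
  assumes sets_P [measurable_cong, simp]: "sets P = sets borel"
    and integrable_norm_sq: "integrable P (\<lambda>x. (norm x)\<^sup>2)"
begin

abbreviation \<mu> where "\<mu> \<equiv> mean_vec P"

lemma space_P [simp]: "space P = UNIV"
  using sets_eq_imp_space_eq[OF sets_P] by simp

lemma integrable_bounded_fn:
  fixes f :: "real^'n \<Rightarrow> 'x::{banach, second_countable_topology}"
  assumes "f \<in> borel_measurable borel" "\<And>x. norm (f x) \<le> B"
  shows "integrable P f"
  using assms by (intro integrable_const_bound[of _ B]) (auto cong: measurable_cong_sets)

lemma integrable_ident: "integrable P (\<lambda>x. x)"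
  by (rule integrable_dominated[of _ "\<lambda>x. 1 + (norm x)\<^sup>2"])
    (use integrable_norm_sq abs_le_1_plus_square[of "norm _"] in auto)

lemma integrable_dev: "integrable P (\<lambda>x. x - \<mu>)"
  using integrable_ident by auto

lemma expectation_dev: "expectation (\<lambda>x. (x - \<mu>) \<bullet> i) = 0"
proof -
  have "expectation (\<lambda>x. (x - \<mu>) \<bullet> i) = (\<integral>x. x - \<mu> \<partial>P) \<bullet> i"
    using integrable_dev by (subst integral_inner_left) auto
  also have "(\<integral>x. x - \<mu> \<partial>P) = 0"
    using integrable_ident prob_space by (simp add: mean_vec_def)
  finally show ?thesis by simp
qed

lemma integrable_norm_sq_dev: "integrable P (\<lambda>x. (norm (x - m))\<^sup>2)"
proof (rule integrable_dominated[of _ "\<lambda>x. 2 * (norm x)\<^sup>2 + 2 * (norm m)\<^sup>2"])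
  fix x :: "real^'n"
  have "(norm (x - m))\<^sup>2 \<le> (norm x + norm m)\<^sup>2"
    by (intro power_mono norm_triangle_ineq4) auto
  also have "\<dots> \<le> 2 * (norm x)\<^sup>2 + 2 * (norm m)\<^sup>2"
    using zero_le_power2[of "norm x - norm m"] by (simp add: power2_sum power2_diff)
  finally show "norm ((norm (x - m))\<^sup>2) \<le> 2 * (norm x)\<^sup>2 + 2 * (norm m)\<^sup>2" by simp
qed (use integrable_norm_sq in auto)

lemmas integrable_dev_norm_sq = integrable_norm_sq_dev[of \<mu>]

lemma integrable_dev_inner_sq: "integrable P (\<lambda>x. ((x - \<mu>) \<bullet> v)\<^sup>2)"
  by (rule integrable_dominated[of _ "\<lambda>x. (norm (x - \<mu>))\<^sup>2 * (norm v)\<^sup>2"])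
    (use integrable_dev_norm_sq Cauchy_Schwarz_ineq in \<open>auto simp: power2_norm_eq_inner\<close>)

end

locale l2_law_test = l2_law P for P :: "(real^'n) measure" +
  fixes f :: "real^'n \<Rightarrow> real"
  assumes cc_f: "cc_smooth f"
begin

definition "mean_grad = (\<integral>x. grad f x \<partial>P)"

text \<open>The influence function of the estimator: to first order, \<open>est\<close> is
  \<open>expectation f\<close> plus the sample mean of \<open>lin\<close>. The last term records the
  effect of recentring the samples.\<close>

definition "lin x = f x - expectation f - mean_grad \<bullet> (x - \<mu>)"

definition "est N X = (1 / real N) * (\<Sum>k<N. f (mm_sample P N X k))"

definition "rem N X = est N X - expectation f - (1 / real N) * psum lin N X"

lemma continuous_f: "continuous_on S f" and continuous_grad_f: "continuous_on S (grad f)"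
  using cc_f by (auto simp: cc_smooth_def smooth_fn_continuous smooth_fn_continuous_grad)

lemma measurable_f [measurable]: "f \<in> borel_measurable borel"
  and measurable_grad_f [measurable]: "grad f \<in> borel_measurable borel"
  using continuous_f continuous_grad_f by (auto intro: borel_measurable_continuous_onI)

lemma integrable_f: "integrable P f"
  using cc_smooth_bounded[OF cc_f] integrable_bounded_fn[of f] by (metis measurable_f real_norm_def)

lemma integrable_grad_f: "integrable P (grad f)"
  using cc_smooth_grad_bounded[OF cc_f] integrable_bounded_fn[of "grad f"] by (metis measurable_grad_f)

lemma measurable_lin [measurable]: "lin \<in> borel_measurable borel"
  unfolding lin_def[abs_def] by measurable

lemma integrable_lin: "integrable P lin"
  unfolding lin_def[abs_def] using integrable_f integrable_inner_right[OF integrable_dev, of mean_grad]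
  by (intro Bochner_Integration.integrable_diff integrable_const) auto

lemma expectation_lin: "expectation lin = 0"
proof -
  have "expectation (\<lambda>x. mean_grad \<bullet> (x - \<mu>)) = 0"
    using expectation_dev[of mean_grad] by (simp add: inner_commute)
  moreover have "integrable P (\<lambda>x. mean_grad \<bullet> (x - \<mu>))"
    by (rule integrable_inner_right[OF integrable_dev])
  ultimately show ?thesis
    unfolding lin_def[abs_def] using integrable_f prob_space
    by (simp add: Bochner_Integration.integral_diff)
qed

lemma lin_sq_le: "\<exists>c. \<forall>x. (lin x)\<^sup>2 \<le> c + 2 * (norm mean_grad)\<^sup>2 * (norm (x - \<mu>))\<^sup>2"
proof -
  obtain B where B: "\<And>x. \<bar>f x\<bar> \<le> B" using cc_smooth_bounded[OF cc_f] by blast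
  define c where "c = B + \<bar>expectation f\<bar>"
  have "(lin x)\<^sup>2 \<le> 2 * c\<^sup>2 + 2 * (norm mean_grad)\<^sup>2 * (norm (x - \<mu>))\<^sup>2" for x
  proof -
    define a where "a = f x - expectation f"
    have "\<bar>a\<bar> \<le> \<bar>c\<bar>" using B[of x] unfolding c_def a_def by linarith
    then have "a\<^sup>2 \<le> c\<^sup>2" by (simp only: abs_le_square_iff)
    moreover have "(lin x)\<^sup>2 \<le> 2 * a\<^sup>2 + 2 * (mean_grad \<bullet> (x - \<mu>))\<^sup>2"
      using zero_le_power2[of "a + mean_grad \<bullet> (x - \<mu>)"]
      by (simp add: lin_def a_def[symmetric] power2_sum power2_diff)
    moreover have "(mean_grad \<bullet> (x - \<mu>))\<^sup>2 \<le> (norm mean_grad)\<^sup>2 * (norm (x - \<mu>))\<^sup>2"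
      using Cauchy_Schwarz_ineq[of mean_grad "x - \<mu>"] by (simp only: power2_norm_eq_inner)
    ultimately show ?thesis by linarith
  qed
  then show ?thesis by blast
qed

lemma integrable_lin_sq: "integrable P (\<lambda>x. (lin x)\<^sup>2)"
proof -
  obtain c where c: "\<forall>x. (lin x)\<^sup>2 \<le> c + 2 * (norm mean_grad)\<^sup>2 * (norm (x - \<mu>))\<^sup>2"
    using lin_sq_le by blast
  show ?thesis
  proof (rule integrable_dominated)
    show "integrable P (\<lambda>x. c + 2 * (norm mean_grad)\<^sup>2 * (norm (x - \<mu>))\<^sup>2)"
      using integrable_dev_norm_sq by auto
  qed (use c in auto)
qed

lemma measurable_component: "k < N \<Longrightarrow> (\<lambda>X. X k) \<in> measurable (iid P N) P"
  by (rule measurable_component_singleton) simp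

lemma measurable_component': "k < N \<Longrightarrow> (\<lambda>X. X k) \<in> borel_measurable (iid P N)"
  using measurable_component[of k N] by (simp cong: measurable_cong_sets)

text \<open>The true mean added back is absorbed into the average, so the shift is a sample mean of
  centred variables. At \<open>N = 0\<close> the division by zero would leave \<mu> behind.\<close>

lemma mm_sample_eq:
  assumes "N \<ge> 1"
  shows "mm_sample P N X k = X k - (1 / real N) *\<^sub>R psum (\<lambda>x. x - \<mu>) N X"
  using assms by (simp add: mm_sample_def sample_mean_def psum_def sum_subtractf scaleR_diff_right sum_constant_scaleR del: sum_constant)

lemma measurable_est [measurable]: "est N \<in> borel_measurable (iid P N)"
proof -
  have "(\<lambda>X. f (mm_sample P N X k)) \<in> borel_measurable (iid P N)" if "k < N" for k
  proof -
    have [measurable]: "(\<lambda>X. \<Sum>k<N. X k) \<in> borel_measurable (iid P N)" "(\<lambda>X. X k) \<in> borel_measurable (iid P N)"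
      using that by (auto intro!: borel_measurable_sum measurable_component')
    show ?thesis unfolding mm_sample_def sample_mean_def by measurable
  qed
  then show ?thesis unfolding est_def[abs_def] by measurable
qed

lemma measurable_rem [measurable]: "rem N \<in> borel_measurable (iid P N)"
  unfolding rem_def[abs_def] by measurable

lemma est_bounded: "\<exists>B. \<forall>N X. \<bar>est N X\<bar> \<le> B"
proof -
  obtain B where B: "B > 0" "\<And>x. \<bar>f x\<bar> \<le> B" using cc_smooth_bounded[OF cc_f] by blast
  have "\<bar>est N X\<bar> \<le> B" for N X
  proof -
    have "\<bar>\<Sum>k<N. f (mm_sample P N X k)\<bar> \<le> (\<Sum>k<N. B)"
      by (rule order_trans[OF sum_abs]) (intro sum_mono B)
    then show ?thesis using B(1) by (cases "N = 0") (auto simp: est_def field_simps abs_mult)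
  qed
  then show ?thesis by blast
qed

lemma mm_var_eq: "mm_var P f N = varM (iid P N) (est N)"
  by (simp add: mm_var_def iid_law_def est_def[abs_def])

definition "grad_dev x = grad f x - mean_grad"

lemma measurable_grad_dev [measurable]: "grad_dev \<in> borel_measurable borel"
  unfolding grad_dev_def[abs_def] by measurable

lemma expectation_grad_dev: "expectation (\<lambda>x. grad_dev x \<bullet> i) = 0"
proof -
  have "integrable P grad_dev"
    unfolding grad_dev_def[abs_def] using integrable_grad_f by auto
  then have "expectation (\<lambda>x. grad_dev x \<bullet> i) = (\<integral>x. grad_dev x \<partial>P) \<bullet> i"
    by (subst integral_inner_left) auto
  also have "(\<integral>x. grad_dev x \<partial>P) = 0"
    using integrable_grad_f prob_space by (simp add: grad_dev_def mean_grad_def)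
  finally show ?thesis by simp
qed

lemma grad_dev_bounded: "\<exists>B. \<forall>x. norm (grad_dev x) \<le> B"
proof -
  obtain B where B: "\<And>x. norm (grad f x) \<le> B" using cc_smooth_grad_bounded[OF cc_f] by blast
  have "norm (grad_dev x) \<le> B + norm mean_grad" for x
    unfolding grad_dev_def using B[of x] norm_triangle_ineq4[of "grad f x" mean_grad] by linarith
  then show ?thesis by blast
qed

lemma integrable_grad_dev_sq_mult:
  assumes "integrable P h" "\<And>x. h x \<ge> 0"
  shows "integrable P (\<lambda>x. (norm (grad_dev x))\<^sup>2 * h x)"
proof -
  obtain B where B: "\<And>x. norm (grad_dev x) \<le> B" using grad_dev_bounded by blast
  show ?thesis
  proof (rule integrable_dominated[of _ "\<lambda>x. B\<^sup>2 * h x"])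
    show "norm ((norm (grad_dev x))\<^sup>2 * h x) \<le> B\<^sup>2 * h x" for x
      using B[of x] assms(2)[of x] by (simp add: abs_mult mult_right_mono power_mono)
  qed (use assms in auto)
qed

text \<open>Each \<open>f (X k - D)\<close> is expanded to second order, with \<open>D\<close> the
  error of the sample mean. The first order terms leave only the fluctuation of the gradient paired
  with \<open>D\<close>, hence a product of two centred sums.\<close>

lemma rem_bound:
  "\<exists>K>0. \<forall>N\<ge>1. \<forall>X. \<bar>rem N X\<bar> \<le> (norm (psum grad_dev N X) * norm (psum (\<lambda>x. x - \<mu>) N X)
      + K * (norm (psum (\<lambda>x. x - \<mu>) N X))\<^sup>2) / (real N)\<^sup>2"
  (is "\<exists>K>0. \<forall>N\<ge>1. \<forall>X. ?bound K N X")
proof -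
  obtain K where K: "K > 0" "\<And>x d. \<bar>f (x - d) - f x + grad f x \<bullet> d\<bar> \<le> K * (norm d)\<^sup>2"
    using cc_smooth_taylor[OF cc_f] by blast
  have "?bound K N X" if N: "N \<ge> 1" for N X
  proof -
    define U where "U = psum (\<lambda>x. x - \<mu>) N X"
    define V where "V = psum grad_dev N X"
    define D where "D = (1 / real N) *\<^sub>R U"
    define r where "r k = f (X k - D) - f (X k) + grad f (X k) \<bullet> D" for k
    have nD: "norm D = norm U / real N" by (simp add: D_def)
    have UD: "U = real N *\<^sub>R D" using N by (simp add: D_def)
    have V: "(\<Sum>k<N. grad f (X k) \<bullet> D) = V \<bullet> D + real N * (mean_grad \<bullet> D)"
      by (simp add: V_def psum_def grad_dev_def inner_sum_left inner_diff_left sum_subtractf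
          sum_constant_scaleR del: sum_constant)
    have UU: "(\<Sum>k<N. mean_grad \<bullet> (X k - \<mu>)) = real N * (mean_grad \<bullet> D)"
      using UD unfolding U_def psum_def by (metis inner_scaleR_right inner_sum_right)
    have est: "real N * est N X = (\<Sum>k<N. f (X k - D))"
      using N by (simp add: est_def mm_sample_eq D_def U_def)
    have "real N * rem N X = (\<Sum>k<N. f (X k - D)) - real N * expectation f - psum lin N X"
      using N by (simp add: rem_def est[symmetric] algebra_simps)
    also have "psum lin N X = (\<Sum>k<N. f (X k)) - real N * expectation f - real N * (mean_grad \<bullet> D)"
      by (simp add: psum_def lin_def sum_subtractf UU)
    also have "(\<Sum>k<N. f (X k - D)) = (\<Sum>k<N. r k) + (\<Sum>k<N. f (X k)) - (V \<bullet> D + real N * (mean_grad \<bullet> D))"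
      unfolding V[symmetric] by (simp add: r_def sum.distrib sum_subtractf)
    \<comment> \<open>The deterministic part \<open>N * (mean_grad \<bullet> D)\<close> of the
      gradient sum cancels against the linear correction inside \<open>lin\<close>.\<close>
    finally have "real N * rem N X = (\<Sum>k<N. r k) - V \<bullet> D" by simp
    moreover have "\<bar>\<Sum>k<N. r k\<bar> \<le> (\<Sum>k<N. K * (norm D)\<^sup>2)"
      unfolding r_def by (rule order_trans[OF sum_abs]) (intro sum_mono K)
    moreover have "\<bar>V \<bullet> D\<bar> \<le> norm V * norm D" by (rule Cauchy_Schwarz_ineq2)
    ultimately have "\<bar>real N * rem N X\<bar> \<le> real N * (K * (norm D)\<^sup>2) + norm V * norm D" by simp
    then have "real N * \<bar>rem N X\<bar> \<le> (norm V * norm U + K * (norm U)\<^sup>2) / real N"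
      using N by (simp add: abs_mult nD power2_eq_square field_simps)
    then show ?thesis using N
      by (simp add: U_def[symmetric] V_def[symmetric] field_simps power2_eq_square)
  qed
  with K(1) show ?thesis by blast
qed

text \<open>AM-GM with weight \<open>sqrt N\<close> reduces the mixed third moments to second and mixed fourth moments,
  so that no fourth moment of \<open>X\<close> is needed when \<open>\<phi>\<close> is bounded.\<close>

lemma rem_correlation_bound:
  assumes [measurable]: "\<phi> \<in> borel_measurable borel"
    and phi: "integrable P (\<lambda>x. (\<phi> x)\<^sup>2)" "integrable P (\<lambda>x. (norm (x - \<mu>))\<^sup>2 * (\<phi> x)\<^sup>2)" "expectation \<phi> = 0"
  shows "\<exists>C. \<forall>N\<ge>1. integrable (iid P N) (\<lambda>X. rem N X * psum \<phi> N X) \<and>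
     \<bar>\<integral>X. rem N X * psum \<phi> N X \<partial>iid P N\<bar> \<le> C / sqrt (real N)"
proof -
  let ?U = "psum (\<lambda>x. x - \<mu>)" and ?V = "psum grad_dev"
  let ?VP = "\<lambda>N X. (norm (?V N X))\<^sup>2 * (norm (psum \<phi> N X))\<^sup>2" and ?UP = "\<lambda>N X. (norm (?U N X))\<^sup>2 * (norm (psum \<phi> N X))\<^sup>2"
  obtain K where K: "K > 0" and rem: "\<And>N X. N \<ge> 1 \<Longrightarrow> \<bar>rem N X\<bar> \<le> (norm (?V N X) * norm (?U N X)
      + K * (norm (?U N X))\<^sup>2) / (real N)\<^sup>2" using rem_bound by blast
  have V2: "integrable P (\<lambda>x. (norm (grad_dev x))\<^sup>2)"
    and V2phi: "integrable P (\<lambda>x. (norm (grad_dev x))\<^sup>2 * (norm (\<phi> x))\<^sup>2)"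
    using integrable_grad_dev_sq_mult[of "\<lambda>_. 1"] integrable_grad_dev_sq_mult[OF phi(1)] by auto
  obtain C1 where C1: "C1 \<ge> 0" "\<And>N. integrable (iid P N) (\<lambda>X. ?VP N X)"
    "\<And>N. integral\<^sup>L (iid P N) (\<lambda>X. ?VP N X) \<le> C1 * (real N)\<^sup>2"
    using psum_norm_fourth_moment[of grad_dev \<phi>] V2 V2phi phi expectation_grad_dev by auto
  obtain C2 where C2: "C2 \<ge> 0" "\<And>N. integrable (iid P N) (\<lambda>X. ?UP N X)"
    "\<And>N. integral\<^sup>L (iid P N) (\<lambda>X. ?UP N X) \<le> C2 * (real N)\<^sup>2"
    using psum_norm_fourth_moment[of "\<lambda>x. x - \<mu>" \<phi>] integrable_dev_norm_sq phi expectation_dev by auto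
  define c where "c = expectation (\<lambda>x. (norm (x - \<mu>))\<^sup>2)"
  have U: "integrable (iid P N) (\<lambda>X. (norm (?U N X))\<^sup>2)"
     "integral\<^sup>L (iid P N) (\<lambda>X. (norm (?U N X))\<^sup>2) = real N * c" for N
    unfolding c_def using integrable_dev_norm_sq expectation_dev
    by (intro psum_norm_second_moment; simp)+
  define C where "C = ((1 + K) * c + C1 + K * C2) / 2"
  have "integrable (iid P N) (\<lambda>X. rem N X * psum \<phi> N X) \<and>
     \<bar>\<integral>X. rem N X * psum \<phi> N X \<partial>iid P N\<bar> \<le> C / sqrt (real N)" if N: "N \<ge> 1" for N
  proof -
    \<comment> \<open>This weight balances the two sides: the second moment of \<open>?U\<close> is
      of order \<open>N\<close> and the mixed fourth moments are of order \<open>N^2\<close>, so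
      after division by \<open>N^2\<close> both contribute order \<open>1 / s\<close>.\<close>
    define s where "s = sqrt (real N)"
    have s: "s > 0" "s * s = real N" using N by (auto simp: s_def)
    define H where "H X = ((1 + K) * s * (norm (?U N X))\<^sup>2 + ?VP N X / s
       + K * (?UP N X) / s) / (2 * (real N)\<^sup>2)" for X
    have H: "\<bar>rem N X * psum \<phi> N X\<bar> \<le> H X" for X
    proof -
      let ?u = "norm (?U N X)" and ?v = "norm (?V N X)" and ?p = "\<bar>psum \<phi> N X\<bar>"
      have 1: "?u * (?v * ?p) \<le> (s * ?u\<^sup>2 + (?v * ?p)\<^sup>2 / s) / 2"
        and 2: "?u * (?u * ?p) \<le> (s * ?u\<^sup>2 + (?u * ?p)\<^sup>2 / s) / 2"
        using abs_mult_weighted_le[OF s(1), of ?u "?v * ?p"] abs_mult_weighted_le[OF s(1), of ?u "?u * ?p"]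
        by (simp_all add: abs_mult)
      have "\<bar>rem N X * psum \<phi> N X\<bar> \<le> (?v * ?u + K * ?u\<^sup>2) / (real N)\<^sup>2 * ?p"
        unfolding abs_mult using rem[OF N] by (intro mult_right_mono) auto
      also have "\<dots> = (?u * (?v * ?p) + K * (?u * (?u * ?p))) / (real N)\<^sup>2"
        by (simp add: field_simps power2_eq_square)
      also have "\<dots> \<le> ((s * ?u\<^sup>2 + (?v * ?p)\<^sup>2 / s) / 2 + K * ((s * ?u\<^sup>2 + (?u * ?p)\<^sup>2 / s) / 2)) / (real N)\<^sup>2"
        using K 1 2 by (intro divide_right_mono add_mono mult_left_mono) auto
      also have "\<dots> = H X"
        using N by (simp add: H_def power_mult_distrib add_divide_distrib algebra_simps)
      finally show ?thesis .
    qed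
    have iH: "integrable (iid P N) H"
      unfolding H_def using U C1 C2 by simp
    have "integral\<^sup>L (iid P N) H = ((1 + K) * s * (real N * c) + integral\<^sup>L (iid P N) (\<lambda>X. ?VP N X) / s
       + K * integral\<^sup>L (iid P N) (\<lambda>X. ?UP N X) / s) / (2 * (real N)\<^sup>2)"
      unfolding H_def using U C1(2) C2(2) by (simp del: real_norm_def)
    also have "\<dots> \<le> ((1 + K) * s * (real N * c) + C1 * (real N)\<^sup>2 / s + K * (C2 * (real N)\<^sup>2) / s) / (2 * (real N)\<^sup>2)"
      using K s C1(3) C2(3) by (intro divide_right_mono add_mono mult_left_mono order_refl) auto
    also have "\<dots> = C / s"
      using s(1) unfolding s(2)[symmetric] C_def by (simp add: field_simps power2_eq_square)
    finally have "integral\<^sup>L (iid P N) H \<le> C / s" .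
    moreover have int: "integrable (iid P N) (\<lambda>X. rem N X * psum \<phi> N X)"
      by (rule integrable_dominated[OF iH]) (use H in auto)
    moreover have "\<bar>\<integral>X. rem N X * psum \<phi> N X \<partial>iid P N\<bar> \<le> integral\<^sup>L (iid P N) H"
      using int iH H by (intro order_trans[OF integral_abs_bound] integral_mono) auto
    ultimately show ?thesis by (simp add: s_def)
  qed
  then show ?thesis by blast
qed

text \<open>The square of the remainder contains \<open>norm (?U N X) ^ 4\<close>, which is where
  the fourth moment of \<open>X\<close> enters. The true order is \<open>1 / N\<close>; it is
  weakened to match the rate of the correlation bound.\<close>

lemma rem_sq_bound:
  assumes fourth: "integrable P (\<lambda>x. (norm (x - \<mu>))^4)"
  shows "\<exists>C. \<forall>N\<ge>1. integrable (iid P N) (\<lambda>X. (rem N X)\<^sup>2) \<and>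
     real N * (\<integral>X. (rem N X)\<^sup>2 \<partial>iid P N) \<le> C / sqrt (real N)"
proof -
  let ?U = "psum (\<lambda>x. x - \<mu>)" and ?V = "psum grad_dev"
  let ?VU = "\<lambda>N X. (norm (?V N X))\<^sup>2 * (norm (?U N X))\<^sup>2" and ?UU = "\<lambda>N X. (norm (?U N X))\<^sup>2 * (norm (?U N X))\<^sup>2"
  obtain K where K: "K > 0" and rem: "\<And>N X. N \<ge> 1 \<Longrightarrow> \<bar>rem N X\<bar> \<le> (norm (?V N X) * norm (?U N X)
      + K * (norm (?U N X))\<^sup>2) / (real N)\<^sup>2" using rem_bound by blast
  have V2: "integrable P (\<lambda>x. (norm (grad_dev x))\<^sup>2)"
    and V2U: "integrable P (\<lambda>x. (norm (grad_dev x))\<^sup>2 * (norm (x - \<mu>))\<^sup>2)"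
    using integrable_grad_dev_sq_mult[of "\<lambda>_. 1"] integrable_grad_dev_sq_mult[OF integrable_dev_norm_sq] by auto
  have U4: "integrable P (\<lambda>x. (norm (x - \<mu>))\<^sup>2 * (norm (x - \<mu>))\<^sup>2)"
    using fourth by (simp flip: power_add)
  obtain C1 where C1: "C1 \<ge> 0" "\<And>N. integrable (iid P N) (\<lambda>X. ?VU N X)"
    "\<And>N. integral\<^sup>L (iid P N) (\<lambda>X. ?VU N X) \<le> C1 * (real N)\<^sup>2"
    using psum_norm_fourth_moment[of grad_dev "\<lambda>x. x - \<mu>"] V2 V2U integrable_dev_norm_sq
      expectation_dev expectation_grad_dev by auto
  obtain C2 where C2: "C2 \<ge> 0" "\<And>N. integrable (iid P N) (\<lambda>X. ?UU N X)"
    "\<And>N. integral\<^sup>L (iid P N) (\<lambda>X. ?UU N X) \<le> C2 * (real N)\<^sup>2"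
    using psum_norm_fourth_moment[of "\<lambda>x. x - \<mu>" "\<lambda>x. x - \<mu>"] U4 integrable_dev_norm_sq expectation_dev by auto
  define C where "C = 2 * C1 + 2 * K\<^sup>2 * C2"
  have "C \<ge> 0" using C1 C2 by (simp add: C_def)
  have "integrable (iid P N) (\<lambda>X. (rem N X)\<^sup>2) \<and>
     real N * (\<integral>X. (rem N X)\<^sup>2 \<partial>iid P N) \<le> C / sqrt (real N)" if N: "N \<ge> 1" for N
  proof -
    define H where "H X = (2 * ?VU N X
       + 2 * K\<^sup>2 * ?UU N X) / (real N)^4" for X
    have H: "(rem N X)\<^sup>2 \<le> H X" for X
    proof -
      let ?u = "norm (?U N X)" and ?v = "norm (?V N X)"
      have "(rem N X)\<^sup>2 \<le> ((?v * ?u + K * ?u\<^sup>2) / (real N)\<^sup>2)\<^sup>2"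
        using power_mono[OF rem[OF N], of X 2] by simp
      also have "\<dots> = (?v * ?u + K * ?u\<^sup>2)\<^sup>2 / (real N)^4"
        by (simp add: power_divide)
      also have "(?v * ?u + K * ?u\<^sup>2)\<^sup>2 \<le> 2 * (?v * ?u)\<^sup>2 + 2 * (K * ?u\<^sup>2)\<^sup>2"
        using zero_le_power2[of "?v * ?u - K * ?u\<^sup>2"] by (simp add: power2_sum power2_diff)
      finally show ?thesis
        using N by (simp add: H_def power_mult_distrib divide_right_mono power2_eq_square mult_ac)
    qed
    have iH: "integrable (iid P N) H"
      unfolding H_def using C1 C2 by simp
    have int: "integrable (iid P N) (\<lambda>X. (rem N X)\<^sup>2)"
      by (rule integrable_dominated[OF iH]) (use H in auto)
    have "integral\<^sup>L (iid P N) H = (2 * integral\<^sup>L (iid P N) (\<lambda>X. ?VU N X)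
       + 2 * K\<^sup>2 * integral\<^sup>L (iid P N) (\<lambda>X. ?UU N X)) / (real N)^4"
      unfolding H_def using C1(2) C2(2) by simp
    also have "\<dots> \<le> (2 * (C1 * (real N)\<^sup>2) + 2 * K\<^sup>2 * (C2 * (real N)\<^sup>2)) / (real N)^4"
      using C1(3) C2(3) by (intro divide_right_mono add_mono mult_left_mono) auto
    also have "\<dots> = C / (real N)\<^sup>2"
      using N by (simp add: C_def field_simps power2_eq_square eval_nat_numeral)
    finally have "integral\<^sup>L (iid P N) H \<le> C / (real N)\<^sup>2" .
    moreover have "(\<integral>X. (rem N X)\<^sup>2 \<partial>iid P N) \<le> integral\<^sup>L (iid P N) H"
      using int iH H by (intro integral_mono) auto
    ultimately have "real N * (\<integral>X. (rem N X)\<^sup>2 \<partial>iid P N) \<le> real N * (C / (real N)\<^sup>2)"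
      by (intro mult_left_mono) auto
    also have "\<dots> = C / real N" using N by (simp add: power2_eq_square)
    also have "\<dots> \<le> C / sqrt (real N)"
      using N \<open>C \<ge> 0\<close> by (intro divide_left_mono) (auto simp: real_le_lsqrt power2_eq_square)
    finally show ?thesis using int by blast
  qed
  then show ?thesis by blast
qed

end

section \<open>Covariance matrices as quadratic forms\<close>

lemma has_bochner_integral_nonneg:
  fixes f :: "'a \<Rightarrow> real"
  assumes "has_bochner_integral M f v" "\<And>x. 0 \<le> f x"
  shows "0 \<le> v"
  using has_bochner_integral_integral_eq[OF assms(1)] Bochner_Integration.integral_nonneg[of M f] assms(2)
  by simp

context l2_law
begin

lemma integrable_dev_inner_mult: "integrable P (\<lambda>x. ((x - \<mu>) \<bullet> v) * ((x - \<mu>) \<bullet> w))"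
  by (rule integrable_mult_of_squares) (auto simp: integrable_dev_inner_sq)

lemma inner_cov_mat: "v \<bullet> (cov_mat P *v w) = expectation (\<lambda>x. ((x - \<mu>) \<bullet> v) * ((x - \<mu>) \<bullet> w))"
proof -
  have i: "integrable P (\<lambda>x. (x $ i - \<mu> $ i) * (x $ j - \<mu> $ j))" for i j
    using integrable_dev_inner_mult[of "axis i 1" "axis j 1"] by (simp add: inner_axis)
  have "expectation (\<lambda>x. ((x - \<mu>) \<bullet> v) * ((x - \<mu>) \<bullet> w))
    = expectation (\<lambda>x. \<Sum>i\<in>UNIV. \<Sum>j\<in>UNIV. v $ i * w $ j * ((x $ i - \<mu> $ i) * (x $ j - \<mu> $ j)))"
    by (simp add: inner_vec_def sum_product mult_ac)
  also have "\<dots> = (\<Sum>i\<in>UNIV. \<Sum>j\<in>UNIV. v $ i * w $ j * cov_mat P $ i $ j)"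
    using i by (simp add: Bochner_Integration.integral_sum cov_mat_def)
  also have "\<dots> = v \<bullet> (cov_mat P *v w)"
    by (simp add: inner_vec_def matrix_vector_mult_def sum_distrib_left mult_ac)
  finally show ?thesis by simp
qed

lemma cov_mat_transpose: "transpose (cov_mat P) = cov_mat P"
  by (simp add: vec_eq_iff transpose_def cov_mat_def mult.commute)

text \<open>A direction of zero variance has almost surely constant projection, so its covariance
  with every other direction vanishes as well.\<close>

lemma cov_mat_null:
  assumes "expectation (\<lambda>x. ((x - \<mu>) \<bullet> v)\<^sup>2) = 0"
  shows "cov_mat P *v v = 0"
proof -
  have ae: "AE x in P. ((x - \<mu>) \<bullet> v)\<^sup>2 = 0"
    using assms integrable_dev_inner_sq[of v] by (subst (asm) integral_nonneg_eq_0_iff_AE) auto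
  have "w \<bullet> (cov_mat P *v v) = 0" for w
    unfolding inner_cov_mat by (rule integral_eq_zero_AE) (use ae in eventually_elim, auto)
  then show ?thesis by (metis inner_eq_zero_iff)
qed

text \<open>The quadratic form at \<open>v\<close> is a variance, hence nonnegative, and its
  vanishing would put \<open>v\<close> in the kernel of a non-singular matrix.\<close>

lemma cov_mat_pos_def:
  assumes "det (cov_mat P) \<noteq> 0"
  shows "pos_def (cov_mat P)"
  unfolding pos_def_def
proof (intro conjI allI impI)
  fix v :: "real^'n" assume "v \<noteq> 0"
  have "v \<bullet> (cov_mat P *v v) = expectation (\<lambda>x. ((x - \<mu>) \<bullet> v)\<^sup>2)"
    by (simp add: inner_cov_mat power2_eq_square)
  moreover have "expectation (\<lambda>x. ((x - \<mu>) \<bullet> v)\<^sup>2) \<noteq> 0"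
    using cov_mat_null[of v] assms \<open>v \<noteq> 0\<close>
    by (metis invertible_det_nz matrix_left_invertible_ker invertible_left_inverse)
  moreover have "expectation (\<lambda>x. ((x - \<mu>) \<bullet> v)\<^sup>2) \<ge> 0" by simp
  ultimately show "v \<bullet> (cov_mat P *v v) > 0" by linarith
qed (rule cov_mat_transpose)

end

section \<open>Variance of the estimator: lower bound and limit\<close>

context l2_law_test
begin

lemma has_bochner_integral_var_est:
  "has_bochner_integral (iid P N) (\<lambda>X. (est N X - integral\<^sup>L (iid P N) (est N))\<^sup>2) (mm_var P f N)"
proof -
  interpret pr: prob_space "iid P N" by (rule prob_space_iid)
  obtain B where B: "\<And>N X. \<bar>est N X\<bar> \<le> B" using est_bounded by blast
  define e where "e = integral\<^sup>L (iid P N) (est N)"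
  have "integrable (iid P N) (\<lambda>X. (est N X - e)\<^sup>2)"
  proof (rule pr.integrable_const_bound[of _ "(B + \<bar>e\<bar>)\<^sup>2"])
    have "\<bar>est N X - e\<bar> \<le> \<bar>B + \<bar>e\<bar>\<bar>" for X using B[of N X] by linarith
    then show "AE X in iid P N. norm ((est N X - e)\<^sup>2) \<le> (B + \<bar>e\<bar>)\<^sup>2"
      by (simp add: abs_le_square_iff)
  qed simp
  then show ?thesis by (simp add: has_bochner_integral_iff mm_var_eq varM_def e_def)
qed

lemma has_bochner_integral_psum_lin:
  assumes [measurable]: "\<phi> \<in> borel_measurable borel"
    and "integrable P (\<lambda>x. (\<phi> x)\<^sup>2)" "expectation \<phi> = 0"
  shows "has_bochner_integral (iid P N) (\<lambda>X. psum lin N X * psum \<phi> N X)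
      (real N * expectation (\<lambda>x. lin x * \<phi> x))"
  using assms by (intro psum_second_moment) (auto simp: integrable_lin_sq expectation_lin)

text \<open>Obtained by expanding the mean square of \<open>est\<close> minus its mean minus the
  sample mean of \<phi>, which is nonnegative. The square of \<open>rem\<close> never appears, so
  second moments of \<open>X\<close> suffice as \<phi> is bounded. The bound is sharpest for \<phi>
  close to \<open>lin\<close>.\<close>

lemma mm_var_lower_bound:
  assumes [measurable]: "\<phi> \<in> borel_measurable borel" and bd: "\<And>x. \<bar>\<phi> x\<bar> \<le> B" and zero: "expectation \<phi> = 0"
  shows "\<exists>C. \<forall>N\<ge>1. real N * mm_var P f N \<ge>
      2 * expectation (\<lambda>x. lin x * \<phi> x) - expectation (\<lambda>x. (\<phi> x)\<^sup>2) - C / sqrt (real N)"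
proof -
  have sq: "(\<phi> x)\<^sup>2 \<le> B\<^sup>2" for x using bd[of x] by (metis abs_le_square_iff abs_ge_self order_trans)
  have i1: "integrable P (\<lambda>x. (\<phi> x)\<^sup>2)"
    using sq by (intro integrable_bounded_fn[of _ "B\<^sup>2"]) auto
  have i2: "integrable P (\<lambda>x. (norm (x - \<mu>))\<^sup>2 * (\<phi> x)\<^sup>2)"
    by (rule integrable_dominated[of _ "\<lambda>x. (norm (x - \<mu>))\<^sup>2 * B\<^sup>2"])
      (use integrable_dev_norm_sq sq in \<open>auto simp: abs_mult mult_left_mono\<close>)
  obtain C where C: "\<And>N. N \<ge> 1 \<Longrightarrow> integrable (iid P N) (\<lambda>X. rem N X * psum \<phi> N X)"
    "\<And>N. N \<ge> 1 \<Longrightarrow> \<bar>\<integral>X. rem N X * psum \<phi> N X \<partial>iid P N\<bar> \<le> C / sqrt (real N)"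
    using rem_correlation_bound[OF assms(1) i1 i2 zero] by blast
  have "real N * mm_var P f N \<ge>
      2 * expectation (\<lambda>x. lin x * \<phi> x) - expectation (\<lambda>x. (\<phi> x)\<^sup>2) - 2 * C / sqrt (real N)" if N: "N \<ge> 1" for N
  proof -
    interpret pr: prob_space "iid P N" by (rule prob_space_iid)
    define R where "R = (\<integral>X. rem N X * psum \<phi> N X \<partial>iid P N)"
    define e where "e = pr.expectation (est N)"
    have iphi: "integrable P \<phi>" using bd by (intro integrable_bounded_fn) auto
    have h1: "has_bochner_integral (iid P N) (psum \<phi> N) 0"
      using psum_mean[OF iphi, of N] zero by simp
    have h2: "has_bochner_integral (iid P N) (\<lambda>X. psum \<phi> N X * psum \<phi> N X) (real N * expectation (\<lambda>x. (\<phi> x)\<^sup>2))"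
      using psum_second_moment[of \<phi> \<phi> N] i1 zero by (simp add: power2_eq_square)
    have h3: "has_bochner_integral (iid P N) (\<lambda>X. rem N X * psum \<phi> N X) R"
      using C(1)[OF N] by (simp add: R_def has_bochner_integral_iff)
    note h4 = has_bochner_integral_psum_lin[OF assms(1) i1 zero, of N]
    note m = has_bochner_integral_scale and add = has_bochner_integral_add
    \<comment> \<open>The factor of the cross terms in that square. The deviation of
      \<open>est\<close> is split into its constant, \<open>lin\<close> and \<open>rem\<close>
      parts, each integrated separately against \<open>psum \<phi> N\<close>.\<close>
    define c where "c = - 2 / real N"
    have "has_bochner_integral (iid P N) (\<lambda>X. (est N X - e)\<^sup>2 + c * ((expectation f - e) * psum \<phi> N X)
        + c * ((1 / real N) * (psum lin N X * psum \<phi> N X)) + c * (rem N X * psum \<phi> N X)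
        + (1 / (real N)\<^sup>2) * (psum \<phi> N X * psum \<phi> N X))
      (mm_var P f N + c * ((expectation f - e) * 0) + c * ((1 / real N) * (real N * expectation (\<lambda>x. lin x * \<phi> x)))
        + c * R + (1 / (real N)\<^sup>2) * (real N * expectation (\<lambda>x. (\<phi> x)\<^sup>2)))" (is "has_bochner_integral _ ?F ?v")
      unfolding e_def
      by (rule add[OF add[OF add[OF add[OF has_bochner_integral_var_est m[OF m[OF h1]]] m[OF m[OF h4]]] m[OF h3]] m[OF h2]])
    moreover have "0 \<le> ?F X" for X
    proof -
      have *: "est N X = rem N X + expectation f + psum lin N X / real N" by (simp add: rem_def)
      have "(x - e)\<^sup>2 + c * ((F - e) * p) + c * ((1 / real N) * (l * p)) + c * (r * p) + (1 / (real N)\<^sup>2) * (p * p)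
          = (x - e - p / real N)\<^sup>2" if "x = r + F + l / real N" for x r F p l
        unfolding that c_def using N by (simp add: power2_eq_square field_simps)
      from this[OF *, of "psum \<phi> N X"] show ?thesis by simp
    qed
    ultimately have "0 \<le> ?v" by (rule has_bochner_integral_nonneg)
    then have "0 \<le> real N * (mm_var P f N + c * expectation (\<lambda>x. lin x * \<phi> x)
        + c * R + expectation (\<lambda>x. (\<phi> x)\<^sup>2) / real N)"
      using N by (intro mult_nonneg_nonneg) (simp_all add: power2_eq_square field_simps)
    also have "\<dots> = real N * mm_var P f N - 2 * expectation (\<lambda>x. lin x * \<phi> x) - 2 * R + expectation (\<lambda>x. (\<phi> x)\<^sup>2)"
      using N by (simp add: c_def field_simps)
    finally show ?thesis using C(2)[OF N] by (simp add: R_def[symmetric] abs_le_iff)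
  qed
  then show ?thesis by blast
qed

text \<open>With \<open>est\<close> decomposed into \<open>lin\<close> and \<open>rem\<close> parts,
  \<open>N\<close> times the variance is E lin^2, plus twice the correlation of \<open>rem\<close>
  with \<open>psum lin N\<close>, plus \<open>N\<close> times the variance of \<open>rem\<close>.
  Both corrections are of order \<open>1 / sqrt N\<close>.\<close>

lemma mm_var_asymptotics:
  assumes fourth: "integrable P (\<lambda>x. (norm (x - \<mu>))^4)"
  shows "\<exists>C. \<forall>N\<ge>1. \<bar>real N * mm_var P f N - expectation (\<lambda>x. (lin x)\<^sup>2)\<bar> \<le> C / sqrt (real N)"
proof -
  define g where "g = 2 * (norm mean_grad)\<^sup>2"
  obtain c where c: "\<forall>x. (lin x)\<^sup>2 \<le> c + g * (norm (x - \<mu>))\<^sup>2"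
    using lin_sq_le unfolding g_def by blast
  \<comment> \<open>\<open>lin\<close> takes the role of \<phi> in
    \<open>rem_correlation_bound\<close>. It is unbounded but grows at most linearly, so this
    product is controlled by the fourth moment.\<close>
  have i2: "integrable P (\<lambda>x. (norm (x - \<mu>))\<^sup>2 * (lin x)\<^sup>2)"
  proof (rule integrable_dominated[of _ "\<lambda>x. c * (norm (x - \<mu>))\<^sup>2 + g * (norm (x - \<mu>))^4"])
    fix x
    have "(norm (x - \<mu>))\<^sup>2 * (lin x)\<^sup>2 \<le> (norm (x - \<mu>))\<^sup>2 * (c + g * (norm (x - \<mu>))\<^sup>2)"
      using c by (intro mult_left_mono) auto
    also have "\<dots> = c * (norm (x - \<mu>))\<^sup>2 + g * (norm (x - \<mu>))^4"
      by (simp add: algebra_simps eval_nat_numeral)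
    finally show "norm ((norm (x - \<mu>))\<^sup>2 * (lin x)\<^sup>2) \<le> c * (norm (x - \<mu>))\<^sup>2 + g * (norm (x - \<mu>))^4"
      by simp
  qed (use integrable_dev_norm_sq fourth in auto)
  obtain C where C: "\<And>N. N \<ge> 1 \<Longrightarrow> integrable (iid P N) (\<lambda>X. rem N X * psum lin N X)"
    "\<And>N. N \<ge> 1 \<Longrightarrow> \<bar>\<integral>X. rem N X * psum lin N X \<partial>iid P N\<bar> \<le> C / sqrt (real N)"
    using rem_correlation_bound[OF measurable_lin integrable_lin_sq i2 expectation_lin] by blast
  obtain C' where C': "\<And>N. N \<ge> 1 \<Longrightarrow> integrable (iid P N) (\<lambda>X. (rem N X)\<^sup>2)"
    "\<And>N. N \<ge> 1 \<Longrightarrow> real N * (\<integral>X. (rem N X)\<^sup>2 \<partial>iid P N) \<le> C' / sqrt (real N)"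
    using rem_sq_bound[OF fourth] by blast
  have "\<bar>real N * mm_var P f N - expectation (\<lambda>x. (lin x)\<^sup>2)\<bar> \<le> (2 * C + C') / sqrt (real N)" if N: "N \<ge> 1" for N
  proof -
    interpret pr: prob_space "iid P N" by (rule prob_space_iid)
    define R where "R = (\<integral>X. rem N X * psum lin N X \<partial>iid P N)"
    define Q where "Q = (\<integral>X. (rem N X)\<^sup>2 \<partial>iid P N)"
    define \<rho> where "\<rho> = pr.expectation (rem N)"
    have h1: "has_bochner_integral (iid P N) (psum lin N) 0"
      using psum_mean[OF integrable_lin, of N] expectation_lin by simp
    have h2: "has_bochner_integral (iid P N) (\<lambda>X. psum lin N X * psum lin N X) (real N * expectation (\<lambda>x. (lin x)\<^sup>2))"
      using has_bochner_integral_psum_lin[OF measurable_lin integrable_lin_sq expectation_lin, of N]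
      by (simp add: power2_eq_square)
    have h3: "has_bochner_integral (iid P N) (\<lambda>X. rem N X * psum lin N X) R"
      using C(1)[OF N] by (simp add: R_def has_bochner_integral_iff)
    have h4: "has_bochner_integral (iid P N) (\<lambda>X. (rem N X)\<^sup>2) Q"
      using C'(1)[OF N] by (simp add: Q_def has_bochner_integral_iff)
    have h5: "has_bochner_integral (iid P N) (rem N) \<rho>"
      using pr.integrable_of_square[OF measurable_rem C'(1)[OF N]] by (simp add: \<rho>_def has_bochner_integral_iff)
    note m = has_bochner_integral_scale and add = has_bochner_integral_add
    have "has_bochner_integral (iid P N) (\<lambda>X. rem N X + expectation f + (1 / real N) * psum lin N X)
        (\<rho> + expectation f + (1 / real N) * 0)"
      by (rule add[OF add[OF h5 pr.has_bochner_integral_const_1] m[OF h1]])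
    then have e: "pr.expectation (est N) = \<rho> + expectation f"
      by (simp add: rem_def has_bochner_integral_iff)
    have "has_bochner_integral (iid P N)
      (\<lambda>X. (1 / (real N)\<^sup>2) * (psum lin N X * psum lin N X) + (2 / real N) * (rem N X * psum lin N X)
         + (rem N X)\<^sup>2 + (- 2 * \<rho>) * rem N X + \<rho>\<^sup>2 + (- 2 * \<rho> / real N) * psum lin N X)
      ((1 / (real N)\<^sup>2) * (real N * expectation (\<lambda>x. (lin x)\<^sup>2)) + (2 / real N) * R
         + Q + (- 2 * \<rho>) * \<rho> + \<rho>\<^sup>2 + (- 2 * \<rho> / real N) * 0)" (is "has_bochner_integral _ ?F ?v")
      by (rule add[OF add[OF add[OF add[OF add[OF m[OF h2] m[OF h3]] h4] m[OF h5]] pr.has_bochner_integral_const_1] m[OF h1]])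
    moreover have "?F X = (est N X - pr.expectation (est N))\<^sup>2" for X
    proof -
      have *: "est N X = rem N X + expectation f + psum lin N X / real N" by (simp add: rem_def)
      have "(1 / (real N)\<^sup>2) * (l * l) + (2 / real N) * (r * l) + r\<^sup>2 + (- 2 * \<rho>) * r + \<rho>\<^sup>2 + (- 2 * \<rho> / real N) * l
        = (x - (\<rho> + F))\<^sup>2" if "x = r + F + l / real N" for x r F l
        unfolding that using N by (simp add: power2_eq_square field_simps)
      from this[OF *] show ?thesis unfolding e .
    qed
    ultimately have "mm_var P f N = ?v"
      using has_bochner_integral_var_est[of N] by (simp add: has_bochner_integral_eq)
    then have "real N * mm_var P f N - expectation (\<lambda>x. (lin x)\<^sup>2) = 2 * R + real N * (Q - \<rho>\<^sup>2)"
      using N by (simp add: field_simps power2_eq_square)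
    \<comment> \<open>The difference is the variance of \<open>rem\<close>; so \<open>N\<close>
      times it lies between 0 and \<open>N * Q\<close>, which is small.\<close>
    moreover have "\<rho>\<^sup>2 \<le> Q"
    proof -
      have "has_bochner_integral (iid P N) (\<lambda>X. (rem N X)\<^sup>2 + (- 2 * \<rho>) * rem N X + \<rho>\<^sup>2) (Q + (- 2 * \<rho>) * \<rho> + \<rho>\<^sup>2)"
        by (rule add[OF add[OF h4 m[OF h5]] pr.has_bochner_integral_const_1])
      moreover have "(rem N X)\<^sup>2 + (- 2 * \<rho>) * rem N X + \<rho>\<^sup>2 = (rem N X - \<rho>)\<^sup>2" for X
        by (simp add: power2_diff)
      ultimately have "has_bochner_integral (iid P N) (\<lambda>X. (rem N X - \<rho>)\<^sup>2) (Q + (- 2 * \<rho>) * \<rho> + \<rho>\<^sup>2)"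
        by simp
      then have "0 \<le> Q + (- 2 * \<rho>) * \<rho> + \<rho>\<^sup>2"
        by (rule has_bochner_integral_nonneg) simp
      then show ?thesis by (simp add: power2_eq_square)
    qed
    moreover have "0 \<le> real N * (Q - \<rho>\<^sup>2)" "real N * (Q - \<rho>\<^sup>2) \<le> real N * Q"
      using \<open>\<rho>\<^sup>2 \<le> Q\<close> by (auto intro!: mult_left_mono)
    moreover have "(2 * C + C') / sqrt (real N) = 2 * (C / sqrt (real N)) + C' / sqrt (real N)"
      by (simp add: add_divide_distrib)
    ultimately show ?thesis
      using C(2)[OF N] C'(2)[OF N] unfolding R_def[symmetric] Q_def[symmetric] by linarith
  qed
  then show ?thesis by blast
qed

section \<open>Limit variance, and the mean gradient of functions uncorrelated with X\<close>

lemma integrable_f_dev: "integrable P (\<lambda>x. f x *\<^sub>R (x - \<mu>))"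
proof -
  obtain B where B: "\<And>x. \<bar>f x\<bar> \<le> B" using cc_smooth_bounded[OF cc_f] by blast
  show ?thesis
    by (rule integrable_dominated[of _ "\<lambda>x. B * norm (x - \<mu>)"])
      (use B integrable_norm[OF integrable_dev] in \<open>auto intro!: mult_right_mono\<close>)
qed

text \<open>This is the covariance vector of \<open>f\<close> with \<open>X\<close>, since the
  second factor is centred.\<close>

definition "cross_cov = (\<integral>x. f x *\<^sub>R (x - \<mu>) \<partial>P)"

lemma expectation_f_dev_inner: "expectation (\<lambda>x. f x * ((x - \<mu>) \<bullet> v)) = cross_cov \<bullet> v"
  unfolding cross_cov_def using integrable_f_dev by (subst integral_inner_left[symmetric]) auto

lemma has_bochner_integral_f_centred_sq:
  "has_bochner_integral P (\<lambda>x. (f x - expectation f)\<^sup>2) (varM P f)"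
proof -
  obtain B where B: "\<And>x. \<bar>f x\<bar> \<le> B" using cc_smooth_bounded[OF cc_f] by blast
  have "\<bar>f x - expectation f\<bar> \<le> \<bar>B + \<bar>expectation f\<bar>\<bar>" for x using B[of x] by linarith
  then have "integrable P (\<lambda>x. (f x - expectation f)\<^sup>2)"
    by (intro integrable_bounded_fn[of _ "(B + \<bar>expectation f\<bar>)\<^sup>2"]) (auto simp: abs_le_square_iff)
  then show ?thesis by (simp add: has_bochner_integral_iff varM_def)
qed

lemma has_bochner_integral_f_centred_dev:
  "has_bochner_integral P (\<lambda>x. (f x - expectation f) * ((x - \<mu>) \<bullet> v)) (cross_cov \<bullet> v)"
proof -
  have "has_bochner_integral P (\<lambda>x. f x * ((x - \<mu>) \<bullet> v)) (cross_cov \<bullet> v)"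
    using integrable_inner_left[OF integrable_f_dev, of v] expectation_f_dev_inner[of v]
    by (simp add: has_bochner_integral_iff)
  moreover have "has_bochner_integral P (\<lambda>x. (x - \<mu>) \<bullet> v) 0"
    using integrable_inner_left[OF integrable_dev, of v] expectation_dev[of v]
    by (simp add: has_bochner_integral_iff)
  ultimately have "has_bochner_integral P (\<lambda>x. f x * ((x - \<mu>) \<bullet> v) + (- expectation f) * ((x - \<mu>) \<bullet> v)) (cross_cov \<bullet> v + (- expectation f) * 0)"
    by (intro has_bochner_integral_add has_bochner_integral_scale)
  then show ?thesis by (simp add: algebra_simps)
qed

lemma expectation_lin_sq:
  "expectation (\<lambda>x. (lin x)\<^sup>2) = varM P f - 2 * (cross_cov \<bullet> mean_grad) + mean_grad \<bullet> (cov_mat P *v mean_grad)"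
proof -
  have "has_bochner_integral P (\<lambda>x. ((x - \<mu>) \<bullet> mean_grad) * ((x - \<mu>) \<bullet> mean_grad)) (mean_grad \<bullet> (cov_mat P *v mean_grad))"
    using integrable_dev_inner_mult inner_cov_mat by (simp add: has_bochner_integral_iff)
  note has_bochner_integral_add[OF has_bochner_integral_add[OF has_bochner_integral_f_centred_sq
        has_bochner_integral_scale[OF has_bochner_integral_f_centred_dev[of mean_grad], of "-2"]] this]
  moreover have "(f x - expectation f)\<^sup>2 + -2 * ((f x - expectation f) * ((x - \<mu>) \<bullet> mean_grad))
      + ((x - \<mu>) \<bullet> mean_grad) * ((x - \<mu>) \<bullet> mean_grad) = (lin x)\<^sup>2" for x
    by (simp add: lin_def power2_diff inner_commute[of mean_grad] power2_eq_square algebra_simps)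
  ultimately show ?thesis by (simp add: has_bochner_integral_iff)
qed

text \<open>The estimator is tested against sample sums of the bounded functions \<open>f - t k\<close>, where \<open>k\<close>
  truncates the linear correction term; a small \<open>t > 0\<close> gives the contradiction.\<close>

lemma mean_grad_eq_0:
  assumes A: "A \<longlonglongrightarrow> (1::real)" "\<And>N. N \<ge> 1 \<Longrightarrow> mm_var P f N \<le> A N / real N * varM P f"
    and zero: "cross_cov = 0" and det: "det (cov_mat P) \<noteq> 0"
  shows "mean_grad = 0"
proof -
  define y where "y x = (x - \<mu>) \<bullet> mean_grad" for x
  define cl where "cl r = max (-1) (min 1 r)" for r :: real
  define k where "k x = cl (y x) - expectation (\<lambda>x. cl (y x))" for x
  define F where "F x = f x - expectation f" for x
  have [measurable]: "y \<in> borel_measurable borel" "k \<in> borel_measurable borel" "cl \<in> borel_measurable borel"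
    "F \<in> borel_measurable borel"
    unfolding y_def[abs_def] k_def[abs_def] cl_def[abs_def] F_def[abs_def] by measurable
  have cl1: "\<bar>cl r\<bar> \<le> 1" for r by (auto simp: cl_def)
  have icl: "integrable P (\<lambda>x. cl (y x))" using cl1 by (intro integrable_bounded_fn[of _ 1]) auto
  have kb: "\<bar>k x\<bar> \<le> 1 + \<bar>expectation (\<lambda>x. cl (y x))\<bar>" for x
    using cl1[of "y x"] unfolding k_def by linarith
  obtain B where B: "\<And>x. \<bar>f x\<bar> \<le> B" using cc_smooth_bounded[OF cc_f] by blast
  have Fb: "\<bar>F x\<bar> \<le> B + \<bar>expectation f\<bar>" for x
    using B[of x] unfolding F_def by linarith
  have ik: "has_bochner_integral P k 0"
    using icl prob_space by (simp add: has_bochner_integral_iff k_def[abs_def])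
  have iF: "has_bochner_integral P F 0"
    using integrable_f prob_space by (simp add: has_bochner_integral_iff F_def[abs_def])
  have iy: "integrable P y"
    unfolding y_def[abs_def] by (rule integrable_inner_left[OF integrable_dev])
  define a b d where "a = expectation (\<lambda>x. y x * k x)" and "b = expectation (\<lambda>x. (k x)\<^sup>2)"
    and "d = expectation (\<lambda>x. F x * k x)"
  have k2: "integrable P (\<lambda>x. (k x)\<^sup>2)"
    using kb by (intro integrable_bounded_fn[of _ "(1 + \<bar>expectation (\<lambda>x. cl (y x))\<bar>)\<^sup>2"])
       (auto simp flip: abs_le_square_iff)
  have F2: "integrable P (\<lambda>x. (F x)\<^sup>2)"
    using has_bochner_integral_f_centred_sq by (auto simp: F_def has_bochner_integral_iff)
  have hb: "has_bochner_integral P (\<lambda>x. (k x)\<^sup>2) b" using k2 by (simp add: b_def has_bochner_integral_iff)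
  have hd: "has_bochner_integral P (\<lambda>x. F x * k x) d"
    using integrable_mult_of_squares[of F k] k2 F2 by (simp add: d_def has_bochner_integral_iff)
  have ha: "has_bochner_integral P (\<lambda>x. y x * k x) a"
    using integrable_mult_of_squares[of y k] k2 integrable_dev_inner_sq[of mean_grad]
    by (simp add: a_def has_bochner_integral_iff y_def)
  have hF: "has_bochner_integral P (\<lambda>x. (F x)\<^sup>2) (varM P f)"
    using has_bochner_integral_f_centred_sq by (simp add: F_def)
  \<comment> \<open>The place where the vanishing of \<open>cross_cov\<close> enters: otherwise a
    term linear in \<open>mean_grad\<close> would survive in the limit.\<close>
  have hFy: "has_bochner_integral P (\<lambda>x. F x * y x) 0"
    using has_bochner_integral_f_centred_dev[of mean_grad] zero by (simp add: F_def y_def)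
  note m = has_bochner_integral_scale and add = has_bochner_integral_add
  \<comment> \<open>In the limit the lower bound reads Var f + 2ta - t^2 b, and universality caps it
    by Var f; the terms in \<open>d\<close> cancel.\<close>
  have key: "2 * t * a \<le> t\<^sup>2 * b" for t
  proof -
    define \<phi> where "\<phi> x = F x + (- t) * k x" for x
    have [measurable]: "\<phi> \<in> borel_measurable borel" unfolding \<phi>_def[abs_def] by measurable
    have b1: "\<bar>\<phi> x\<bar> \<le> (B + \<bar>expectation f\<bar>) + \<bar>t\<bar> * (1 + \<bar>expectation (\<lambda>x. cl (y x))\<bar>)" for x
    proof -
      have "\<bar>\<phi> x\<bar> \<le> \<bar>F x\<bar> + \<bar>t\<bar> * \<bar>k x\<bar>"
        unfolding \<phi>_def by (rule order_trans[OF abs_triangle_ineq]) (simp add: abs_mult)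
      also have "\<dots> \<le> (B + \<bar>expectation f\<bar>) + \<bar>t\<bar> * (1 + \<bar>expectation (\<lambda>x. cl (y x))\<bar>)"
        by (intro add_mono mult_left_mono Fb kb) auto
      finally show ?thesis .
    qed
    have "has_bochner_integral P \<phi> (0 + (- t) * 0)"
      unfolding \<phi>_def[abs_def] by (rule add[OF iF m[OF ik]])
    then have z: "expectation \<phi> = 0" by (simp add: has_bochner_integral_iff)
    have "has_bochner_integral P (\<lambda>x. (F x)\<^sup>2 + (- 2 * t) * (F x * k x) + t\<^sup>2 * (k x)\<^sup>2) (varM P f + (- 2 * t) * d + t\<^sup>2 * b)"
      by (rule add[OF add[OF hF m[OF hd]] m[OF hb]])
    moreover have "(F x)\<^sup>2 + (- 2 * t) * (F x * k x) + t\<^sup>2 * (k x)\<^sup>2 = (\<phi> x)\<^sup>2" for x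
      by (simp add: \<phi>_def power2_eq_square algebra_simps)
    ultimately have e1: "expectation (\<lambda>x. (\<phi> x)\<^sup>2) = varM P f + (- 2 * t) * d + t\<^sup>2 * b"
      by (simp add: has_bochner_integral_iff)
    have "has_bochner_integral P (\<lambda>x. (F x)\<^sup>2 + (- t) * (F x * k x) + (- 1) * (F x * y x) + t * (y x * k x))
        (varM P f + (- t) * d + (- 1) * 0 + t * a)"
      by (rule add[OF add[OF add[OF hF m[OF hd]] m[OF hFy]] m[OF ha]])
    moreover have "(F x)\<^sup>2 + (- t) * (F x * k x) + (- 1) * (F x * y x) + t * (y x * k x) = lin x * \<phi> x" for x
      by (simp add: \<phi>_def lin_def F_def y_def power2_eq_square algebra_simps inner_commute[of mean_grad])
    ultimately have e2: "expectation (\<lambda>x. lin x * \<phi> x) = varM P f + (- t) * d + (- 1) * 0 + t * a"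
      by (simp add: has_bochner_integral_iff)
    obtain C where C: "\<And>N. N \<ge> 1 \<Longrightarrow> real N * mm_var P f N \<ge>
      2 * expectation (\<lambda>x. lin x * \<phi> x) - expectation (\<lambda>x. (\<phi> x)\<^sup>2) - C / sqrt (real N)"
      using mm_var_lower_bound[OF _ b1 z] by auto
    have "varM P f + 2 * t * a - t\<^sup>2 * b - C / sqrt (real N) \<le> A N * varM P f" if N: "N \<ge> 1" for N
      using C[OF N] mult_left_mono[OF A(2)[OF N], of "real N"] N unfolding e1 e2 by simp
    then have ev: "\<forall>\<^sub>F N in sequentially. varM P f + 2 * t * a - t\<^sup>2 * b - C / sqrt (real N) \<le> A N * varM P f"
      unfolding eventually_sequentially by blast
    have "(\<lambda>N. C / sqrt (real N)) \<longlonglongrightarrow> 0"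
      by (intro tendsto_divide_0[OF tendsto_const] filterlim_at_top_imp_at_infinity
          filterlim_compose[OF sqrt_at_top] filterlim_real_sequentially)
    then have l1: "(\<lambda>N. varM P f + 2 * t * a - t\<^sup>2 * b - C / sqrt (real N)) \<longlonglongrightarrow> varM P f + 2 * t * a - t\<^sup>2 * b - 0"
      by (intro tendsto_diff tendsto_const)
    have "(\<lambda>N. A N * varM P f) \<longlonglongrightarrow> 1 * varM P f"
      by (intro tendsto_mult A tendsto_const)
    from tendsto_le[OF _ this l1 ev] show ?thesis by simp
  qed
  have iycl: "integrable P (\<lambda>x. y x * cl (y x))"
    by (rule integrable_dominated[OF integrable_abs[OF iy]]) (use cl1 in \<open>auto simp: abs_mult mult_left_le\<close>)
  have "a = expectation (\<lambda>x. y x * cl (y x))"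
  proof -
    have "expectation y = 0" unfolding y_def[abs_def] by (rule expectation_dev)
    then show ?thesis using iy iycl by (simp add: a_def k_def right_diff_distrib)
  qed
  moreover have ycl: "y x * cl (y x) \<ge> 0" for x
    by (auto simp: cl_def max_def min_def zero_le_mult_iff)
  moreover have "\<not> a > 0"
  proof
    assume "a > 0"
    have "b \<ge> 0" by (simp add: b_def)
    \<comment> \<open>The choice \<open>t = a / (b + 1)\<close> makes the linear term win; adding 1
      keeps the denominator positive when \<open>b = 0\<close>.\<close>
    have "2 * (a / (b + 1)) * a \<le> (a / (b + 1))\<^sup>2 * b" by (rule key)
    also have "\<dots> = (a / (b + 1)) * a * (b / (b + 1))" by (simp add: power2_eq_square)
    also have "\<dots> \<le> (a / (b + 1)) * a * 1"
      using \<open>a > 0\<close> \<open>b \<ge> 0\<close> by (intro mult_left_mono) auto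
    finally have "(a / (b + 1)) * a \<le> 0" by simp
    moreover have "(a / (b + 1)) * a > 0" using \<open>a > 0\<close> \<open>b \<ge> 0\<close> by simp
    ultimately show False by linarith
  qed
  moreover have "0 \<le> expectation (\<lambda>x. y x * cl (y x))"
    using ycl by (intro Bochner_Integration.integral_nonneg)
  ultimately have a0: "expectation (\<lambda>x. y x * cl (y x)) = 0"
    by linarith
  from iycl a0 have "AE x in P. y x * cl (y x) = 0"
    using ycl by (subst (asm) integral_nonneg_eq_0_iff_AE) auto
  then have ae: "AE x in P. (y x)\<^sup>2 = 0"
    by eventually_elim (auto simp: cl_def max_def min_def split: if_splits)
  have "expectation (\<lambda>x. (y x)\<^sup>2) = 0"
    by (rule integral_eq_zero_AE[OF ae])
  then have "cov_mat P *v mean_grad = 0" unfolding y_def by (rule cov_mat_null)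
  then show ?thesis
    using det by (metis invertible_det_nz matrix_left_invertible_ker invertible_left_inverse)
qed

end

subsection \<open>Linear change of variables for Lebesgue measure\<close>

text \<open>The library's change of variables formula requires a well-ordered index type.\<close>

lemma nn_integral_lborel_shear:
  fixes i j :: "'a::euclidean_space"
  assumes ij: "i \<in> Basis" "j \<in> Basis" "i \<noteq> j" and [measurable]: "F \<in> borel_measurable borel"
  shows "(\<integral>\<^sup>+x. F (x + (x \<bullet> j) *\<^sub>R i) \<partial>lborel) = (\<integral>\<^sup>+x. F x \<partial>lborel)"
proof -
  interpret product_sigma_finite "\<lambda>_::'a. lborel :: real measure" ..
  define B where "B = (Basis :: 'a set) - {i}"
  define \<Phi> where "\<Phi> f = (\<Sum>b\<in>Basis. f b *\<^sub>R b)" for f :: "'a \<Rightarrow> real"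
  have Bas: "Basis = insert i B" "finite B" "i \<notin> B" "j \<in> B" using ij by (auto simp: B_def)
  have [measurable]: "\<Phi> \<in> borel_measurable (PiM Basis (\<lambda>_. lborel))"
    unfolding \<Phi>_def[abs_def] by (intro borel_measurable_sum) measurable
  \<comment> \<open>Fubini with coordinate \<open>i\<close> integrated innermost, the one changed by
    the shear.\<close>
  have int: "(\<integral>\<^sup>+x. G x \<partial>lborel) = (\<integral>\<^sup>+x. (\<integral>\<^sup>+y. G (\<Phi> (x(i := y))) \<partial>lborel) \<partial>PiM B (\<lambda>_. lborel))"
    if [measurable]: "G \<in> borel_measurable borel" for G :: "'a \<Rightarrow> ennreal"
  proof -
    have "(\<integral>\<^sup>+x. G x \<partial>lborel) = (\<integral>\<^sup>+x. G (\<Phi> x) \<partial>PiM Basis (\<lambda>_. lborel))"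
      by (subst lborel_eq) (simp add: nn_integral_distr \<Phi>_def)
    also have "\<dots> = (\<integral>\<^sup>+x. G (\<Phi> x) \<partial>PiM (insert i B) (\<lambda>_. lborel))"
      using Bas(1) by simp
    also have "\<dots> = (\<integral>\<^sup>+x. (\<integral>\<^sup>+y. G (\<Phi> (x(i := y))) \<partial>lborel) \<partial>PiM B (\<lambda>_. lborel))"
      by (rule product_nn_integral_insert) (use Bas in \<open>auto simp flip: Bas(1)\<close>)
    finally show ?thesis .
  qed
  have \<Phi>: "\<Phi> (x(i := y)) = y *\<^sub>R i + (\<Sum>b\<in>B. x b *\<^sub>R b)" for x y
    unfolding \<Phi>_def Bas(1) using Bas(2,3) by (auto intro!: sum.cong)
  \<comment> \<open>As \<open>i \<noteq> j\<close>, the amount of the shear is constant in the inner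
    variable, so the inner integral is merely translated.\<close>
  have inner: "\<Phi> (x(i := y)) \<bullet> j = x j" for x y
    unfolding \<Phi>_def using ij by (subst inner_sum_left_Basis) (auto simp: inner_sum_left_Basis)
  have "(\<integral>\<^sup>+x. F (x + (x \<bullet> j) *\<^sub>R i) \<partial>lborel)
    = (\<integral>\<^sup>+x. (\<integral>\<^sup>+y. F (\<Phi> (x(i := y)) + x j *\<^sub>R i) \<partial>lborel) \<partial>PiM B (\<lambda>_. lborel))"
    by (subst int) (simp_all only: inner, measurable)
  also have "\<dots> = (\<integral>\<^sup>+x. (\<integral>\<^sup>+y. F (\<Phi> (x(i := y))) \<partial>lborel) \<partial>PiM B (\<lambda>_. lborel))"
  proof (rule nn_integral_cong)
    fix x :: "'a \<Rightarrow> real"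
    have "(\<integral>\<^sup>+y. F (\<Phi> (x(i := y))) \<partial>lborel) = (\<integral>\<^sup>+y. F (\<Phi> (x(i := x j + 1 * y))) \<partial>lborel)"
      unfolding \<Phi> by (subst nn_integral_real_affine[where c=1 and t="x j"]) auto
    also have "\<dots> = (\<integral>\<^sup>+y. F (\<Phi> (x(i := y)) + x j *\<^sub>R i) \<partial>lborel)"
      unfolding \<Phi> by (simp add: algebra_simps)
    finally show "(\<integral>\<^sup>+y. F (\<Phi> (x(i := y)) + x j *\<^sub>R i) \<partial>lborel) = (\<integral>\<^sup>+y. F (\<Phi> (x(i := y))) \<partial>lborel)" ..
  qed
  also have "\<dots> = (\<integral>\<^sup>+x. F x \<partial>lborel)" by (subst int) auto
  finally show ?thesis .
qed

lemma prod_Basis_vec: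
  fixes h :: "real^'n \<Rightarrow> 'c::comm_monoid_mult"
  shows "(\<Prod>b\<in>Basis. h b) = (\<Prod>i\<in>UNIV. h (axis i 1))"
proof -
  have "(Basis :: (real^'n) set) = range (\<lambda>i. axis i 1)" by (auto simp: Basis_vec_def)
  moreover have "inj (\<lambda>i::'n. axis i (1::real))" by (auto simp: inj_on_def axis_eq_axis)
  ultimately show ?thesis using prod.reindex[of "\<lambda>i::'n. axis i (1::real)" UNIV h] by simp
qed

text \<open>Induction over elementary linear maps: compositions, maps with a zero row, diagonal
  scalings, swaps and shears. Non-singularity is part of the induction predicate, so the singular
  generators hold vacuously and a regular composition has regular factors.\<close>

lemma nn_integral_lborel_linear:
  fixes f :: "real^'n \<Rightarrow> real^'n"
  assumes "linear f" "det (matrix f) \<noteq> 0" "F \<in> borel_measurable borel"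
  shows "(\<integral>\<^sup>+x. F x \<partial>lborel) = ennreal \<bar>det (matrix f)\<bar> * (\<integral>\<^sup>+x. F (f x) \<partial>lborel)"
proof -
  have "det (matrix f) \<noteq> 0 \<longrightarrow> (\<forall>F\<in>borel_measurable borel.
     (\<integral>\<^sup>+x. F x \<partial>lborel) = ennreal \<bar>det (matrix f)\<bar> * (\<integral>\<^sup>+x. F (f x) \<partial>lborel))" (is "?P f")
    using assms(1)
  proof (rule induct_linear_elementary[where P = ?P])
    fix f g :: "real^'n \<Rightarrow> real^'n"
    assume lin: "linear f" "linear g" and P: "?P f" "?P g"
    have [measurable]: "f \<in> borel_measurable borel" "g \<in> borel_measurable borel"
      using lin by (auto intro!: borel_measurable_continuous_onI linear_continuous_on simp: linear_linear)
    have d: "det (matrix (f \<circ> g)) = det (matrix f) * det (matrix g)"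
      using lin by (simp add: matrix_compose det_mul)
    show "?P (f \<circ> g)"
    proof (intro impI ballI)
      fix F :: "real^'n \<Rightarrow> ennreal" assume [measurable]: "F \<in> borel_measurable borel" and "det (matrix (f \<circ> g)) \<noteq> 0"
      then have nz: "det (matrix f) \<noteq> 0" "det (matrix g) \<noteq> 0" using d by auto
      have "(\<integral>\<^sup>+x. F x \<partial>lborel) = ennreal \<bar>det (matrix f)\<bar> * (\<integral>\<^sup>+x. F (f x) \<partial>lborel)"
        by (rule P(1)[rule_format, OF nz(1)]) measurable
      also have "(\<integral>\<^sup>+x. F (f x) \<partial>lborel) = ennreal \<bar>det (matrix g)\<bar> * (\<integral>\<^sup>+x. F (f (g x)) \<partial>lborel)"
        by (rule P(2)[rule_format, OF nz(2)]) measurable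
      finally show "(\<integral>\<^sup>+x. F x \<partial>lborel) = ennreal \<bar>det (matrix (f \<circ> g))\<bar> * (\<integral>\<^sup>+x. F ((f \<circ> g) x) \<partial>lborel)"
        by (simp add: d abs_mult ennreal_mult mult.assoc)
    qed
  next
    fix f :: "real^'n \<Rightarrow> real^'n" and i
    assume "linear f" "\<And>x. f x $ i = 0"
    then have "row i (matrix f) = 0" by (simp add: row_def matrix_def vec_eq_iff)
    then show "?P f" by (simp add: det_zero_row)
  next
    fix c :: "'n \<Rightarrow> real"
    let ?f = "\<lambda>x::real^'n. \<chi> i. c i * x $ i"
    have det: "det (matrix ?f) = (\<Prod>i\<in>UNIV. c i)"
      by (subst det_diagonal) (auto simp: matrix_def axis_def)
    show "?P ?f"
    proof (intro impI ballI)
      fix F :: "real^'n \<Rightarrow> ennreal" assume [measurable]: "F \<in> borel_measurable borel" and "det (matrix ?f) \<noteq> 0"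
      then have c: "c i \<noteq> 0" for i unfolding det by simp
      \<comment> \<open>The same diagonal scaling, written in the form for which
        \<open>lborel_affine_euclidean\<close> supplies the Jacobian.\<close>
      define T where "T x = 0 + (\<Sum>j\<in>Basis. ((x \<bullet> j) * (?f j \<bullet> j)) *\<^sub>R j)" for x :: "real^'n"
      have c': "(\<chi> i. c i * b $ i) \<bullet> b \<noteq> 0" if "b \<in> Basis" for b :: "real^'n"
        using that c by (auto simp: Basis_vec_def inner_axis)
      have T: "T x = ?f x" for x
      proof (rule euclidean_eqI)
        fix b :: "real^'n" assume b: "b \<in> Basis"
        then obtain i where i: "b = axis i 1" by (auto simp: Basis_vec_def)
        have "T x \<bullet> b = (x \<bullet> b) * (?f b \<bullet> b)" unfolding T_def using b by (simp add: inner_sum_left_Basis)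
        then show "T x \<bullet> b = ?f x \<bullet> b" by (simp add: i inner_axis)
      qed
      have [measurable]: "T \<in> borel_measurable borel" unfolding T_def[abs_def] by measurable
      have "lborel = density (distr lborel borel T) (\<lambda>_. \<Prod>j\<in>Basis. \<bar>?f j \<bullet> j\<bar>)"
        unfolding T_def using lborel_affine_euclidean[of "\<lambda>j. ?f j \<bullet> j" 0] c' by (simp add: mult.commute)
      then have "(\<integral>\<^sup>+x. F x \<partial>lborel) = (\<integral>\<^sup>+x. F x \<partial>density (distr lborel borel T) (\<lambda>_. \<Prod>j\<in>Basis. \<bar>?f j \<bullet> j\<bar>))"
        by simp
      also have "\<dots> = (\<integral>\<^sup>+x. ennreal (\<Prod>j\<in>Basis. \<bar>?f j \<bullet> j\<bar>) * F (T x) \<partial>lborel)"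
        by (subst nn_integral_density) (auto simp: nn_integral_distr)
      also have "(\<Prod>j\<in>Basis. \<bar>?f j \<bullet> j\<bar>) = \<bar>det (matrix ?f)\<bar>"
        unfolding det prod_Basis_vec by (simp add: inner_axis abs_prod)
      finally show "(\<integral>\<^sup>+x. F x \<partial>lborel) = ennreal \<bar>det (matrix ?f)\<bar> * (\<integral>\<^sup>+x. F (?f x) \<partial>lborel)"
        by (simp add: T nn_integral_cmult flip: T)
    qed
  next
    fix m n :: 'n assume "m \<noteq> n"
    let ?\<pi> = "Transposition.transpose m n"
    let ?f = "\<lambda>x::real^'n. \<chi> i. x $ ?\<pi> i"
    have lin: "linear ?f" by (rule linearI) (auto simp: vec_eq_iff)
    have ff: "?f \<circ> ?f = id" by (auto simp: fun_eq_iff vec_eq_iff)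
    \<comment> \<open>A swap is its own inverse, so its determinant is 1 or -1.\<close>
    have "det (matrix ?f) * det (matrix ?f) = 1"
      using lin by (metis det_I det_mul ff matrix_compose matrix_id_mat_1)
    then have det: "\<bar>det (matrix ?f)\<bar> = 1"
      by (simp only: power2_eq_square[symmetric] abs_square_eq_1)
    have [measurable]: "?f \<in> borel_measurable borel"
      using lin by (auto intro!: borel_measurable_continuous_onI linear_continuous_on simp: linear_linear)
    \<comment> \<open>Permuting coordinates sends boxes to boxes with the same side lengths, and
      boxes determine Lebesgue measure.\<close>
    have eq: "lborel = distr lborel borel ?f"
    proof (rule lborel_eqI)
      fix l u :: "real^'n" assume le: "\<And>b. b \<in> Basis \<Longrightarrow> l \<bullet> b \<le> u \<bullet> b"
      have le': "l $ i \<le> u $ i" for i using le[of "axis i 1"] by (simp add: inner_axis axis_in_Basis_iff)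
      have "?f x \<in> box l u \<longleftrightarrow> x \<in> box (?f l) (?f u)" for x
        unfolding mem_box_cart by (metis (no_types, lifting) Transposition.transpose_involutory vec_lambda_beta)
      then have "?f -` box l u = box (?f l) (?f u)" by auto
      then have "emeasure (distr lborel borel ?f) (box l u) = emeasure lborel (box (?f l) (?f u))"
        by (simp add: emeasure_distr)
      also have "\<dots> = (\<Prod>b\<in>Basis. (?f u - ?f l) \<bullet> b)"
        using le' by (subst emeasure_lborel_box) (auto simp: Basis_vec_def inner_axis)
      also have "(\<Prod>b\<in>Basis. (?f u - ?f l) \<bullet> b) = (\<Prod>i\<in>UNIV. (u - l) $ ?\<pi> i)"
        unfolding prod_Basis_vec by (simp add: inner_axis)
      also have "\<dots> = (\<Prod>i\<in>UNIV. (u - l) $ i)"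
        by (rule prod.reindex_bij_betw[of ?\<pi> UNIV UNIV "\<lambda>i. (u - l) $ i"]) simp
      also have "\<dots> = (\<Prod>b\<in>Basis. (u - l) \<bullet> b)"
        unfolding prod_Basis_vec by (simp add: inner_axis)
      finally show "emeasure (distr lborel borel ?f) (box l u) = (\<Prod>b\<in>Basis. (u - l) \<bullet> b)" .
    qed simp
    have "(\<integral>\<^sup>+x. F x \<partial>lborel) = (\<integral>\<^sup>+x. F (?f x) \<partial>lborel)" if "F \<in> borel_measurable borel" for F :: "real^'n \<Rightarrow> ennreal"
    proof -
      have "(\<integral>\<^sup>+x. F x \<partial>lborel) = (\<integral>\<^sup>+x. F x \<partial>distr lborel borel ?f)"
        by (rule arg_cong[OF eq])
      also have "\<dots> = (\<integral>\<^sup>+x. F (?f x) \<partial>lborel)"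
        by (rule nn_integral_distr) (use that in auto)
      finally show ?thesis .
    qed
    note inv = this
    show "?P ?f"
      by (intro impI ballI) (unfold det ennreal_1 mult_1, erule inv)
  next
    fix m n :: 'n assume "m \<noteq> n"
    let ?f = "\<lambda>x::real^'n. \<chi> i. if i = m then x$m + x$n else x$i"
    have f: "?f x = x + (x \<bullet> axis n 1) *\<^sub>R axis m 1" for x
      by (simp add: vec_eq_iff inner_axis) (simp add: axis_def)
    have "matrix ?f = (\<chi> k. if k = m then row m (mat 1) + 1 *s row n (mat 1) else row k (mat 1))"
      by (auto simp: vec_eq_iff matrix_def row_def mat_def axis_def)
    then have det: "det (matrix ?f) = 1"
      using det_row_operation[OF \<open>m \<noteq> n\<close>, of "mat 1" 1] by simp
    have inv: "(\<integral>\<^sup>+x. F x \<partial>lborel) = (\<integral>\<^sup>+x. F (?f x) \<partial>lborel)" if "F \<in> borel_measurable borel" for F :: "real^'n \<Rightarrow> ennreal"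
      unfolding f by (rule nn_integral_lborel_shear[symmetric])
        (use \<open>m \<noteq> n\<close> that in \<open>auto simp: Basis_vec_def axis_eq_axis\<close>)
    show "?P ?f"
      by (intro impI ballI) (unfold det abs_1 ennreal_1 mult_1, erule inv)
  qed
  with assms show ?thesis by blast
qed

lemma integral_lborel_affine:
  fixes F :: "'a::euclidean_space \<Rightarrow> real"
  assumes "c \<noteq> 0" and [measurable]: "F \<in> borel_measurable borel"
  shows "(\<integral>x. F x \<partial>lborel) = \<bar>c\<bar> ^ DIM('a) * (\<integral>x. F (t + c *\<^sub>R x) \<partial>lborel)"
proof -
  have "(\<integral>x. F x \<partial>lborel) = (\<integral>x. F x \<partial>density (distr lborel borel (\<lambda>x. t + c *\<^sub>R x)) (\<lambda>_. ennreal (\<bar>c\<bar> ^ DIM('a))))"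
    using lborel_affine[OF assms(1), of t] by simp
  also have "\<dots> = (\<integral>x. \<bar>c\<bar> ^ DIM('a) * F (t + c *\<^sub>R x) \<partial>lborel)"
    by (subst integral_density) (auto simp: integral_distr)
  finally show ?thesis by simp
qed

text \<open>Difference quotients of an integrable function integrate to 0 by translation invariance,
  and they converge to the directional derivative under a common bound. This is the form of
  integration by parts used throughout.\<close>

lemma integral_directional_derivative_eq_0:
  fixes F :: "'a::euclidean_space \<Rightarrow> real"
  assumes d: "\<And>x. (F has_derivative F' x) (at x)" and cont: "continuous_on UNIV (\<lambda>x. F' x v)"
    and S: "bounded S" "\<And>x. x \<notin> S \<Longrightarrow> F x = 0"
  shows "(\<integral>x. F' x v \<partial>lborel) = 0"
proof -
  obtain R where R: "S \<subseteq> cball 0 R"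
    using bounded_subset_ballD[OF S(1), of 0] ball_subset_cball by blast
  have F0: "F x = 0" if "x \<notin> cball 0 R" for x using S(2) R that by blast
  have F'0: "F' x v = 0" if "x \<notin> cball 0 R" for x
  proof -
    have "open (- cball (0::'a) R)" by auto
    then have "(F has_derivative (\<lambda>v. 0)) (at x)"
      by (rule has_derivative_transform_within_open[OF has_derivative_const[of 0]])
        (use that F0 in auto)
    then show ?thesis using has_derivative_unique[OF d] by metis
  qed
  have "bounded ((\<lambda>x. F' x v) ` cball 0 R)"
    by (intro compact_imp_bounded compact_continuous_image continuous_on_subset[OF cont]) auto
  then obtain C where C: "C > 0" "\<And>x. x \<in> cball 0 R \<Longrightarrow> \<bar>F' x v\<bar> \<le> C" by (auto simp: bounded_pos)
  have C': "\<bar>F' x v\<bar> \<le> C" for x using C F'0[of x] by (cases "x \<in> cball 0 R") auto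
  have contF: "continuous_on UNIV F"
    using d by (meson continuous_at_imp_continuous_on has_derivative_continuous)
  then have [measurable]: "F \<in> borel_measurable borel" by (rule borel_measurable_continuous_onI)
  have [measurable]: "(\<lambda>x. F' x v) \<in> borel_measurable borel" using cont by (rule borel_measurable_continuous_onI)
  define G where "G n x = (F (x + (1 / real (Suc n)) *\<^sub>R v) - F x) / (1 / real (Suc n))" for n x
  have [measurable]: "G n \<in> borel_measurable borel" for n unfolding G_def[abs_def] by measurable
  have line: "((\<lambda>s. F (x + s *\<^sub>R v)) has_derivative (\<lambda>h. F' (x + s *\<^sub>R v) (h *\<^sub>R v))) (at s)" for x s
  proof -
    have "((\<lambda>s. x + s *\<^sub>R v) has_derivative (\<lambda>h. h *\<^sub>R v)) (at s)" by (auto intro!: derivative_eq_intros)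
    from has_derivative_compose[OF this d] show ?thesis .
  qed
  have lin: "linear (F' x)" for x using d has_derivative_linear by blast
  have lineD: "((\<lambda>s. F (x + s *\<^sub>R v)) has_real_derivative F' (x + s *\<^sub>R v) v) (at s)" for x s
  proof -
    have "(\<lambda>h. F' (x + s *\<^sub>R v) (h *\<^sub>R v)) = (*) (F' (x + s *\<^sub>R v) v)"
      by (auto simp: fun_eq_iff linear_scale[OF lin])
    then show ?thesis using line[of x s] by (simp add: has_field_derivative_def)
  qed
  have intF: "integrable lborel F"
  proof -
    have "(\<lambda>x. indicator (cball 0 R) x *\<^sub>R F x) = F" using F0 by (auto simp: indicator_def fun_eq_iff)
    moreover have "integrable lborel (\<lambda>x. indicator (cball 0 R) x *\<^sub>R F x)"
      using continuous_on_subset[OF contF] by (intro borel_integrable_compact) auto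
    ultimately show ?thesis by simp
  qed
  have lim: "(\<lambda>n. \<integral>x. G n x \<partial>lborel) \<longlonglongrightarrow> (\<integral>x. F' x v \<partial>lborel)"
  proof (rule tendsto_integral_dominated[where w="\<lambda>x. C * indicator (cball 0 (R + norm v)) x"])
    show "integrable lborel (\<lambda>x. C * indicator (cball (0::'a) (R + norm v)) x)"
      by (intro integrable_mult_right integrable_real_indicator) (use emeasure_lborel_cball_finite[of "0::'a" "R + norm v"] in \<open>auto simp: infinity_ennreal_def\<close>)
    show "(\<lambda>n. G n x) \<longlonglongrightarrow> F' x v" for x
    proof -
      have "((\<lambda>h. (F (x + h *\<^sub>R v) - F x) / h) \<longlongrightarrow> F' x v) (at 0)"
        using lineD[of x 0] by (simp add: has_field_derivative_iff)
      moreover have "filterlim (\<lambda>n. 1 / real (Suc n)) (at 0) sequentially"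
        using LIMSEQ_inverse_real_of_nat by (auto simp: filterlim_at inverse_eq_divide)
      ultimately show ?thesis
        unfolding G_def by (rule filterlim_compose)
    qed
    \<comment> \<open>The ball is enlarged by \<open>norm v\<close> because the increments are at
      most \<open>v\<close>: outside it both points of the quotient miss the support. Inside, the
      mean value theorem bounds the quotient by \<open>C\<close>.\<close>
    show "norm (G n x) \<le> C * indicator (cball 0 (R + norm v)) x" for n x
    proof -
      define t where "t = 1 / real (Suc n)"
      have t: "0 < t" "t \<le> 1" by (auto simp: t_def)
      have Gt: "G n x = (F (x + t *\<^sub>R v) - F x) / t" by (simp only: G_def t_def)
      show ?thesis
      proof (cases "x \<in> cball 0 (R + norm v)")
        case True
        obtain \<xi> where "F (x + t *\<^sub>R v) - F (x + 0 *\<^sub>R v) = (t - 0) * F' (x + \<xi> *\<^sub>R v) v"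
          using MVT2[OF t(1), of "\<lambda>s. F (x + s *\<^sub>R v)" "\<lambda>s. F' (x + s *\<^sub>R v) v"] lineD by blast
        then have "G n x = F' (x + \<xi> *\<^sub>R v) v" using t by (simp add: Gt)
        then show ?thesis using C' True by simp
      next
        case False
        then have "norm x > R + norm v" by simp
        moreover have "norm (t *\<^sub>R v) \<le> norm v" using t by (simp add: mult_left_le_one_le)
        ultimately have "norm (x + t *\<^sub>R v) > R" "norm x > R"
          using norm_triangle_ineq2[of x "- (t *\<^sub>R v)"] norm_ge_zero[of v]
          unfolding norm_minus_cancel diff_minus_eq_add by linarith+
        then show ?thesis using F0 False by (simp add: Gt)
      qed
    qed
  qed measurable
  have "(\<integral>x. G n x \<partial>lborel) = 0" for n
  proof -
    have "(\<integral>x. F x \<partial>lborel) = (\<integral>x. F ((1 / real (Suc n)) *\<^sub>R v + 1 *\<^sub>R x) \<partial>lborel)"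
      by (subst integral_lborel_affine[of 1 F "(1 / real (Suc n)) *\<^sub>R v"]) auto
    moreover have "integrable lborel (\<lambda>x. F (x + (1 / real (Suc n)) *\<^sub>R v))"
    proof -
      have "integrable (distr lborel borel ((+) ((1 / real (Suc n)) *\<^sub>R v))) F" using intF by (simp add: lborel_distr_plus)
      then show ?thesis by (subst (asm) integrable_distr_eq) (auto simp: add.commute)
    qed
    ultimately show ?thesis using intF unfolding G_def by (simp add: add.commute)
  qed
  with lim show ?thesis by (simp add: LIMSEQ_const_iff)
qed

subsection \<open>Gaussian integrals\<close>

lemma nn_integral_gauss_real:
  assumes "c > 0"
  shows "(\<integral>\<^sup>+t. ennreal (exp (- c * t\<^sup>2)) \<partial>lborel) = ennreal (sqrt (pi / c))"
proof -
  \<comment> \<open>The standard deviation for which the exponent of the one-dimensional normal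
    density is \<open>- c * t^2\<close>.\<close>
  define \<sigma> where "\<sigma> = sqrt (1 / (2 * c))"
  have s: "\<sigma> > 0" "\<sigma>\<^sup>2 = 1 / (2 * c)" using assms by (auto simp: \<sigma>_def)
  have eq: "exp (- c * t\<^sup>2) = sqrt (pi / c) * Distributions.normal_density 0 \<sigma> t" for t
    using assms by (simp add: Distributions.normal_density_def s(2) real_sqrt_divide field_simps)
  have "(\<integral>\<^sup>+t. ennreal (Distributions.normal_density 0 \<sigma> t) \<partial>lborel) = 1"
    using s(1) by (subst nn_integral_eq_integral) auto
  then show ?thesis
    unfolding eq using assms by (simp add: ennreal_mult' nn_integral_cmult)
qed

lemma nn_integral_gauss:
  assumes "c > 0"
  shows "(\<integral>\<^sup>+x. ennreal (exp (- c * (norm x)\<^sup>2)) \<partial>(lborel :: 'a::euclidean_space measure)) = ennreal (sqrt (pi / c) ^ DIM('a))"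
proof -
  have "exp (- c * (norm x)\<^sup>2) = (\<Prod>b\<in>Basis. exp (- c * (x \<bullet> b)\<^sup>2))" for x :: 'a
    unfolding power2_norm_eq_inner by (subst euclidean_inner) (simp add: exp_sum sum_distrib_left power2_eq_square flip: sum_negf)
  then have "(\<integral>\<^sup>+x. ennreal (exp (- c * (norm x)\<^sup>2)) \<partial>(lborel :: 'a measure)) = (\<integral>\<^sup>+x. (\<Prod>b\<in>Basis. ennreal (exp (- c * (x \<bullet> b)\<^sup>2))) \<partial>(lborel :: 'a measure))"
    by (simp add: prod_ennreal)
  also have "\<dots> = (\<Prod>b\<in>(Basis::'a set). \<integral>\<^sup>+t. ennreal (exp (- c * t\<^sup>2)) \<partial>lborel)"
    by (rule nn_integral_lborel_prod) auto
  finally show ?thesis using assms by (simp only: nn_integral_gauss_real prod_constant ennreal_power real_sqrt_ge_zero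
        divide_nonneg_pos pi_ge_zero)
qed

text \<open>Gram-Schmidt for the inner product given by \<open>M\<close>, by induction on the set of
  indices already treated. While an index is left, fewer than \<open>n\<close> vectors
  \<open>M *v b j\<close> span a proper subspace, and any nonzero vector orthogonal to it can be
  normalised and added.\<close>

lemma pos_def_orthonormal_matrix:
  fixes M :: "real^'n^'n"
  assumes M: "pos_def M"
  obtains A :: "real^'n^'n" where "transpose A ** M ** A = mat 1"
proof -
  have sym: "v \<bullet> (M *v w) = w \<bullet> (M *v v)" for v w
    using M by (metis dot_lmul_matrix inner_commute pos_def_def transpose_matrix_vector)
  have "\<exists>b :: 'n \<Rightarrow> real^'n. \<forall>i\<in>J. \<forall>j\<in>J. b i \<bullet> (M *v b j) = of_bool (i = j)" for J :: "'n set"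
    using finite[of J]
  proof (induction J)
    case empty
    then show ?case by simp
  next
    case (insert k J)
    then obtain b where b: "\<And>i j. i \<in> J \<Longrightarrow> j \<in> J \<Longrightarrow> b i \<bullet> (M *v b j) = of_bool (i = j)" by blast
    have "dim ((\<lambda>j. M *v b j) ` J) \<le> card ((\<lambda>j. M *v b j) ` J)" using insert.hyps by (intro dim_le_card) (auto intro: span_base)
    also have "\<dots> \<le> card J" using insert.hyps by (intro card_image_le)
    also have "\<dots> < CARD('n)" using insert.hyps by (intro psubset_card_mono) auto
    finally have "dim ((\<lambda>j. M *v b j) ` J) < DIM(real^'n)" by simp
    then obtain x where x: "x \<noteq> 0" "\<And>y. y \<in> span ((\<lambda>j. M *v b j) ` J) \<Longrightarrow> orthogonal x y"
      using orthogonal_to_subspace_exists by blast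
    have x0: "x \<bullet> (M *v b j) = 0" if "j \<in> J" for j
      using x(2)[OF span_base, of "M *v b j"] that by (simp add: orthogonal_def)
    define s where "s = x \<bullet> (M *v x)"
    have s: "s > 0" using M x(1) by (simp add: s_def pos_def_def)
    define b' where "b' = b(k := (1 / sqrt s) *\<^sub>R x)"
    have "b' i \<bullet> (M *v b' j) = of_bool (i = j)" if "i \<in> insert k J" "j \<in> insert k J" for i j
    proof -
      have "((1 / sqrt s) *\<^sub>R x) \<bullet> (M *v ((1 / sqrt s) *\<^sub>R x)) = 1"
        using s by (simp add: matrix_vector_mult_scaleR s_def[symmetric] flip: real_sqrt_mult power2_eq_square)
      moreover have "((1 / sqrt s) *\<^sub>R x) \<bullet> (M *v b j) = 0" if "j \<in> J" for j using x0[OF that] by simp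
      moreover have "b j \<bullet> (M *v ((1 / sqrt s) *\<^sub>R x)) = 0" if "j \<in> J" for j
        using x0[OF that] by (subst sym) simp
      ultimately show ?thesis using that insert.hyps b by (auto simp: b'_def)
    qed
    then show ?case by blast
  qed
  from this[of UNIV] obtain b :: "'n \<Rightarrow> real^'n" where b: "\<And>i j. b i \<bullet> (M *v b j) = of_bool (i = j)" by auto
  define A :: "real^'n^'n" where "A = (\<chi> i j. b j $ i)"
  have "(transpose A ** M ** A) $ i $ j = b i \<bullet> (M *v b j)" for i j
    unfolding matrix_mul_assoc[symmetric]
    by (simp add: matrix_matrix_mult_def A_def transpose_def inner_vec_def matrix_vector_mult_def)
  then have "transpose A ** M ** A = mat 1"
    by (simp add: vec_eq_iff b mat_def)
  with that show ?thesis by blast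
qed

lemma pos_def_matrix_inv:
  fixes S :: "real^'n^'n"
  assumes S: "pos_def S"
  shows "S ** matrix_inv S = mat 1" "matrix_inv S ** S = mat 1" "pos_def (matrix_inv S)" "det S \<noteq> 0"
proof -
  have "S *v x = 0 \<Longrightarrow> x = 0" for x
    using S unfolding pos_def_def by (metis inner_zero_right less_irrefl)
  then have inv: "invertible S" by (metis matrix_left_invertible_ker invertible_left_inverse)
  then show 1: "S ** matrix_inv S = mat 1" "matrix_inv S ** S = mat 1"
    unfolding invertible_def matrix_inv_def by (metis (mono_tags, lifting) someI_ex)+
  show "det S \<noteq> 0" using inv by (simp add: invertible_det_nz)
  show "pos_def (matrix_inv S)" unfolding pos_def_def
  proof (intro conjI allI impI)
    have "transpose (matrix_inv S) ** S = mat 1"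
      using S 1 by (metis matrix_transpose_mul pos_def_def transpose_mat)
    then show "transpose (matrix_inv S) = matrix_inv S"
      by (metis 1(1) matrix_mul_assoc matrix_mul_lid matrix_mul_rid)
    fix v :: "real^'n" assume "v \<noteq> 0"
    define w where "w = matrix_inv S *v v"
    have v: "v = S *v w" by (simp add: w_def matrix_vector_mul_assoc 1)
    then have "w \<noteq> 0" using \<open>v \<noteq> 0\<close> by auto
    then have "w \<bullet> (S *v w) > 0" using S by (simp add: pos_def_def)
    then show "v \<bullet> (matrix_inv S *v v) > 0"
      by (simp add: w_def[symmetric] v[symmetric] inner_commute)
  qed
qed

text \<open>In the coordinates \<open>x = A *v y\<close> the form is |y|^2, and |x| is at most
  \<open>K\<close> |y|, which gives the constant \<open>1 / K^2\<close>.\<close>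

lemma pos_def_lower_bound:
  fixes M :: "real^'n^'n"
  assumes M: "pos_def M"
  obtains c where "c > 0" "\<And>x. x \<bullet> (M *v x) \<ge> c * (norm x)\<^sup>2"
proof -
  obtain A :: "real^'n^'n" where A: "transpose A ** M ** A = mat 1"
    using pos_def_orthonormal_matrix[OF M] by blast
  obtain K where K: "K > 0" "\<And>y. norm (A *v y) \<le> K * norm y"
    using linear_bounded_pos[OF matrix_vector_mul_linear[of A]] by (auto simp: mult.commute)
  have invA: "A ** (transpose A ** M) = mat 1"
    using A by (metis matrix_left_right_inverse)
  have "x \<bullet> (M *v x) \<ge> (1 / K\<^sup>2) * (norm x)\<^sup>2" for x
  proof -
    define y where "y = (transpose A ** M) *v x"
    have x: "x = A *v y" by (simp add: y_def matrix_vector_mul_assoc invA)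
    have "x \<bullet> (M *v x) = y \<bullet> (transpose A *v (M *v (A *v y)))"
      unfolding x by (metis dot_lmul_matrix transpose_matrix_vector transpose_transpose)
    also have "\<dots> = (norm y)\<^sup>2"
      by (simp add: matrix_vector_mul_assoc A matrix_mul_assoc power2_norm_eq_inner)
    finally have "x \<bullet> (M *v x) = (norm y)\<^sup>2" .
    moreover have "(norm x)\<^sup>2 \<le> (K * norm y)\<^sup>2" unfolding x by (intro power_mono K) auto
    ultimately show ?thesis using K(1) by (simp add: field_simps power_mult_distrib)
  qed
  with that[of "1 / K\<^sup>2"] K(1) show ?thesis by simp
qed

text \<open>The substitution \<open>x = A *v y\<close> reduces the exponent to -|y|^2 / 2, and the
  Jacobian satisfies (det A)^2 = det S.\<close>

lemma nn_integral_gauss_pos_def: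
  fixes M :: "real^'n^'n"
  assumes M: "pos_def M" and MS: "M ** S = mat 1"
  shows "(\<integral>\<^sup>+x. ennreal (exp (- (1/2) * ((x - \<mu>) \<bullet> (M *v (x - \<mu>))))) \<partial>lborel)
    = ennreal (sqrt ((2 * pi) ^ CARD('n) * det S))" "det S > 0"
proof -
  obtain A :: "real^'n^'n" where A: "transpose A ** M ** A = mat 1"
    using pos_def_orthonormal_matrix[OF M] by blast
  have d: "(det A)\<^sup>2 * det M = 1"
    using arg_cong[OF A, of det] by (simp add: det_mul det_transpose power2_eq_square mult_ac)
  have "det M * det S = 1" using arg_cong[OF MS, of det] by (simp add: det_mul)
  with d have dS: "det S = (det A)\<^sup>2" by (metis mult.assoc mult.commute mult.right_neutral)
  have dA: "det A \<noteq> 0" using d by auto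
  then show "det S > 0" by (simp add: dS)
  define g where "g x = ennreal (exp (- (1/2) * (x \<bullet> (M *v x))))" for x
  have [measurable]: "g \<in> borel_measurable borel"
    unfolding g_def[abs_def] by (intro measurable_compose[OF _ measurable_ennreal] borel_measurable_continuous_onI continuous_intros)
  have gA: "g (A *v y) = ennreal (exp (- (1/2) * (norm y)\<^sup>2))" for y
  proof -
    have "(A *v y) \<bullet> (M *v (A *v y)) = y \<bullet> (transpose A *v (M *v (A *v y)))"
      by (metis dot_lmul_matrix transpose_matrix_vector transpose_transpose)
    also have "\<dots> = (norm y)\<^sup>2"
      by (simp add: matrix_vector_mul_assoc A matrix_mul_assoc power2_norm_eq_inner)
    finally show ?thesis by (simp add: g_def)
  qed
  have "(\<integral>\<^sup>+x. g (x - \<mu>) \<partial>lborel) = (\<integral>\<^sup>+x. g (x - \<mu>) \<partial>distr lborel borel ((+) \<mu>))"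
    by (simp add: lborel_distr_plus)
  also have "\<dots> = (\<integral>\<^sup>+x. g x \<partial>lborel)"
    by (subst nn_integral_distr) auto
  also have "\<dots> = ennreal \<bar>det A\<bar> * (\<integral>\<^sup>+y. g (A *v y) \<partial>lborel)"
    using nn_integral_lborel_linear[of "(*v) A" g] dA by simp
  also have "\<dots> = ennreal \<bar>det A\<bar> * ennreal (sqrt (pi / (1/2)) ^ CARD('n))"
    unfolding gA by (subst nn_integral_gauss) auto
  also have "\<dots> = ennreal (sqrt ((2 * pi) ^ CARD('n) * det S))"
    unfolding dS real_sqrt_mult[of "(2 * pi) ^ _"] real_sqrt_power[of "2 * pi"] real_sqrt_abs
    by (simp add: mult_ac flip: ennreal_mult)
  finally show "(\<integral>\<^sup>+x. ennreal (exp (- (1/2) * ((x - \<mu>) \<bullet> (M *v (x - \<mu>))))) \<partial>lborel)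
    = ennreal (sqrt ((2 * pi) ^ CARD('n) * det S))" by (simp add: g_def)
qed

subsection \<open>Localised affine functions\<close>

lemma grad_eqI:
  assumes "(f has_derivative (\<lambda>v. g \<bullet> v)) (at x)"
  shows "grad f x = g"
  by (rule euclidean_eqI) (simp add: grad_inner_Basis frechet_eqI[OF assms])

lemma smooth_fn_bump': "smooth_fn bump"
  by (rule cc_smooth_bump[unfolded cc_smooth_def, THEN conjunct1])

lemma tendsto_inverse_Suc: "(\<lambda>n. 1 / real (Suc n)) \<longlonglongrightarrow> 0"
  using LIMSEQ_inverse_real_of_nat by (simp add: inverse_eq_divide)

abbreviation shrunk :: "nat \<Rightarrow> real^'n \<Rightarrow> real^'n \<Rightarrow> real^'n" where
  "shrunk n m x \<equiv> (1 / real (Suc n)) *\<^sub>R (x - m)"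

text \<open>An affine function cut off at radius \<open>n + 1\<close> around \<open>m\<close>. The
  centre is arbitrary because the location parameter of the normal density is not yet known to be
  its mean. The constant part detects the mean, the linear part the covariance.\<close>

definition local_affine :: "real \<Rightarrow> real^'n \<Rightarrow> real^'n \<Rightarrow> nat \<Rightarrow> real^'n \<Rightarrow> real" where
  "local_affine \<alpha> w m n x = (\<alpha> + (x - m) \<bullet> w) * bump (shrunk n m x)"

lemma cc_smooth_local_affine: "cc_smooth (local_affine \<alpha> w m n)"
proof (rule cc_smoothI)
  have "local_affine \<alpha> w m n = (\<lambda>x. ((\<alpha> - m \<bullet> w) + x \<bullet> w) * bump ((1 / real (Suc n)) *\<^sub>R x + - ((1 / real (Suc n)) *\<^sub>R m)))"
    by (auto simp: fun_eq_iff local_affine_def algebra_simps inner_diff_left)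
  then show "smooth_fn (local_affine \<alpha> w m n)"
    by (simp only:) (intro smooth_fn_mult smooth_fn_add smooth_fn_const smooth_fn_inner smooth_fn_affine smooth_fn_bump')
  fix x assume "x \<notin> cball m (real (Suc n))"
  then have "1 < norm (shrunk n m x)"
    unfolding norm_scaleR by (simp add: dist_norm norm_minus_commute[of m] less_divide_eq del: of_nat_Suc)
  then show "local_affine \<alpha> w m n x = 0"
    by (simp add: local_affine_def bump_outside)
qed simp

lemma grad_local_affine:
  "grad (local_affine \<alpha> w m n) x = bump (shrunk n m x) *\<^sub>R w
    + ((\<alpha> + (x - m) \<bullet> w) * (1 / real (Suc n))) *\<^sub>R grad bump (shrunk n m x)"
proof (rule grad_eqI)
  define a where "a = 1 / real (Suc n)"
  have "((\<lambda>x. a *\<^sub>R (x - m)) has_derivative (\<lambda>v. a *\<^sub>R v)) (at x)"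
    by (auto intro!: derivative_eq_intros)
  from has_derivative_compose[OF this smooth_fn_has_grad[OF smooth_fn_bump']]
  have "((\<lambda>x. bump (a *\<^sub>R (x - m))) has_derivative (\<lambda>v. grad bump (a *\<^sub>R (x - m)) \<bullet> (a *\<^sub>R v))) (at x)" .
  moreover have "((\<lambda>x. \<alpha> + (x - m) \<bullet> w) has_derivative (\<lambda>v. v \<bullet> w)) (at x)"
    by (auto intro!: derivative_eq_intros)
  ultimately have "(local_affine \<alpha> w m n has_derivative
    (\<lambda>v. (\<alpha> + (x - m) \<bullet> w) * (grad bump (a *\<^sub>R (x - m)) \<bullet> (a *\<^sub>R v)) + (v \<bullet> w) * bump (a *\<^sub>R (x - m)))) (at x)"
    unfolding local_affine_def[abs_def] a_def[symmetric] by (intro has_derivative_mult)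
  then show "(local_affine \<alpha> w m n has_derivative (\<bullet>) (bump (shrunk n m x) *\<^sub>R w
    + ((\<alpha> + (x - m) \<bullet> w) * (1 / real (Suc n))) *\<^sub>R grad bump (shrunk n m x))) (at x)"
    unfolding a_def[symmetric]
    by (rule has_derivative_eq_rhs) (auto simp: fun_eq_iff inner_add_left inner_commute algebra_simps)
qed

context l2_law
begin

lemma integrable_norm_dev: "integrable P (\<lambda>x. norm (x - m))"
  using integrable_ident by (intro integrable_norm) auto

lemma measurable_bump [measurable]: "bump \<in> borel_measurable (borel :: (real^'n) measure)"
  and measurable_grad_bump [measurable]: "grad bump \<in> borel_measurable (borel :: (real^'n) measure)"
  using smooth_fn_bump' by (auto intro!: borel_measurable_continuous_onI smooth_fn_continuous smooth_fn_continuous_grad)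

lemma tendsto_scaled: "(\<lambda>n. h (shrunk n m x)) \<longlonglongrightarrow> h 0"
  if "continuous_on UNIV h" for h :: "real^'n \<Rightarrow> 'y::topological_space"
proof -
  have lim: "(\<lambda>n. (1 / real (Suc n)) *\<^sub>R (x - m)) \<longlonglongrightarrow> 0 *\<^sub>R (x - m)"
    by (intro tendsto_scaleR tendsto_inverse_Suc tendsto_const)
  have "isCont h (0 *\<^sub>R (x - m))"
    using that by (simp add: continuous_on_eq_continuous_at)
  from isCont_tendsto_compose[OF this lim] show ?thesis
    unfolding scaleR_zero_left .
qed

lemma tendsto_scaled_bump:
  fixes x :: "real^'n"
  shows "(\<lambda>n. bump (shrunk n m x)) \<longlonglongrightarrow> bump (0::real^'n)"
    and "(\<lambda>n. grad bump (shrunk n m x)) \<longlonglongrightarrow> grad bump (0::real^'n)"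
proof -
  have "continuous_on UNIV (bump :: real^'n \<Rightarrow> real)" by (rule smooth_fn_continuous[OF smooth_fn_bump'])
  from tendsto_scaled[OF this] show "(\<lambda>n. bump (shrunk n m x)) \<longlonglongrightarrow> bump (0::real^'n)" .
  have "continuous_on UNIV (grad bump :: real^'n \<Rightarrow> real^'n)" by (rule smooth_fn_continuous_grad[OF smooth_fn_bump'])
  from tendsto_scaled[OF this] show "(\<lambda>n. grad bump (shrunk n m x)) \<longlonglongrightarrow> grad bump (0::real^'n)" .
qed

text \<open>The derivative of the cut-off carries the factor \<open>1 / (n + 1)\<close> and
  disappears pointwise, while the linear growth of the prefactor is dominated by a first moment. The
  cut-off itself tends to \<open>bump 0\<close>, not to 1.\<close>

lemma tendsto_mean_grad_local_affine:
  "(\<lambda>n. \<integral>x. grad (local_affine \<alpha> w m n) x \<partial>P) \<longlonglongrightarrow> bump (0::real^'n) *\<^sub>R w"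
proof -
  let ?b = "\<lambda>x. \<bar>\<alpha>\<bar> + norm (x - m) * norm w"
  obtain B where B: "B > 0" "\<And>x. \<bar>bump (x::real^'n)\<bar> \<le> B" using cc_smooth_bounded[OF cc_smooth_bump] by blast
  obtain G where G: "G > 0" "\<And>x. norm (grad bump (x::real^'n)) \<le> G" using cc_smooth_grad_bounded[OF cc_smooth_bump] by blast
  have "(\<lambda>n. \<integral>x. grad (local_affine \<alpha> w m n) x \<partial>P) \<longlonglongrightarrow> (\<integral>x. bump (0::real^'n) *\<^sub>R w \<partial>P)"
  proof (rule tendsto_integral_dominated[where w="\<lambda>x. B * norm w + ?b x * G"])
    show "integrable P (\<lambda>x. B * norm w + ?b x * G)"
      using integrable_norm_dev[of m] by auto
    show "(\<lambda>n. grad (local_affine \<alpha> w m n) x) \<longlonglongrightarrow> bump (0::real^'n) *\<^sub>R w" for x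
    proof -
      have "(\<lambda>n. grad (local_affine \<alpha> w m n) x) \<longlonglongrightarrow> bump (0::real^'n) *\<^sub>R w + ((\<alpha> + (x - m) \<bullet> w) * 0) *\<^sub>R grad bump (0::real^'n)"
        unfolding grad_local_affine
        by (intro tendsto_add tendsto_scaleR tendsto_mult tendsto_const tendsto_inverse_Suc tendsto_scaled_bump)
      then show ?thesis by simp
    qed
    show "norm (grad (local_affine \<alpha> w m n) x) \<le> B * norm w + ?b x * G" for n x
    proof -
      have 1: "norm (((\<alpha> + (x - m) \<bullet> w) * (1 / real (Suc n))) *\<^sub>R grad bump (shrunk n m x))
        \<le> ?b x * G"
      proof -
        have "\<bar>\<alpha> + (x - m) \<bullet> w\<bar> \<le> ?b x"
          using Cauchy_Schwarz_ineq2[of "x - m" w] by linarith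
        moreover have "\<bar>(\<alpha> + (x - m) \<bullet> w) * (1 / real (Suc n))\<bar> \<le> \<bar>\<alpha> + (x - m) \<bullet> w\<bar>"
          by (simp add: abs_mult divide_le_eq mult_le_cancel_left1)
        ultimately have "\<bar>(\<alpha> + (x - m) \<bullet> w) * (1 / real (Suc n))\<bar> \<le> ?b x" by linarith
        then show ?thesis unfolding norm_scaleR using G by (intro mult_mono) auto
      qed
      have 2: "norm (bump (shrunk n m x) *\<^sub>R w) \<le> B * norm w"
        unfolding norm_scaleR by (intro mult_right_mono B) auto
      show ?thesis
        unfolding grad_local_affine by (rule norm_triangle_mono[OF 2 1])
    qed
  qed (simp_all add: grad_local_affine)
  then show ?thesis using prob_space by simp
qed

lemma tendsto_cross_local_affine:
  "(\<lambda>n. \<integral>x. local_affine \<alpha> w m n x *\<^sub>R (x - m) \<partial>P) \<longlonglongrightarrow> bump (0::real^'n) *\<^sub>R (\<integral>x. (\<alpha> + (x - m) \<bullet> w) *\<^sub>R (x - m) \<partial>P)"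
proof -
  let ?b = "\<lambda>x. \<bar>\<alpha>\<bar> + norm (x - m) * norm w"
  obtain B where B: "B > 0" "\<And>x. \<bar>bump (x::real^'n)\<bar> \<le> B" using cc_smooth_bounded[OF cc_smooth_bump] by blast
  have "(\<lambda>n. \<integral>x. local_affine \<alpha> w m n x *\<^sub>R (x - m) \<partial>P) \<longlonglongrightarrow> (\<integral>x. bump (0::real^'n) *\<^sub>R ((\<alpha> + (x - m) \<bullet> w) *\<^sub>R (x - m)) \<partial>P)"
  proof (rule tendsto_integral_dominated[where w="\<lambda>x. B * (\<bar>\<alpha>\<bar> * norm (x - m) + norm w * (norm (x - m))\<^sup>2)"])
    show "integrable P (\<lambda>x. B * (\<bar>\<alpha>\<bar> * norm (x - m) + norm w * (norm (x - m))\<^sup>2))"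
      using integrable_norm_dev[of m] integrable_norm_sq_dev[of m] by auto
    show "(\<lambda>n. local_affine \<alpha> w m n x *\<^sub>R (x - m)) \<longlonglongrightarrow> bump (0::real^'n) *\<^sub>R ((\<alpha> + (x - m) \<bullet> w) *\<^sub>R (x - m))" for x
    proof -
      have "(\<lambda>n. local_affine \<alpha> w m n x *\<^sub>R (x - m)) \<longlonglongrightarrow> ((\<alpha> + (x - m) \<bullet> w) * bump (0::real^'n)) *\<^sub>R (x - m)"
        unfolding local_affine_def
        by (intro tendsto_scaleR tendsto_mult tendsto_const tendsto_scaled_bump)
      then show ?thesis
        by (simp add: mult.commute)
    qed
    show "norm (local_affine \<alpha> w m n x *\<^sub>R (x - m)) \<le> B * (\<bar>\<alpha>\<bar> * norm (x - m) + norm w * (norm (x - m))\<^sup>2)" for n x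
    proof -
      have "\<bar>\<alpha> + (x - m) \<bullet> w\<bar> \<le> ?b x"
        using Cauchy_Schwarz_ineq2[of "x - m" w] by linarith
      then have "\<bar>local_affine \<alpha> w m n x\<bar> \<le> ?b x * B"
        unfolding local_affine_def abs_mult by (intro mult_mono B) auto
      then have "norm (local_affine \<alpha> w m n x *\<^sub>R (x - m)) \<le> ?b x * B * norm (x - m)"
        unfolding norm_scaleR by (intro mult_right_mono) auto
      then show ?thesis
        by (simp add: power2_eq_square algebra_simps)
    qed
  qed (simp_all add: local_affine_def)
  then show ?thesis by (simp only: integral_scaleR_right)
qed

text \<open>The identity is tested on localised affine functions and the cut-off is removed; the
  common factor \<open>bump 0\<close> cancels. With \<open>w = 0\<close> it locates the mean, with
  \<open>\<alpha> = 0\<close> it inverts the covariance.\<close>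

lemma stein_moments:
  assumes stein: "\<And>f. cc_smooth f \<Longrightarrow> (\<integral>x. grad f x \<partial>P) = M *v (\<integral>x. f x *\<^sub>R (x - m) \<partial>P)"
  shows "M *v (\<integral>x. (\<alpha> + (x - m) \<bullet> w) *\<^sub>R (x - m) \<partial>P) = w"
proof -
  have lim: "(\<lambda>n. M *v (\<integral>x. local_affine \<alpha> w m n x *\<^sub>R (x - m) \<partial>P)) \<longlonglongrightarrow>
      M *v (bump (0::real^'n) *\<^sub>R (\<integral>x. (\<alpha> + (x - m) \<bullet> w) *\<^sub>R (x - m) \<partial>P))"
    by (intro bounded_linear.tendsto[OF matrix_vector_mul_bounded_linear] tendsto_cross_local_affine)
  have eq: "M *v (\<integral>x. local_affine \<alpha> w m n x *\<^sub>R (x - m) \<partial>P) = (\<integral>x. grad (local_affine \<alpha> w m n) x \<partial>P)" for n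
    by (rule stein[OF cc_smooth_local_affine, symmetric])
  have "M *v (bump (0::real^'n) *\<^sub>R (\<integral>x. (\<alpha> + (x - m) \<bullet> w) *\<^sub>R (x - m) \<partial>P)) = bump (0::real^'n) *\<^sub>R w"
    by (rule LIMSEQ_unique[OF lim[unfolded eq] tendsto_mean_grad_local_affine])
  then show ?thesis using bump_0[where 'a="real^'n"] by (simp add: matrix_vector_mult_scaleR)
qed

lemma cov_mat_mult_vec: "(\<integral>x. ((x - \<mu>) \<bullet> w) *\<^sub>R (x - \<mu>) \<partial>P) = cov_mat P *v w"
proof -
  have i: "integrable P (\<lambda>x. ((x - \<mu>) \<bullet> w) *\<^sub>R (x - \<mu>))"
  proof (rule integrable_dominated[of _ "\<lambda>x. norm w * (norm (x - \<mu>))\<^sup>2"])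
    show "norm (((x - \<mu>) \<bullet> w) *\<^sub>R (x - \<mu>)) \<le> norm w * (norm (x - \<mu>))\<^sup>2" for x
      using mult_right_mono[OF Cauchy_Schwarz_ineq2[of "x - \<mu>" w], of "norm (x - \<mu>)"]
      by (simp add: power2_eq_square mult_ac)
  qed (use integrable_dev_norm_sq in auto)
  have "(\<integral>x. ((x - \<mu>) \<bullet> w) *\<^sub>R (x - \<mu>) \<partial>P) \<bullet> v = (cov_mat P *v w) \<bullet> v" for v
  proof -
    have "(\<integral>x. ((x - \<mu>) \<bullet> w) *\<^sub>R (x - \<mu>) \<partial>P) \<bullet> v = expectation (\<lambda>x. (((x - \<mu>) \<bullet> w) *\<^sub>R (x - \<mu>)) \<bullet> v)"
      by (rule integral_inner_left[symmetric]) (rule i)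
    also have "\<dots> = expectation (\<lambda>x. ((x - \<mu>) \<bullet> v) * ((x - \<mu>) \<bullet> w))"
      unfolding inner_scaleR_left by (rule Bochner_Integration.integral_cong[OF refl mult.commute])
    also have "\<dots> = v \<bullet> (cov_mat P *v w)"
      by (rule inner_cov_mat[symmetric])
    finally show ?thesis by (rule trans[OF _ inner_commute])
  qed
  then show ?thesis using vector_eq_rdot by blast
qed

end

subsection \<open>The normal distribution\<close>

lemma tendsto_1_of_bigo:
  assumes "(\<lambda>N. A N - 1) \<in> O(\<lambda>N. 1 / sqrt (real N))"
  shows "A \<longlonglongrightarrow> (1::real)"
proof -
  have "(\<lambda>N. 1 / sqrt (real N)) \<longlonglongrightarrow> 0"
    by (intro tendsto_divide_0[OF tendsto_const] filterlim_at_top_imp_at_infinity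
        filterlim_compose[OF sqrt_at_top] filterlim_real_sequentially)
  then have "(\<lambda>N. 1 / sqrt (real N)) \<in> o(\<lambda>_. 1)" by (intro smalloI_tendsto) auto
  with assms have "(\<lambda>N. A N - 1) \<in> o(\<lambda>_. 1)" by (rule landau_o.big_small_trans)
  from smalloD_tendsto[OF this] have "(\<lambda>N. A N - 1) \<longlonglongrightarrow> 0" by simp
  then show ?thesis by (simp add: LIM_zero_iff)
qed

text \<open>\<open>m\<close> and \<open>S\<close> are only parameters of the density here; that they
  are its mean and covariance is derived later from the Stein identity, without computing moment
  integrals.\<close>

locale gaussian =
  fixes m :: "real^'n" and S :: "real^'n^'n"
  assumes pos_def_S: "pos_def S"
begin

abbreviation "M \<equiv> matrix_inv S"
abbreviation "nd \<equiv> Defs.normal_density m S"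
abbreviation "P \<equiv> density lborel (\<lambda>x. ennreal (nd x))"

definition "Z = sqrt ((2 * pi) ^ CARD('n) * det S)"

abbreviation "qexp x \<equiv> exp (- (1/2) * ((x - m) \<bullet> (M *v (x - m))))"

lemma nd_eq: "nd x = qexp x / Z"
  by (simp add: Defs.normal_density_def Z_def)

lemma Z_pos: "Z > 0"
  using nn_integral_gauss_pos_def(2)[OF pos_def_matrix_inv(3,2)[OF pos_def_S]] by (simp add: Z_def)

lemma nd_pos: "nd x > 0"
  using Z_pos by (simp add: nd_eq)

lemma M_sym: "v \<bullet> (M *v w) = (M *v v) \<bullet> w"
  using pos_def_matrix_inv(3)[OF pos_def_S] unfolding pos_def_def
  by (metis dot_lmul_matrix transpose_matrix_vector)

lemma nd_has_derivative: "(nd has_derivative (\<lambda>v. - ((x - m) \<bullet> (M *v v)) * nd x)) (at x)"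
proof -
  note d = bounded_linear.has_derivative[OF matrix_vector_mul_bounded_linear]
  have "((\<lambda>x. (x - m) \<bullet> (M *v (x - m))) has_derivative (\<lambda>v. (x - m) \<bullet> (M *v v) + v \<bullet> (M *v (x - m)))) (at x)"
    by (auto intro!: derivative_eq_intros d)
  moreover have "(x - m) \<bullet> (M *v v) + v \<bullet> (M *v (x - m)) = 2 * ((x - m) \<bullet> (M *v v))" for v
    using M_sym[of "x - m" v] by (simp add: inner_commute)
  ultimately have "((\<lambda>x. (x - m) \<bullet> (M *v (x - m))) has_derivative (\<lambda>v. 2 * ((x - m) \<bullet> (M *v v)))) (at x)" by simp
  from bounded_linear.has_derivative[OF bounded_linear_divide[of Z] has_derivative_exp[OF has_derivative_mult_right[OF this, of "- (1/2)"]]]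
  have "((\<lambda>x. qexp x / Z) has_derivative
    (\<lambda>v. (qexp x * (- (1/2) * (2 * ((x - m) \<bullet> (M *v v))))) / Z)) (at x)"
    by (simp add: mult.commute)
  then show ?thesis unfolding nd_eq by (rule has_derivative_eq_rhs) (simp add: fun_eq_iff)
qed

lemma continuous_nd: "continuous_on UNIV nd"
  using nd_has_derivative by (meson continuous_at_imp_continuous_on has_derivative_continuous)

lemma measurable_nd [measurable]: "nd \<in> borel_measurable borel"
  by (rule borel_measurable_continuous_onI[OF continuous_nd])

lemma prob_space_P: "prob_space P"
proof
  have "(\<integral>\<^sup>+x. ennreal (nd x) \<partial>lborel) = (\<integral>\<^sup>+x. ennreal (1 / Z) * ennreal (qexp x) \<partial>lborel)"
    using Z_pos by (simp add: nd_eq mult.commute flip: ennreal_mult')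
  also have "\<dots> = ennreal (1 / Z) * (\<integral>\<^sup>+x. ennreal (qexp x) \<partial>lborel)"
  proof (rule nn_integral_cmult)
    have "(\<lambda>x. ennreal (qexp x)) = (\<lambda>x. ennreal (Z * nd x))"
      using Z_pos by (simp add: nd_eq)
    then show "(\<lambda>x. ennreal (qexp x)) \<in> borel_measurable lborel" by simp
  qed
  also have "\<dots> = 1"
    using nn_integral_gauss_pos_def(1)[OF pos_def_matrix_inv(3,2)[OF pos_def_S]] Z_pos
    by (simp only: Z_def[symmetric]) (simp flip: ennreal_mult)
  finally show "emeasure P (space P) = 1" by (simp add: emeasure_density)
qed

lemma integrable_exp_sq:
  assumes "c > 0"
  shows "integrable lborel (\<lambda>x. exp (- c * (norm (x - m))\<^sup>2))"
proof (rule integrableI_nonneg)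
  have "(\<integral>\<^sup>+x. ennreal (exp (- c * (norm (x - m))\<^sup>2)) \<partial>lborel) = (\<integral>\<^sup>+x. ennreal (exp (- c * (norm (x - m))\<^sup>2)) \<partial>distr lborel borel ((+) m))"
    by (simp only: lborel_distr_plus)
  also have "\<dots> = (\<integral>\<^sup>+x. ennreal (exp (- c * (norm x)\<^sup>2)) \<partial>(lborel :: (real^'n) measure))"
    by (subst nn_integral_distr) auto
  also have "\<dots> < \<infinity>" unfolding nn_integral_gauss[OF assms] by simp
  finally show "(\<integral>\<^sup>+x. ennreal (exp (- c * (norm (x - m))\<^sup>2)) \<partial>lborel) < \<infinity>" .
qed auto

lemma integrable_P_fourth: "integrable P (\<lambda>x. (norm (x - m))^4)"
proof -
  obtain c where c: "c > 0" "\<And>x. x \<bullet> (M *v x) \<ge> c * (norm x)\<^sup>2"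
    using pos_def_lower_bound[OF pos_def_matrix_inv(3)[OF pos_def_S]] by blast
  \<comment> \<open>From \<open>power_le_fact_exp\<close> at \<open>(c / 4) * r\<close> with
    exponent 2: half of the decay \<open>exp (- (c / 2) * r)\<close> absorbs \<open>r^2\<close>, and
    the other half stays integrable.\<close>
  define C where "C = 2 * (4 / c)\<^sup>2 / Z"
  have "integrable lborel (\<lambda>x. nd x * (norm (x - m))^4)"
  proof (rule integrable_dominated[of _ "\<lambda>x. C * exp (- (c / 4) * (norm (x - m))\<^sup>2)"])
    show "norm (nd x * (norm (x - m))^4) \<le> C * exp (- (c / 4) * (norm (x - m))\<^sup>2)" for x
    proof -
      define r where "r = (norm (x - m))\<^sup>2"
      have r: "r \<ge> 0" "(norm (x - m))^4 = r\<^sup>2" by (simp_all add: r_def)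
      have "((c / 4) * r)\<^sup>2 \<le> fact 2 * exp ((c / 4) * r)"
        using c(1) r by (intro power_le_fact_exp) simp
      then have "r\<^sup>2 \<le> 2 * (4 / c)\<^sup>2 * exp ((c / 4) * r)"
        using c(1) by (simp add: power_mult_distrib power_divide field_simps)
      moreover have "nd x \<le> exp (- (c / 2) * r) / Z"
        unfolding nd_eq using c(2)[of "x - m"] Z_pos by (intro divide_right_mono) (simp_all add: r_def)
      ultimately have "nd x * r\<^sup>2 \<le> (exp (- (c / 2) * r) / Z) * (2 * (4 / c)\<^sup>2 * exp ((c / 4) * r))"
        using Z_pos nd_pos[of x] by (intro mult_mono) (auto intro: less_imp_le)
      also have "\<dots> = C * (exp (- (c / 2) * r) * exp ((c / 4) * r))" by (simp add: C_def)
      also have "exp (- (c / 2) * r) * exp ((c / 4) * r) = exp (- (c / 4) * r)"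
        unfolding exp_add[symmetric] by (simp add: algebra_simps)
      finally show ?thesis
        unfolding r(2) r_def[symmetric] using nd_pos[of x] by (simp add: abs_mult)
    qed
    show "integrable lborel (\<lambda>x. C * exp (- (c / 4) * (norm (x - m))\<^sup>2))"
      using integrable_exp_sq[of "c / 4"] c(1) by simp
  qed simp
  then show ?thesis
    using nd_pos by (subst integrable_density) (auto intro: less_imp_le)
qed

sublocale l2_law P
proof -
  interpret prob_space P by (rule prob_space_P)
  show "l2_law P"
  proof
    show "integrable P (\<lambda>x. (norm x)\<^sup>2)"
    proof (rule integrable_dominated[of _ "\<lambda>x. 2 * (1 + (norm (x - m))^4) + 2 * (norm m)\<^sup>2"])
      show "norm ((norm x)\<^sup>2) \<le> 2 * (1 + (norm (x - m))^4) + 2 * (norm m)\<^sup>2" for x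
      proof -
        define r where "r = norm (x - m)"
        have "norm x \<le> r + norm m" using norm_triangle_ineq[of "x - m" m] by (simp add: r_def)
        then have "(norm x)\<^sup>2 \<le> (r + norm m)\<^sup>2" by (intro power_mono) auto
        moreover have "(r + norm m)\<^sup>2 \<le> 2 * r\<^sup>2 + 2 * (norm m)\<^sup>2"
          using zero_le_power2[of "r - norm m"] by (simp add: power2_sum power2_diff)
        moreover have "r\<^sup>2 \<le> 1 + r^4"
          using abs_le_1_plus_square[of "r\<^sup>2"] by simp
        ultimately have "(norm x)\<^sup>2 \<le> 2 * r\<^sup>2 + 2 * (norm m)\<^sup>2" "2 * r\<^sup>2 \<le> 2 * (1 + r^4)"
          by (blast intro: order_trans, simp)
        then have "(norm x)\<^sup>2 \<le> 2 * (1 + r^4) + 2 * (norm m)\<^sup>2"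
          by (meson add_right_mono order_trans)
        then show ?thesis unfolding r_def by simp
      qed
    qed (use integrable_P_fourth in auto)
  qed simp
qed

text \<open>The directional derivatives of \<open>f\<close> times the density integrate to 0, and
  differentiating the density multiplies it by \<open>- (x - m) \<bullet> (M *v v)\<close>.\<close>

lemma stein:
  assumes f: "cc_smooth f"
  shows "(\<integral>x. grad f x \<partial>P) = M *v (\<integral>x. f x *\<^sub>R (x - m) \<partial>P)"
proof -
  interpret l2_law_test P f by unfold_locales (rule f)
  obtain B where B: "\<And>x. \<bar>f x\<bar> \<le> B" using cc_smooth_bounded[OF f] by blast
  have ifu: "integrable P (\<lambda>x. f x *\<^sub>R (x - m))"
    by (rule integrable_dominated[of _ "\<lambda>x. B * norm (x - m)"])
      (use B integrable_norm_dev[of m] in \<open>auto intro!: mult_right_mono\<close>)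
  have "(\<integral>x. grad f x \<partial>P) \<bullet> v = (M *v (\<integral>x. f x *\<^sub>R (x - m) \<partial>P)) \<bullet> v" for v
  proof -
    let ?F' = "\<lambda>x v. f x * (- ((x - m) \<bullet> (M *v v)) * nd x) + (grad f x \<bullet> v) * nd x"
    let ?g = "\<lambda>x. nd x *\<^sub>R (grad f x \<bullet> v)" and ?h = "\<lambda>x. nd x *\<^sub>R ((f x *\<^sub>R (x - m)) \<bullet> (M *v v))"
    have dF: "((\<lambda>x. f x * nd x) has_derivative (\<lambda>v. ?F' x v)) (at x)" for x
      using f by (intro has_derivative_mult nd_has_derivative smooth_fn_has_grad) (simp add: cc_smooth_def)
    have "(\<integral>x. ?F' x v \<partial>lborel) = 0"
    proof (rule integral_directional_derivative_eq_0[OF dF, of v "fsupp f"])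
      show "continuous_on UNIV (\<lambda>x. ?F' x v)"
        by (intro continuous_intros continuous_f continuous_grad_f continuous_nd)
      show "bounded (fsupp f)" using f by (simp add: cc_smooth_def compact_imp_bounded)
    qed (simp add: not_in_fsupp)
    moreover have i1: "integrable P (\<lambda>x. (grad f x) \<bullet> v)" and i2: "integrable P (\<lambda>x. (f x *\<^sub>R (x - m)) \<bullet> (M *v v))"
      by (rule integrable_inner_left, rule integrable_grad_f) (rule integrable_inner_left, rule ifu)
    have j1: "integrable lborel (\<lambda>x. ?g x)"
      using i1 nd_pos by (subst (asm) integrable_density) (auto intro: less_imp_le)
    have j2: "integrable lborel (\<lambda>x. ?h x)"
      using i2 nd_pos by (subst (asm) integrable_density) (auto intro: less_imp_le)
    have "(\<integral>x. ?g x - ?h x \<partial>lborel) = 0"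
      using calculation by (simp add: algebra_simps)
    then have "(\<integral>x. ?g x \<partial>lborel) = (\<integral>x. ?h x \<partial>lborel)"
      using j1 j2 by simp
    moreover have "expectation (\<lambda>x. grad f x \<bullet> v) = (\<integral>x. ?g x \<partial>lborel)"
      using nd_pos by (intro integral_density) (auto intro: less_imp_le)
    moreover have "expectation (\<lambda>x. (f x *\<^sub>R (x - m)) \<bullet> (M *v v)) = (\<integral>x. ?h x \<partial>lborel)"
      using nd_pos by (intro integral_density) (auto intro: less_imp_le)
    moreover have "expectation (\<lambda>x. grad f x \<bullet> v) = (\<integral>x. grad f x \<partial>P) \<bullet> v"
      by (rule integral_inner_left) (rule integrable_grad_f)
    moreover have "expectation (\<lambda>x. (f x *\<^sub>R (x - m)) \<bullet> (M *v v)) = (\<integral>x. f x *\<^sub>R (x - m) \<partial>P) \<bullet> (M *v v)"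
      by (rule integral_inner_left) (rule ifu)
    ultimately show ?thesis using M_sym by simp
  qed
  then show ?thesis using vector_eq_rdot by blast
qed

lemma S_M: "S *v (M *v x) = x"
  by (simp add: matrix_vector_mul_assoc pos_def_matrix_inv[OF pos_def_S])

lemma mean_vec_P: "mean_vec P = m"
proof -
  have "M *v (\<integral>x. x - m \<partial>P) = 0"
    using stein_moments[OF stein, of 1 0] by simp
  then have "(\<integral>x. x - m \<partial>P) = 0" by (metis S_M matrix_vector_mult_0_right)
  then show ?thesis using integrable_ident prob_space by (simp add: mean_vec_def)
qed

lemma cov_mat_P: "cov_mat P = S"
proof -
  have "M *v (cov_mat P *v w) = w" for w
    using stein_moments[OF stein, of 0 w] cov_mat_mult_vec[of w] by (simp add: mean_vec_P)
  then have "cov_mat P *v w = S *v w" for w by (metis S_M)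
  then show ?thesis by (simp add: matrix_eq)
qed

end

locale gaussian_test = gaussian m S for m :: "real^'n" and S +
  fixes f :: "real^'n \<Rightarrow> real"
  assumes cc_f': "cc_smooth f"
begin

sublocale l2_law_test P f
  by unfold_locales (rule cc_f')

lemma cross_cov_eq: "cross_cov = S *v mean_grad"
  unfolding mean_grad_def cross_cov_def stein[OF cc_f'] mean_vec_P S_M ..

abbreviation "limit_var \<equiv> varM P f - mean_grad \<bullet> (S *v mean_grad)"

lemma expectation_lin_sq_eq: "expectation (\<lambda>x. (lin x)\<^sup>2) = limit_var"
  unfolding expectation_lin_sq cross_cov_eq cov_mat_P by (simp add: inner_commute)

lemma fourth: "integrable P (\<lambda>x. (norm (x - mean_vec P))^4)"
  unfolding mean_vec_P by (rule integrable_P_fourth)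

text \<open>A vanishing limit variance makes \<open>f\<close> affine, so compact support forces \<open>f = 0\<close>.\<close>

lemma f_eq_0:
  assumes "expectation (\<lambda>x. (lin x)\<^sup>2) = 0"
  shows "f x = 0"
proof -
  have "AE x in P. (lin x)\<^sup>2 = 0"
    using assms integrable_lin_sq by (subst (asm) integral_nonneg_eq_0_iff_AE) auto
  \<comment> \<open>Positivity of the density turns a null set of the law into a Lebesgue null set;
    by continuity the closed set of zeros of \<open>lin\<close> is then everything.\<close>
  then have "AE x in lborel. lin x = 0"
    using nd_pos by (subst (asm) AE_density) auto
  then have "AE x in lebesgue. x \<in> {x. lin x = 0}" by (auto intro: AE_completion)
  moreover have "closed {x. lin x = 0}"
    unfolding lin_def by (intro closed_Collect_eq continuous_intros continuous_f)
  ultimately have "lin x = 0" for x using mem_closed_if_AE_lebesgue by blast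
  then have "f x = expectation f + mean_grad \<bullet> (x - mean_vec P)" for x
    by (simp add: lin_def algebra_simps)
  then obtain c g where f: "\<And>x. f x = c + g \<bullet> (x - mean_vec P)" by blast
  obtain R where R: "\<And>x. norm x > R \<Longrightarrow> f x = 0"
  proof -
    have "bounded (fsupp f)" using cc_f' by (simp add: cc_smooth_def compact_imp_bounded)
    then obtain R where "\<And>x. x \<in> fsupp f \<Longrightarrow> norm x \<le> R" by (auto simp: bounded_iff)
    then show ?thesis using that[of R] not_in_fsupp by (meson not_le)
  qed
  \<comment> \<open>Long enough to push both \<open>x + w\<close> and \<open>x - w\<close> out of
    the support; an affine function at \<open>x\<close> is the average of its values at these two
    points.\<close>
  define w :: "real^'n" where "w = (\<bar>R\<bar> + norm x + 1) *\<^sub>R axis undefined 1"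
  have nw: "norm w = \<bar>R\<bar> + norm x + 1" by (simp add: w_def)
  have "norm (x + w) > R" "norm (x - w) > R"
    using norm_triangle_ineq4[of "x + w" x] norm_triangle_ineq4[of x "x - w"] nw
    by (auto simp: algebra_simps)
  then have "f (x + w) = 0" "f (x - w) = 0" using R by auto
  moreover have "f (x + w) + f (x - w) = 2 * f x"
    unfolding f by (simp add: inner_diff_right inner_add_right)
  ultimately show ?thesis by simp
qed

lemma mean_grad_components: "(\<chi> i. \<integral>x. pderiv_i f i x \<partial>P) = mean_grad"
proof -
  have "(\<integral>x. pderiv_i f i x \<partial>P) = mean_grad $ i" for i
  proof -
    have "pderiv_i f i x = grad f x \<bullet> axis i 1" for x
      using cc_f' by (simp add: pderiv_i_def frechet_grad smooth_fn_differentiable cc_smooth_def)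
    then have "(\<integral>x. pderiv_i f i x \<partial>P) = (\<integral>x. grad f x \<partial>P) \<bullet> axis i 1"
      by (simp add: integral_inner_left[OF integrable_grad_f])
    then show ?thesis by (simp add: mean_grad_def inner_axis)
  qed
  then show ?thesis by (simp add: vec_eq_iff)
qed

text \<open>The factor \<open>A N\<close> is the ratio of the exact variance to its limit, so a zero
  limit must be excluded first. In that case \<open>f = 0\<close> and both sides vanish
  exactly.\<close>

lemma mm_var_expansion:
  "\<exists>A :: nat \<Rightarrow> real. (\<lambda>N. A N - 1) \<in> O(\<lambda>N. 1 / sqrt (real N)) \<and> (\<forall>N\<ge>1. mm_var P f N =
      A N / real N * limit_var)"
proof (cases "expectation (\<lambda>x. (lin x)\<^sup>2) = 0")
  case True
  then have "f = (\<lambda>_. 0)" using f_eq_0 by auto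
  then have "mm_var P f N = 0" for N by (simp add: mm_var_def varM_def)
  then show ?thesis using True by (intro exI[of _ "\<lambda>_. 1"]) (simp add: expectation_lin_sq_eq)
next
  case False
  define V where "V = expectation (\<lambda>x. (lin x)\<^sup>2)"
  have "V \<ge> 0" by (simp add: V_def)
  moreover have "V \<noteq> 0" using False by (simp add: V_def)
  ultimately have V: "V > 0" by simp
  obtain C where C: "\<And>N. N \<ge> 1 \<Longrightarrow> \<bar>real N * mm_var P f N - V\<bar> \<le> C / sqrt (real N)"
    using mm_var_asymptotics[OF fourth] unfolding V_def by blast
  define A where "A N = real N * mm_var P f N / V" for N
  have "norm (A N - 1) \<le> (C / V) * norm (1 / sqrt (real N))" if "N \<ge> 1" for N
  proof -
    have "A N - 1 = (real N * mm_var P f N - V) / V" using V by (simp add: A_def diff_divide_distrib)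
    then have "\<bar>A N - 1\<bar> = \<bar>real N * mm_var P f N - V\<bar> / V" using V by simp
    also have "\<dots> \<le> (C / sqrt (real N)) / V" using C[OF that] V by (intro divide_right_mono) auto
    finally show ?thesis by (simp add: mult.commute)
  qed
  then have "(\<lambda>N. A N - 1) \<in> O(\<lambda>N. 1 / sqrt (real N))"
    by (intro bigoI[of _ "C / V"]) (auto simp: eventually_sequentially)
  moreover have "mm_var P f N = A N / real N * V" if "N \<ge> 1" for N
    using V that by (simp add: A_def)
  ultimately show ?thesis unfolding V_def expectation_lin_sq_eq by blast
qed

lemma mean_grad_quadratic_nonneg: "mean_grad \<bullet> (S *v mean_grad) \<ge> 0"
  using pos_def_S unfolding pos_def_def by (cases "mean_grad = 0") (auto intro: less_imp_le)

lemma mm_var_le: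
  "\<exists>A :: nat \<Rightarrow> real. A \<longlonglongrightarrow> 1 \<and> (\<forall>N\<ge>1. mm_var P f N \<le> A N / real N * varM P f)"
proof -
  obtain A :: "nat \<Rightarrow> real" where A: "(\<lambda>N. A N - 1) \<in> O(\<lambda>N. 1 / sqrt (real N))"
    "\<And>N. N \<ge> 1 \<Longrightarrow> mm_var P f N = A N / real N * limit_var"
    using mm_var_expansion by blast
  have V: "limit_var \<ge> 0"
    unfolding expectation_lin_sq_eq[symmetric] by simp
  \<comment> \<open>The expansion does not tell the sign of \<open>A N\<close> for small
    \<open>N\<close>. The absolute value has the same limit and lets \<open>limit_var\<close> be
    enlarged to \<open>varM P f\<close>.\<close>
  have "(\<lambda>N. \<bar>A N\<bar>) \<longlonglongrightarrow> \<bar>1\<bar>" by (intro tendsto_rabs tendsto_1_of_bigo A)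
  moreover have "mm_var P f N \<le> \<bar>A N\<bar> / real N * varM P f" if "N \<ge> 1" for N
  proof -
    have "mm_var P f N \<le> \<bar>A N\<bar> / real N * limit_var"
      unfolding A(2)[OF that] using V by (intro mult_right_mono divide_right_mono) auto
    also have "\<dots> \<le> \<bar>A N\<bar> / real N * varM P f"
      using mean_grad_quadratic_nonneg by (intro mult_left_mono) auto
    finally show ?thesis .
  qed
  ultimately show ?thesis by (intro exI[of _ "\<lambda>N. \<bar>A N\<bar>"]) auto
qed

lemma mm_var_limit_less:
  assumes "mean_grad \<noteq> 0"
  shows "\<exists>L. (\<lambda>N. real N * mm_var P f N) \<longlonglongrightarrow> L \<and> L < varM P f"
proof -
  obtain A :: "nat \<Rightarrow> real" where A: "(\<lambda>N. A N - 1) \<in> O(\<lambda>N. 1 / sqrt (real N))"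
    "\<And>N. N \<ge> 1 \<Longrightarrow> mm_var P f N = A N / real N * limit_var"
    using mm_var_expansion by blast
  have "(\<lambda>N. A N * limit_var) \<longlonglongrightarrow> 1 * limit_var"
    by (intro tendsto_mult tendsto_1_of_bigo A tendsto_const)
  moreover have "\<forall>\<^sub>F N in sequentially. A N * limit_var = real N * mm_var P f N"
    unfolding eventually_sequentially using A(2) by (intro exI[of _ 1]) auto
  ultimately have "(\<lambda>N. real N * mm_var P f N) \<longlonglongrightarrow> 1 * limit_var"
    by (rule Lim_transform_eventually)
  moreover have "mean_grad \<bullet> (S *v mean_grad) > 0" using pos_def_S assms by (simp add: pos_def_def)
  ultimately show ?thesis
    by (intro exI[of _ "1 * limit_var"] conjI) simp_all
qed

end

section \<open>Universality of the normal law\<close>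

context gaussian
begin

lemma test_fn_nd: "test_fn nd f \<longleftrightarrow> cc_smooth f"
proof -
  have "fsupp nd = UNIV" using nd_pos by (simp add: fsupp_def less_imp_neq[symmetric])
  then show ?thesis by (simp add: test_fn_def cc_smooth_def)
qed

text \<open>Localised coordinate functions have mean gradients tending to a nonzero multiple of a
  unit vector, so they cannot all be 0. Such an \<open>f\<close> gives the strict variance
  reduction; \<open>undefined\<close> picks an arbitrary coordinate.\<close>

lemma exists_mean_grad_nonzero: "\<exists>f. cc_smooth f \<and> (\<integral>x. grad f x \<partial>P) \<noteq> 0"
proof (rule ccontr)
  assume "\<not> ?thesis"
  then have "(\<integral>x. grad (local_affine 0 (axis undefined 1) m n) x \<partial>P) = 0" for n
    using cc_smooth_local_affine by blast
  then have "bump (0::real^'n) *\<^sub>R axis undefined 1 = (0::real^'n)"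
    using tendsto_mean_grad_local_affine[of 0 "axis undefined 1" m] by (simp add: LIMSEQ_const_iff)
  then show False using bump_0[where 'a="real^'n"] by simp
qed

lemma aumm1_gaussian: "aumm1 P nd"
  unfolding aumm1_def test_fn_nd
proof (intro conjI allI impI)
  fix f :: "real^'n \<Rightarrow> real" assume f: "cc_smooth f"
  interpret gaussian_test m S f by unfold_locales (rule f)
  show "\<exists>A :: nat \<Rightarrow> real. A \<longlonglongrightarrow> 1 \<and> (\<forall>N\<ge>1. mm_var P f N \<le> A N / real N * varM P f)"
    by (rule mm_var_le)
next
  obtain f where f: "cc_smooth f" "(\<integral>x. grad f x \<partial>P) \<noteq> 0" using exists_mean_grad_nonzero by blast
  interpret gaussian_test m S f by unfold_locales (rule f(1))
  show "\<exists>f. cc_smooth f \<and> (\<exists>L. (\<lambda>N. real N * mm_var P f N) \<longlonglongrightarrow> L \<and> L < varM P f)"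
    using f mm_var_limit_less by (auto simp: mean_grad_def)
qed

end

subsection \<open>Characterisation of the normal distribution\<close>

lemma grad_add_scale:
  assumes "smooth_fn f" "smooth_fn g"
  shows "grad (\<lambda>x. f x + c * g x) x = grad f x + c *\<^sub>R grad g x"
proof (rule grad_eqI)
  have "((\<lambda>x. f x + c * g x) has_derivative (\<lambda>v. grad f x \<bullet> v + c * (grad g x \<bullet> v))) (at x)"
    using assms by (intro has_derivative_add has_derivative_mult_right smooth_fn_has_grad)
  then show "((\<lambda>x. f x + c * g x) has_derivative (\<bullet>) (grad f x + c *\<^sub>R grad g x)) (at x)"
    by (rule has_derivative_eq_rhs) (simp add: fun_eq_iff inner_add_left)
qed

lemma test_fn_add_scale:
  assumes "test_fn p f" "test_fn p g"
  shows "test_fn p (\<lambda>x. f x + c * g x)"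
proof -
  have sm: "smooth_fn f" "smooth_fn g" and cc: "cc_smooth f" "cc_smooth g"
    using assms by (auto simp: test_fn_def cc_smooth_def)
  have "cc_smooth (\<lambda>x. f x + c * g x)"
    by (intro cc_smooth_add cc_smooth_mult smooth_fn_const cc)
  moreover have "closed (fsupp f \<union> fsupp g)" by (simp add: fsupp_def closed_Un)
  then have "fsupp (\<lambda>x. f x + c * g x) \<subseteq> fsupp f \<union> fsupp g"
    by (rule fsupp_subset) (simp add: not_in_fsupp)
  ultimately show ?thesis using assms unfolding test_fn_def cc_smooth_def by blast
qed

lemma test_fn_0: "test_fn p (\<lambda>x. 0)"
  by (auto simp: test_fn_def fsupp_def smooth_fn_const)

lemma integrable_continuous_vanishing:
  fixes h :: "'a::euclidean_space \<Rightarrow> real"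
  assumes "continuous_on UNIV h" "\<And>z. z \<notin> cball 0 1 \<Longrightarrow> h z = 0"
  shows "integrable lborel h"
proof -
  have "integrable lborel (\<lambda>x. indicator (cball 0 1) x *\<^sub>R h x)"
    using continuous_on_subset[OF assms(1)] by (intro borel_integrable_compact) auto
  moreover have "(\<lambda>x. indicator (cball 0 1) x *\<^sub>R h x) = h"
    using assms(2) by (auto simp: indicator_def fun_eq_iff)
  ultimately show ?thesis by simp
qed

lemma grad_bump_outside: "z \<notin> cball 0 1 \<Longrightarrow> grad bump z = 0"
proof -
  assume z: "z \<notin> cball 0 1"
  have "fsupp bump \<subseteq> cball (0::'a) 1" by (rule fsupp_subset) (auto simp: bump_outside)
  with z have "z \<notin> fsupp bump" by blast
  then show ?thesis by (simp add: grad_def frechet_outside_fsupp)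
qed

lemma integral_bump_pos: "(\<integral>z. bump (z::'a::euclidean_space) \<partial>lborel) > 0"
proof -
  have c: "continuous_on UNIV (bump :: 'a \<Rightarrow> real)" by (rule smooth_fn_continuous[OF smooth_fn_bump'])
  have i: "integrable lborel (bump :: 'a \<Rightarrow> real)"
    by (rule integrable_continuous_vanishing[OF c]) (rule bump_outside)
  have "(\<integral>z. bump (z::'a) \<partial>lborel) \<noteq> 0"
  proof
    assume "(\<integral>z. bump (z::'a) \<partial>lborel) = 0"
    then have "AE z in lborel. bump (z::'a) = 0"
      using i by (subst (asm) integral_nonneg_eq_0_iff_AE) (auto simp: bump_nonneg)
    then have "AE z in lebesgue. z \<in> {z. bump (z::'a) = 0}" by (auto intro: AE_completion)
    moreover have "closed {z. bump (z::'a) = 0}"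
      using c by (intro closed_Collect_eq continuous_intros) auto
    ultimately have "bump (0::'a) = 0" using mem_closed_if_AE_lebesgue by blast
    with bump_0[where 'a='a] show False by simp
  qed
  moreover have "(\<integral>z. bump (z::'a) \<partial>lborel) \<ge> 0"
    by (intro Bochner_Integration.integral_nonneg bump_nonneg)
  ultimately show ?thesis by linarith
qed

locale density_law =
  fixes p :: "real^'n \<Rightarrow> real"
  assumes prob: "prob_space (density lborel (\<lambda>x. ennreal (p x)))"
    and meas_p [measurable]: "p \<in> borel_measurable borel"
    and p_nonneg: "p x \<ge> 0"
    and diff_p: "p differentiable (at x)"
    and int_sq: "integrable (density lborel (\<lambda>x. ennreal (p x))) (\<lambda>x. (norm x)\<^sup>2)"
begin

abbreviation "P \<equiv> density lborel (\<lambda>x. ennreal (p x))"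

sublocale l2_law P
proof -
  interpret prob_space P by (rule prob)
  show "l2_law P" by unfold_locales (use int_sq in auto)
qed

lemma continuous_p: "continuous_on UNIV p"
  using diff_p by (meson continuous_at_imp_continuous_on differentiable_imp_continuous_within)

lemma expectation_p:
  fixes h :: "real^'n \<Rightarrow> real"
  assumes "h \<in> borel_measurable borel"
  shows "expectation h = (\<integral>x. p x * h x \<partial>lborel)"
  using assms p_nonneg by (subst integral_density) auto

lemma integrable_cross:
  assumes "cc_smooth f"
  shows "integrable P (\<lambda>x. f x *\<^sub>R (x - \<mu>))"
proof -
  interpret l2_law_test P f by unfold_locales (rule assms)
  show ?thesis by (rule integrable_f_dev)
qed

lemma integrable_grad:
  assumes "cc_smooth f"
  shows "integrable P (grad f)"
proof -
  interpret l2_law_test P f by unfold_locales (rule assms)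
  show ?thesis by (rule integrable_grad_f)
qed

abbreviation "K f \<equiv> (\<integral>x. f x *\<^sub>R (x - \<mu>) \<partial>P)"
abbreviation "G f \<equiv> (\<integral>x. grad f x \<partial>P)"

text \<open>Since \<open>E f(X) (X - \<mu>) = 0\<close> forces \<open>E \<partial>f(X) = 0\<close>, the second functional factors linearly
  through the first.\<close>

lemma stein_matrix:
  assumes key: "\<And>f. test_fn p f \<Longrightarrow> K f = 0 \<Longrightarrow> G f = 0"
  obtains M :: "real^'n^'n" where "\<And>f. test_fn p f \<Longrightarrow> G f = M *v K f"
proof -
  have cc: "cc_smooth f" "smooth_fn f" if "test_fn p f" for f using that by (auto simp: test_fn_def cc_smooth_def)
  have K: "K (\<lambda>x. f x + c * g x) = K f + c *\<^sub>R K g" if "test_fn p f" "test_fn p g" for f g c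
    using integrable_cross[OF cc(1)[OF that(1)]] integrable_cross[OF cc(1)[OF that(2)]]
    by (simp add: scaleR_add_left flip: scaleR_scaleR)
  have G: "G (\<lambda>x. f x + c * g x) = G f + c *\<^sub>R G g" if "test_fn p f" "test_fn p g" for f g c
    unfolding grad_add_scale[OF cc(2)[OF that(1)] cc(2)[OF that(2)]]
    using integrable_grad[OF cc(1)[OF that(1)]] integrable_grad[OF cc(1)[OF that(2)]] by simp
  have K0: "K (\<lambda>_. 0) = 0" by simp
  have G0: "G (\<lambda>_. 0) = 0" using key[OF test_fn_0] by simp
  \<comment> \<open>\<open>W\<close> is the joint range of the two functionals, a subspace by
    linearity. The hypothesis \<open>key\<close> says that its first projection is injective, so
    \<open>W\<close> is the graph of a linear map.\<close>
  define W where "W = {(K f, G f) | f. test_fn p f}"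
  have W: "(K f, G f) \<in> W" if "test_fn p f" for f using that by (auto simp: W_def)
  have sub: "subspace W"
  proof (rule subspaceI)
    show "0 \<in> W" using W[OF test_fn_0[of p]] by (simp add: K0 G0 zero_prod_def)
  next
    fix x y assume "x \<in> W" "y \<in> W"
    then obtain f g where f: "test_fn p f" "x = (K f, G f)" and g: "test_fn p g" "y = (K g, G g)" by (auto simp: W_def)
    show "x + y \<in> W" using W[OF test_fn_add_scale[OF f(1) g(1), of 1]] K[OF f(1) g(1), of 1] G[OF f(1) g(1), of 1] f g by simp
  next
    fix c x assume "x \<in> W"
    then obtain f where f: "test_fn p f" "x = (K f, G f)" by (auto simp: W_def)
    show "c *\<^sub>R x \<in> W" using W[OF test_fn_add_scale[OF test_fn_0 f(1), of c]] K[OF test_fn_0 f(1), of c] G[OF test_fn_0 f(1), of c] f K0 G0 by simp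
  qed
  have inj: "inj_on fst W"
  proof (rule inj_onI)
    fix x y assume "x \<in> W" "y \<in> W" and xy: "fst x = fst y"
    then obtain f g where f: "test_fn p f" "x = (K f, G f)" and g: "test_fn p g" "y = (K g, G g)" by (auto simp: W_def)
    have "K (\<lambda>x. f x + (-1) * g x) = 0" using K[OF f(1) g(1), of "-1"] f g xy by simp
    then have "G (\<lambda>x. f x + (-1) * g x) = 0" using key[OF test_fn_add_scale[OF f(1) g(1), of "-1"]] by simp
    then show "x = y" using G[OF f(1) g(1), of "-1"] f g xy by simp
  qed
  \<comment> \<open>A linear left inverse of the projection, defined on the whole space; its second
    component is the required matrix.\<close>
  obtain h where h: "linear h" "\<And>w. w \<in> W \<Longrightarrow> h (fst w) = w"
    using linear_exists_left_inverse_on[OF linear_fst sub inj] by blast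
  have "linear (snd \<circ> h)" by (rule linear_compose[OF h(1) linear_snd])
  then have "G f = matrix (snd \<circ> h) *v K f" if "test_fn p f" for f
    using h(2)[OF W[OF that]] by simp
  with that show ?thesis by simp
qed

text \<open>Apply the identity to bumps shrinking to \<open>x0\<close>; only differentiability of \<open>p\<close> at \<open>x0\<close> enters.\<close>

lemma density_derivative:
  fixes M :: "real^'n^'n"
  assumes M: "\<And>f. test_fn p f \<Longrightarrow> G f = M *v K f"
    and x0: "x0 \<in> interior (fsupp p)" and dp: "(p has_derivative p') (at x0)"
  shows "p' v = - (p x0 * ((M *v (x0 - \<mu>)) \<bullet> v))"
proof -
  define q where "q y = p y * ((M *v (y - \<mu>)) \<bullet> v)" for y
  have contq: "continuous_on UNIV q"
    unfolding q_def by (intro continuous_intros continuous_p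
      bounded_linear.continuous_on[OF matrix_vector_mul_bounded_linear])
  have [measurable]: "q \<in> borel_measurable borel" by (rule borel_measurable_continuous_onI[OF contq])
  have cb: "continuous_on UNIV (bump :: real^'n \<Rightarrow> real)" by (rule smooth_fn_continuous[OF smooth_fn_bump'])
  have cgb: "continuous_on UNIV (\<lambda>z::real^'n. grad bump z \<bullet> v)"
    by (intro continuous_intros smooth_fn_continuous_grad[OF smooth_fn_bump'])
  obtain e where e: "e > 0" "ball x0 e \<subseteq> interior (fsupp p)"
    using x0 open_interior openE by blast
  \<comment> \<open>Differentiability at the single point already bounds the difference quotients by
    \<open>B + 1\<close>, which later serves as the dominating function.\<close>
  obtain \<delta> where \<delta>: "\<delta> > 0" "\<And>h. norm h < \<delta> \<Longrightarrow> \<bar>p (x0 + h) - p x0 - p' h\<bar> \<le> norm h"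
  proof -
    have "\<exists>d>0. \<forall>y. norm (y - x0) < d \<longrightarrow> norm (p y - p x0 - p' (y - x0)) \<le> 1 * norm (y - x0)"
      using dp unfolding has_derivative_at_alt by (metis zero_less_one)
    then obtain d where d: "d > 0" "\<And>y. norm (y - x0) < d \<Longrightarrow> norm (p y - p x0 - p' (y - x0)) \<le> 1 * norm (y - x0)" by blast
    show ?thesis using that[of d] d(1) d(2)[of "x0 + _"] by simp
  qed
  have linp': "linear p'" using dp has_derivative_linear by blast
  have cp': "continuous_on UNIV p'" using linp' by (simp add: linear_continuous_on linear_linear)
  obtain B where B: "B > 0" "\<And>z. \<bar>p' z\<bar> \<le> B * norm z"
    using linear_bounded_pos[OF linp'] by (auto simp: mult.commute)
  obtain n0 where n0: "1 / real (Suc n0) < min e \<delta>"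
    using reals_Archimedean[of "min e \<delta>"] e \<delta> by (auto simp: inverse_eq_divide)
  \<comment> \<open>The offset \<open>n0\<close> makes every rescaled bump, from
    \<open>n = 0\<close> on, fit both into the interior of the support and into the
    \<delta>-neighbourhood of \<open>x0\<close>.\<close>
  define r where "r n = real (Suc (n + n0))" for n
  have r: "r n \<ge> 1" "1 / r n < e" "1 / r n < \<delta>" "r n > 0" for n
  proof -
    have "1 / r n \<le> 1 / real (Suc n0)" unfolding r_def by (intro divide_left_mono) auto
    then show "1 / r n < e" "1 / r n < \<delta>" using n0 by auto
    show "r n \<ge> 1" "r n > 0" by (auto simp: r_def)
  qed
  have rlim: "filterlim (\<lambda>n. 1 / r n) (at 0) sequentially"
  proof -
    have "(\<lambda>n. 1 / r n) \<longlonglongrightarrow> 0" unfolding r_def using LIMSEQ_ignore_initial_segment[OF tendsto_inverse_Suc, of n0] by simp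
    then show ?thesis using r(4) by (auto simp: filterlim_at less_imp_neq[symmetric])
  qed
  let ?y = "\<lambda>n z. x0 + (1 / r n) *\<^sub>R z"
  let ?D = "\<lambda>n z. r n * (p (?y n z) - p x0) * (grad bump z \<bullet> v)"
  \<comment> \<open>Both sides of the matrix identity are rescaled by
    \<open>y = x0 + z / r n\<close>, and the common Jacobian cancels. The gradient of the bump has
    integral 0, so \<open>p x0\<close> may be subtracted to form a difference quotient.\<close>
  have relation: "(\<integral>z. ?D n z \<partial>lborel)
      = (\<integral>z. q (?y n z) * bump z \<partial>lborel)" for n
  proof -
    define f where "f y = bump (r n *\<^sub>R (y - x0))" for y
    have gradf: "grad f y = r n *\<^sub>R grad bump (r n *\<^sub>R (y - x0))" for y
    proof (rule grad_eqI)
      have "((\<lambda>y. r n *\<^sub>R (y - x0)) has_derivative (\<lambda>v. r n *\<^sub>R v)) (at y)"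
        by (auto intro!: derivative_eq_intros)
      from has_derivative_compose[OF this smooth_fn_has_grad[OF smooth_fn_bump']]
      show "(f has_derivative (\<bullet>) (r n *\<^sub>R grad bump (r n *\<^sub>R (y - x0)))) (at y)"
        unfolding f_def[abs_def] by (rule has_derivative_eq_rhs) (simp add: fun_eq_iff)
    qed
    have f0: "f y = 0" if "y \<notin> cball x0 (1 / r n)" for y
      unfolding f_def
    proof (rule bump_outside)
      show "r n *\<^sub>R (y - x0) \<notin> cball 0 1"
        using that r(4)[of n] unfolding mem_cball dist_norm norm_minus_commute[of x0] diff_0 norm_minus_cancel norm_scaleR
        by (simp add: field_simps)
    qed
    have sm: "smooth_fn f"
    proof -
      have "f = (\<lambda>y. bump (r n *\<^sub>R y + - (r n *\<^sub>R x0)))" by (simp add: f_def fun_eq_iff algebra_simps)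
      then show ?thesis by (simp only:) (intro smooth_fn_affine smooth_fn_bump')
    qed
    have "cc_smooth f" by (rule cc_smoothI[OF sm compact_cball f0])
    moreover have "fsupp f \<subseteq> cball x0 (1 / r n)" by (rule fsupp_subset[OF closed_cball f0])
    moreover have "cball x0 (1 / r n) \<subseteq> ball x0 e" using r(2)[of n] by auto
    ultimately have test: "test_fn p f" using e(2) unfolding test_fn_def cc_smooth_def by blast
    note cc = \<open>cc_smooth f\<close>
    interpret l2_law_test P f by unfold_locales (rule cc)
    have Gv: "G f \<bullet> v = (1 / r n) ^ CARD('n) * (\<integral>z. r n * p (?y n z) * (grad bump z \<bullet> v) \<partial>lborel)"
    proof -
      have "G f \<bullet> v = expectation (\<lambda>x. grad f x \<bullet> v)"
        by (rule integral_inner_left[symmetric]) (rule integrable_grad[OF cc])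
      also have "\<dots> = (\<integral>x. p x * (grad f x \<bullet> v) \<partial>lborel)"
        by (rule expectation_p) measurable
      also have "\<dots> = \<bar>1 / r n\<bar> ^ DIM(real^'n) * (\<integral>z. p (?y n z) * (grad f (?y n z) \<bullet> v) \<partial>lborel)"
        using r(4)[of n] by (intro integral_lborel_affine) auto
      also have "\<dots> = (1 / r n) ^ CARD('n) * (\<integral>z. r n * p (?y n z) * (grad bump z \<bullet> v) \<partial>lborel)"
        using r(4)[of n] by (simp add: gradf mult_ac)
      finally show ?thesis .
    qed
    have Kv: "(M *v K f) \<bullet> v = (1 / r n) ^ CARD('n) * (\<integral>z. q (?y n z) * bump z \<partial>lborel)"
    proof -
      have adj: "(M *v y) \<bullet> v = y \<bullet> (transpose M *v v)" for y
        by (metis dot_lmul_matrix inner_commute transpose_matrix_vector)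
      have "(M *v K f) \<bullet> v = expectation (\<lambda>x. (f x *\<^sub>R (x - \<mu>)) \<bullet> (transpose M *v v))"
        unfolding adj by (rule integral_inner_left[symmetric]) (rule integrable_cross[OF cc])
      also have "\<dots> = (\<integral>x. p x * ((f x *\<^sub>R (x - \<mu>)) \<bullet> (transpose M *v v)) \<partial>lborel)"
        by (rule expectation_p) measurable
      also have "\<dots> = (\<integral>x. q x * f x \<partial>lborel)"
        by (simp add: q_def adj mult_ac)
      also have "\<dots> = \<bar>1 / r n\<bar> ^ DIM(real^'n) * (\<integral>z. q (?y n z) * f (?y n z) \<partial>lborel)"
        using r(4)[of n] by (intro integral_lborel_affine) auto
      also have "\<dots> = (1 / r n) ^ CARD('n) * (\<integral>z. q (?y n z) * bump z \<partial>lborel)"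
        using r(4)[of n] by (simp add: f_def)
      finally show ?thesis .
    qed
    have "(\<integral>z. r n * p (?y n z) * (grad bump z \<bullet> v) \<partial>lborel) = (\<integral>z. q (?y n z) * bump z \<partial>lborel)"
      using Gv Kv M[OF test] r(4)[of n] by simp
    moreover have "(\<integral>z. grad bump (z::real^'n) \<bullet> v \<partial>lborel) = 0"
      by (rule integral_directional_derivative_eq_0[OF smooth_fn_has_grad[OF smooth_fn_bump'] cgb bounded_cball bump_outside])
    moreover have "integrable lborel (\<lambda>z. r n * p (?y n z) * (grad bump z \<bullet> v))"
      by (rule integrable_continuous_vanishing)
        (auto intro!: continuous_intros continuous_on_compose2[OF continuous_p] cgb simp: grad_bump_outside)
    moreover have "integrable lborel (\<lambda>z::real^'n. grad bump z \<bullet> v)"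
      by (rule integrable_continuous_vanishing[OF cgb]) (simp add: grad_bump_outside)
    ultimately show ?thesis
      by (simp add: algebra_simps)
  qed
  have lim1: "(\<lambda>n. \<integral>z. ?D n z \<partial>lborel)
      \<longlonglongrightarrow> (\<integral>z. p' z * (grad bump z \<bullet> v) \<partial>lborel)"
  proof (rule tendsto_integral_dominated[where w="\<lambda>z. (B + 1) * \<bar>grad bump z \<bullet> v\<bar>"])
    show "integrable lborel (\<lambda>z::real^'n. (B + 1) * \<bar>grad bump z \<bullet> v\<bar>)"
      by (rule integrable_continuous_vanishing) (auto intro!: continuous_intros cgb simp: grad_bump_outside)
    show "(\<lambda>n. ?D n z) \<longlonglongrightarrow> p' z * (grad bump z \<bullet> v)" for z
    proof (intro tendsto_mult tendsto_const)
      have l: "((\<lambda>s. x0 + s *\<^sub>R z) has_derivative (\<lambda>h. h *\<^sub>R z)) (at 0)" by (auto intro!: derivative_eq_intros)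
      have "((\<lambda>s. p (x0 + s *\<^sub>R z)) has_derivative (\<lambda>h. p' (h *\<^sub>R z))) (at 0)"
        by (rule has_derivative_compose[OF l]) (simp add: dp)
      then have "((\<lambda>s. p (x0 + s *\<^sub>R z)) has_real_derivative p' z) (at 0)"
        by (simp add: has_field_derivative_def linear_scale[OF linp'] mult_commute_abs)
      then have "((\<lambda>s. (p (x0 + s *\<^sub>R z) - p x0) / s) \<longlongrightarrow> p' z) (at 0)"
        by (simp add: has_field_derivative_iff)
      from filterlim_compose[OF this rlim]
      show "(\<lambda>n. r n * (p (?y n z) - p x0)) \<longlonglongrightarrow> p' z"
        by (simp add: mult.commute)
    qed
    show "norm (?D n z) \<le> (B + 1) * \<bar>grad bump z \<bullet> v\<bar>" for n z
    proof -
      show ?thesis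
      proof (cases "z \<in> cball 0 1")
        case True
        then have nz: "norm z \<le> 1" by simp
        define h where "h = (1 / r n) *\<^sub>R z"
        have nh: "norm h = norm z / r n" using r(4)[of n] by (simp add: h_def)
        have "norm h \<le> 1 / r n" using nz r(4)[of n] unfolding nh by (intro divide_right_mono) auto
        then have "norm h < \<delta>" using r(3)[of n] by linarith
        from \<delta>(2)[OF this] B(2)[of h] have "\<bar>p (x0 + h) - p x0\<bar> \<le> (B + 1) * norm h" by (simp add: algebra_simps)
        then have "r n * \<bar>p (x0 + h) - p x0\<bar> \<le> r n * ((B + 1) * norm h)"
          using r(4)[of n] by (intro mult_left_mono) auto
        also have "\<dots> = (B + 1) * norm z" using r(4)[of n] by (simp add: nh)
        also have "\<dots> \<le> (B + 1) * 1" using nz B(1) by (intro mult_left_mono) auto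
        finally have "\<bar>r n * (p (x0 + h) - p x0)\<bar> \<le> B + 1" using r(4)[of n] by (simp add: abs_mult)
        then show ?thesis unfolding h_def[symmetric] norm_mult by (simp add: mult_right_mono)
      next
        case False
        then show ?thesis by (simp add: grad_bump_outside)
      qed
    qed
    show "(\<lambda>z. p' z * (grad bump z \<bullet> v)) \<in> borel_measurable lborel"
      using borel_measurable_continuous_onI[OF continuous_on_mult[OF cp' cgb]] by simp
    show "(\<lambda>z. ?D n z) \<in> borel_measurable lborel" for n
      by measurable
  qed
  have lim2: "(\<lambda>n. \<integral>z. q (?y n z) * bump z \<partial>lborel) \<longlonglongrightarrow> (\<integral>z. q x0 * bump (z::real^'n) \<partial>lborel)"
  proof -
    have "bounded (q ` cball x0 1)"
      by (intro compact_imp_bounded compact_continuous_image continuous_on_subset[OF contq]) auto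
    then obtain Bq where Bq: "\<And>y. y \<in> cball x0 1 \<Longrightarrow> \<bar>q y\<bar> \<le> Bq"
      by (auto simp: bounded_iff simp del: mem_cball)
    show ?thesis
    proof (rule tendsto_integral_dominated[where w="\<lambda>z. Bq * bump z"])
      show "integrable lborel (\<lambda>z::real^'n. Bq * bump z)"
        by (rule integrable_continuous_vanishing) (auto intro!: continuous_intros cb simp: bump_outside)
      show "(\<lambda>n. q (?y n z) * bump z) \<longlonglongrightarrow> q x0 * bump z" for z
      proof (intro tendsto_mult tendsto_const)
        have "(\<lambda>n. 1 / r n) \<longlonglongrightarrow> 0" using rlim by (simp add: filterlim_at)
        then have "(\<lambda>n. x0 + (1 / r n) *\<^sub>R z) \<longlonglongrightarrow> x0 + 0 *\<^sub>R z" by (intro tendsto_intros)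
        then have l: "(\<lambda>n. x0 + (1 / r n) *\<^sub>R z) \<longlonglongrightarrow> x0" by simp
        have "isCont q x0" using contq by (simp add: continuous_on_eq_continuous_at)
        from isCont_tendsto_compose[OF this l] show "(\<lambda>n. q (?y n z)) \<longlonglongrightarrow> q x0" .
      qed
      show "norm (q (?y n z) * bump z) \<le> Bq * bump z" for n z
      proof -
        show ?thesis
        proof (cases "z \<in> cball 0 1")
          case True
          then have "norm ((1 / r n) *\<^sub>R z) \<le> 1" using r(1)[of n] by (simp add: divide_le_eq)
          then have "\<bar>q (?y n z)\<bar> \<le> Bq" by (intro Bq) (simp add: dist_norm)
          then show ?thesis by (simp add: abs_mult bump_nonneg mult_right_mono)
        next
          case False
          then show ?thesis by (simp add: bump_outside)
        qed
      qed
    qed measurable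
  qed
  have "(\<integral>z. p' z * (grad bump z \<bullet> v) \<partial>lborel) = (\<integral>z. q x0 * bump (z::real^'n) \<partial>lborel)"
    by (rule LIMSEQ_unique[OF lim1[unfolded relation] lim2])
  \<comment> \<open>Integration by parts for the linear function \<open>p'\<close> against the bump
    turns the limit on the left into \<open>- p' v\<close> times the integral of the bump.\<close>
  moreover have "(\<integral>z. p' z * (grad bump z \<bullet> v) + p' v * bump z \<partial>lborel) = 0"
  proof (rule integral_directional_derivative_eq_0[of "\<lambda>z. p' z * bump z" "\<lambda>z v. p' z * (grad bump z \<bullet> v) + p' v * bump z" v "cball 0 1"])
    show "((\<lambda>z. p' z * bump z) has_derivative (\<lambda>v. p' z * (grad bump z \<bullet> v) + p' v * bump z)) (at z)" for z
      using linp' by (intro has_derivative_mult linear_imp_has_derivative smooth_fn_has_grad smooth_fn_bump')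
    show "continuous_on UNIV (\<lambda>z. p' z * (grad bump z \<bullet> v) + p' v * bump z)"
      by (intro continuous_on_add continuous_on_mult continuous_on_const cp' cgb cb)
  qed (auto simp: bump_outside)
  moreover have "integrable lborel (\<lambda>z. p' z * (grad bump z \<bullet> v))"
    by (rule integrable_continuous_vanishing[OF continuous_on_mult[OF cp' cgb]]) (simp add: grad_bump_outside)
  moreover have "integrable lborel (\<lambda>z::real^'n. bump z)"
    by (rule integrable_continuous_vanishing[OF cb]) (rule bump_outside)
  ultimately have "(q x0 + p' v) * (\<integral>z. bump (z::real^'n) \<partial>lborel) = 0"
    by (simp add: algebra_simps)
  then have "q x0 + p' v = 0" using integral_bump_pos[where 'a="real^'n"] by simp
  then show ?thesis by (simp add: q_def)
qed

text \<open>At a zero of \<open>p\<close> the derivative vanishes because \<open>p\<close> is minimal there, so the differential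
  equation holds on the whole space and not only inside the support.\<close>

lemma density_gaussian_form:
  fixes M :: "real^'n^'n"
  assumes M: "\<And>f. test_fn p f \<Longrightarrow> G f = M *v K f"
  shows "p x = p \<mu> * exp (- (1/2) * ((x - \<mu>) \<bullet> (M *v (x - \<mu>))))"
proof -
  have der: "frechet_derivative p (at y) v = - (p y * ((M *v (y - \<mu>)) \<bullet> v))" for y v
  proof (cases "p y = 0")
    case True
    have "(p has_derivative frechet_derivative p (at y)) (at y)"
      using diff_p frechet_derivative_works by blast
    then have "frechet_derivative p (at y) = (\<lambda>v. 0)"
      by (rule differential_zero_maxmin[of y UNIV, rotated 2]) (use True p_nonneg in auto)
    then show ?thesis using True by simp
  next
    case False
    have "open {y. p y \<noteq> 0}" using continuous_p by (intro open_Collect_neq continuous_intros) auto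
    moreover have "{y. p y \<noteq> 0} \<subseteq> fsupp p" by (simp add: fsupp_def closure_subset)
    ultimately have "y \<in> interior (fsupp p)" using False by (meson interiorI mem_Collect_eq)
    from density_derivative[OF M this, of "frechet_derivative p (at y)" v] show ?thesis
      using diff_p frechet_derivative_works by blast
  qed
  define u where "u = x - \<mu>"
  define k where "k = u \<bullet> (M *v u)"
  \<comment> \<open>On the ray from \<mu> through \<open>x\<close> the equation becomes scalar, with
    solution a multiple of \<open>exp (- t^2 * k / 2)\<close>, so \<phi> is constant. Symmetry of
    \<open>M\<close> is not known yet; a ray sees only its quadratic form.\<close>
  define \<phi> where "\<phi> t = p (\<mu> + t *\<^sub>R u) * exp (t\<^sup>2 * k / 2)" for t
  have "(\<phi> has_real_derivative 0) (at t)" for t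
  proof -
    have l: "((\<lambda>s. \<mu> + s *\<^sub>R u) has_derivative (\<lambda>h. h *\<^sub>R u)) (at t)" by (auto intro!: derivative_eq_intros)
    have "((\<lambda>s. p (\<mu> + s *\<^sub>R u)) has_derivative (\<lambda>h. frechet_derivative p (at (\<mu> + t *\<^sub>R u)) (h *\<^sub>R u))) (at t)"
      by (rule has_derivative_compose[OF l]) (use diff_p frechet_derivative_works in blast)
    then have "((\<lambda>s. p (\<mu> + s *\<^sub>R u)) has_real_derivative - (p (\<mu> + t *\<^sub>R u) * (t * k))) (at t)"
      unfolding has_field_derivative_def der
      by (rule has_derivative_eq_rhs) (simp add: fun_eq_iff matrix_vector_mult_scaleR k_def inner_commute)
    moreover have "((\<lambda>s. exp (s\<^sup>2 * k / 2)) has_real_derivative exp (t\<^sup>2 * k / 2) * (t * k)) (at t)"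
      by (auto intro!: derivative_eq_intros)
    ultimately have "(\<phi> has_real_derivative - (p (\<mu> + t *\<^sub>R u) * (t * k)) * exp (t\<^sup>2 * k / 2) + exp (t\<^sup>2 * k / 2) * (t * k) * p (\<mu> + t *\<^sub>R u)) (at t)"
      unfolding \<phi>_def[abs_def] by (rule DERIV_mult)
    then show ?thesis by (simp add: algebra_simps)
  qed
  then have "\<phi> 1 = \<phi> 0" using DERIV_isconst_all by blast
  then show ?thesis by (simp add: \<phi>_def u_def[symmetric] k_def[symmetric] exp_minus field_simps) (simp add: u_def mult.commute)
qed

text \<open>The explicit Gaussian form makes \<open>p\<close> positive everywhere, which admits all
  compactly supported test functions and identifies \<open>M\<close> as the inverse covariance. The
  remaining constant is fixed by the total mass.\<close>

lemma density_normal: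
  assumes det: "det (cov_mat P) \<noteq> 0"
    and universal: "\<And>f. test_fn p f \<Longrightarrow> \<exists>A::nat \<Rightarrow> real. A \<longlonglongrightarrow> 1 \<and> (\<forall>N\<ge>1. mm_var P f N \<le> A N / real N * varM P f)"
  shows "pos_def (cov_mat P)" "p = Defs.normal_density (mean_vec P) (cov_mat P)"
proof -
  show pd: "pos_def (cov_mat P)" by (rule cov_mat_pos_def[OF det])
  have key: "G f = 0" if f: "test_fn p f" and z: "K f = 0" for f
  proof -
    interpret l2_law_test P f by unfold_locales (use f in \<open>simp add: test_fn_def cc_smooth_def\<close>)
    obtain A :: "nat \<Rightarrow> real" where A: "A \<longlonglongrightarrow> 1" "\<And>N. N \<ge> 1 \<Longrightarrow> mm_var P f N \<le> A N / real N * varM P f"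
      using universal[OF f] by blast
    have "cross_cov = 0" using z by (simp add: cross_cov_def)
    from mean_grad_eq_0[OF A this det] show ?thesis by (simp add: mean_grad_def)
  qed
  obtain M :: "real^'n^'n" where M: "\<And>f. test_fn p f \<Longrightarrow> G f = M *v K f"
    using stein_matrix[OF key] by blast
  have form: "p x = p \<mu> * exp (- (1/2) * ((x - \<mu>) \<bullet> (M *v (x - \<mu>))))" for x
    by (rule density_gaussian_form[OF M])
  have mass: "(\<integral>\<^sup>+x. ennreal (p x) \<partial>lborel) = 1"
    using emeasure_space_1 by (simp add: emeasure_density)
  \<comment> \<open>Otherwise the explicit form would make \<open>p\<close> vanish identically,
    contradicting total mass 1.\<close>
  have p\<mu>: "p \<mu> > 0"
  proof (rule ccontr)
    assume "\<not> p \<mu> > 0"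
    then have "p \<mu> = 0" using p_nonneg[of \<mu>] by simp
    then have "p x = 0" for x using form[of x] by simp
    then show False using mass by simp
  qed
  have "p x \<noteq> 0" for x using form[of x] p\<mu> by simp
  then have "fsupp p = UNIV" by (simp add: fsupp_def)
  \<comment> \<open>Only now do the localised affine functions of every radius count as test
    functions, as \<open>stein_moments\<close> demands.\<close>
  then have "cc_smooth f \<Longrightarrow> test_fn p f" for f by (simp add: test_fn_def cc_smooth_def)
  then have "M *v (\<integral>x. (0 + (x - \<mu>) \<bullet> w) *\<^sub>R (x - \<mu>) \<partial>P) = w" for w
    by (intro stein_moments M)
  then have MC: "M *v (cov_mat P *v w) = w" for w by (simp add: cov_mat_mult_vec)
  have "M *v x = matrix_inv (cov_mat P) *v x" for x
    using MC[of "matrix_inv (cov_mat P) *v x"] by (simp add: matrix_vector_mul_assoc pos_def_matrix_inv(1)[OF pd])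
  interpret g: gaussian \<mu> "cov_mat P" by unfold_locales (rule pd)
  \<comment> \<open>Two proportional densities of mass 1 coincide, so the factor in front must be
    1.\<close>
  have nd: "p x = (p \<mu> * g.Z) * g.nd x" for x
    using form[of x] g.Z_pos \<open>\<And>x. M *v x = matrix_inv (cov_mat P) *v x\<close> by (simp add: g.nd_eq)
  have "(\<integral>\<^sup>+x. ennreal (g.nd x) \<partial>lborel) = 1"
    using g.emeasure_space_1 by (simp add: emeasure_density)
  moreover have "(\<integral>\<^sup>+x. ennreal (p x) \<partial>lborel) = (\<integral>\<^sup>+x. ennreal (p \<mu> * g.Z) * ennreal (g.nd x) \<partial>lborel)"
  proof (rule nn_integral_cong)
    fix x
    have "0 \<le> p \<mu> * g.Z" using p\<mu> g.Z_pos by simp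
    from ennreal_mult'[OF this] show "ennreal (p x) = ennreal (p \<mu> * g.Z) * ennreal (g.nd x)"
      by (rule trans[OF arg_cong[OF nd]])
  qed
  ultimately have "ennreal (p \<mu> * g.Z) = 1" using mass by (simp add: nn_integral_cmult)
  then have one: "p \<mu> * g.Z = 1" by simp
  show "p = Defs.normal_density (mean_vec P) (cov_mat P)"
  proof (rule ext)
    show "p x = g.nd x" for x by (rule trans[OF nd]) (unfold one, rule mult_1)
  qed
qed

end

theorem theorem2p1:
  shows
   "(\<forall>(\<mu>::real^'n) (\<Sigma>::real^'n^'n). pos_def \<Sigma> \<longrightarrow>
       (let P = density lborel (\<lambda>x. ennreal (normal_density \<mu> \<Sigma> x)) in
          aumm1 P (normal_density \<mu> \<Sigma>) \<and>
          (\<forall>f. smooth_fn f \<and> compact (fsupp f) \<longrightarrow>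
             (\<exists>A :: nat \<Rightarrow> real.
                (\<lambda>N. A N - 1) \<in> O(\<lambda>N. 1 / sqrt (real N)) \<and>
                (\<forall>N\<ge>1. mm_var P f N =
                   A N / real N *
                   (varM P f -
                    (let g = (\<chi> i. \<integral>x. pderiv_i f i x \<partial>P) in g \<bullet> (\<Sigma> *v g))))))))
    \<and>
    (\<forall>(p :: real^'n \<Rightarrow> real).
       let P = density lborel (\<lambda>x. ennreal (p x)) in
       (prob_space P \<and> p \<in> borel_measurable borel \<and> (\<forall>x. p x \<ge> 0) \<and>
        (\<forall>x. p differentiable (at x)) \<and>
        integrable P (\<lambda>x. (norm x)\<^sup>2) \<and> det (cov_mat P) \<noteq> 0 \<and> aumm1 P p)
       \<longrightarrow> (\<exists>\<mu> \<Sigma>. pos_def \<Sigma> \<and> P = density lborel (\<lambda>x. ennreal (normal_density \<mu> \<Sigma> x))))"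
proof (unfold Let_def, rule conjI; intro allI impI)
  fix \<mu> :: "real^'n" and \<Sigma> :: "real^'n^'n" assume "pos_def \<Sigma>"
  then interpret gaussian \<mu> \<Sigma> by unfold_locales
  show "aumm1 P (normal_density \<mu> \<Sigma>) \<and> (\<forall>f. smooth_fn f \<and> compact (fsupp f) \<longrightarrow>
     (\<exists>A :: nat \<Rightarrow> real. (\<lambda>N. A N - 1) \<in> O(\<lambda>N. 1 / sqrt (real N)) \<and>
        (\<forall>N\<ge>1. mm_var P f N = A N / real N *
           (varM P f - (\<chi> i. \<integral>x. pderiv_i f i x \<partial>P) \<bullet> (\<Sigma> *v (\<chi> i. \<integral>x. pderiv_i f i x \<partial>P))))))"
    (is "_ \<and> (\<forall>f. _ \<longrightarrow> ?expansion f)")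
  proof (intro conjI allI impI aumm1_gaussian)
    fix f :: "real^'n \<Rightarrow> real" assume "smooth_fn f \<and> compact (fsupp f)"
    then interpret gaussian_test \<mu> \<Sigma> f by unfold_locales (simp add: cc_smooth_def)
    show "?expansion f"
      unfolding mean_grad_components by (rule mm_var_expansion)
  qed
next
  fix p :: "real^'n \<Rightarrow> real"
  assume h: "prob_space (density lborel (\<lambda>x. ennreal (p x))) \<and> p \<in> borel_measurable borel \<and> (\<forall>x. p x \<ge> 0) \<and>
        (\<forall>x. p differentiable (at x)) \<and>
        integrable (density lborel (\<lambda>x. ennreal (p x))) (\<lambda>x. (norm x)\<^sup>2) \<and>
        det (cov_mat (density lborel (\<lambda>x. ennreal (p x)))) \<noteq> 0 \<and> aumm1 (density lborel (\<lambda>x. ennreal (p x))) p"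
  then interpret density_law p by (intro density_law.intro) blast+
  have det: "det (cov_mat P) \<noteq> 0" and univ: "aumm1 P p" using h by blast+
  note normal = density_normal[OF det univ[unfolded aumm1_def, THEN conjunct1, rule_format]]
  have "P = density lborel (\<lambda>x. ennreal (normal_density (mean_vec P) (cov_mat P) x))"
    by (rule arg_cong[OF normal(2)])
  with normal(1) show "\<exists>\<mu> \<Sigma>. pos_def \<Sigma> \<and> P = density lborel (\<lambda>x. ennreal (normal_density \<mu> \<Sigma> x))"
    by blast
qed

end
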